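(* Let $K$ be a field, let $(E,C)$ be a separated graph, and let $S$ be any subset of $C_{\rm fin}$. Then the algebra $CL_K(E,C,S)$ is hereditary.
   Context: A graph is a directed graph $E=(E^0,E^1,s,r)$ with $E^0$ a nonempty set (no finiteness or countability assumptions). A separated graph is a pair $(E,C)$ where $C=\bigsqcup_{v\in E^0}C_v$ and each $C_v$ is a partition of $s^{-1}(v)$ into pairwise disjoint nonempty subsets ($C_v=\emptyset$ if $v$ is a sink). $C_{\rm fin}$ denotes the set of finite members of $C$. The Cohn–Leavitt algebra $CL_K(E,C,S)$ is the (not necessarily unital) associative $K$-algebra with generators $\{v,e,e^*\mid v\in E^0,\ e\in E^1\}$ and relations: (V) $vv'=\delta_{v,v'}v$; (E1) $s(e)e=er(e)=e$; (E2) $r(e)e^*=e^*s(e)=e^*$; (SCK1) $e^*e'=\delta_{e,e'}r(e)$ for $e,e'\in X$, $X\in C$; and (SCK2) $v=\sum_{e\in X}ee^*$ for $X\in S\cap C_v$, $v\in E^0$. For a (not necessarily unital) ring $R$, $R\text{-Mod}$ denotes the category of those left $R$-modules $M$ which are full ($RM=M$) and nondegenerate ($Rx=0$ implies $x=0$, for $x\in M$), with arbitrary module homomorphisms as morphisms. $R$ is left hereditary if every subobject of a projective object in $R\text{-Mod}$ is projective (in $R\text{-Mod}$). Right hereditary is defined symmetrically, and $R$ is hereditary if it is both left and right hereditary. *)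

theory Defs
  imports
    "HOL-Algebra.Generated_Groups"
    "HOL-Algebra.Module"
    "HOL-Algebra.QuotRing"
    "HOL-Library.Poly_Mapping"
    "HOL-Library.Disjoint_Sets"
    "HOL-Library.Equipollence"
    "Graph_Theory.Digraph"
begin

section \<open>Rings and modules without unit\<close>

text \<open>
  Non-unital rings are carried by the record type of rings of HOL-Algebra, and modules over them by
  the record type of modules. The field \<open>one\<close> of a non-unital ring is never used, and neither are
  the fields \<open>mult\<close> and \<open>one\<close> of a module.
\<close>

locale nonunital_ring = abelian_group R for R (structure) +
  assumes m_closed: "\<lbrakk>a \<in> carrier R; b \<in> carrier R\<rbrakk> \<Longrightarrow> a \<otimes> b \<in> carrier R"
    and m_assoc: "\<lbrakk>a \<in> carrier R; b \<in> carrier R; c \<in> carrier R\<rbrakk>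
      \<Longrightarrow> (a \<otimes> b) \<otimes> c = a \<otimes> (b \<otimes> c)"
    and l_distr: "\<lbrakk>a \<in> carrier R; b \<in> carrier R; c \<in> carrier R\<rbrakk>
      \<Longrightarrow> (a \<oplus> b) \<otimes> c = a \<otimes> c \<oplus> b \<otimes> c"
    and r_distr: "\<lbrakk>a \<in> carrier R; b \<in> carrier R; c \<in> carrier R\<rbrakk>
      \<Longrightarrow> a \<otimes> (b \<oplus> c) = a \<otimes> b \<oplus> a \<otimes> c"

definition opposite_ring :: "('r, 'z) ring_scheme \<Rightarrow> ('r, 'z) ring_scheme"
  where "opposite_ring R = R\<lparr>mult := (\<lambda>a b. b \<otimes>\<^bsub>R\<^esub> a)\<rparr>"

locale left_module = abelian_group M for R :: "('r, 'z) ring_scheme" and M :: "('r, 'm) module" +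
  assumes smult_closed: "\<lbrakk>a \<in> carrier R; x \<in> carrier M\<rbrakk> \<Longrightarrow> a \<odot>\<^bsub>M\<^esub> x \<in> carrier M"
    and smult_l_distr: "\<lbrakk>a \<in> carrier R; b \<in> carrier R; x \<in> carrier M\<rbrakk>
      \<Longrightarrow> (a \<oplus>\<^bsub>R\<^esub> b) \<odot>\<^bsub>M\<^esub> x = a \<odot>\<^bsub>M\<^esub> x \<oplus>\<^bsub>M\<^esub> b \<odot>\<^bsub>M\<^esub> x"
    and smult_r_distr: "\<lbrakk>a \<in> carrier R; x \<in> carrier M; y \<in> carrier M\<rbrakk>
      \<Longrightarrow> a \<odot>\<^bsub>M\<^esub> (x \<oplus>\<^bsub>M\<^esub> y) = a \<odot>\<^bsub>M\<^esub> x \<oplus>\<^bsub>M\<^esub> a \<odot>\<^bsub>M\<^esub> y"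
    and smult_assoc: "\<lbrakk>a \<in> carrier R; b \<in> carrier R; x \<in> carrier M\<rbrakk>
      \<Longrightarrow> (a \<otimes>\<^bsub>R\<^esub> b) \<odot>\<^bsub>M\<^esub> x = a \<odot>\<^bsub>M\<^esub> (b \<odot>\<^bsub>M\<^esub> x)"

text \<open>\<open>RM\<close> is the additive subgroup of \<open>M\<close> generated by the products \<open>a x\<close>.\<close>

definition full_module :: "('r, 'z) ring_scheme \<Rightarrow> ('r, 'm) module \<Rightarrow> bool"
  where "full_module R M \<longleftrightarrow>
    generate (add_monoid M) {a \<odot>\<^bsub>M\<^esub> x | a x. a \<in> carrier R \<and> x \<in> carrier M} = carrier M"

definition nondegenerate_module :: "('r, 'z) ring_scheme \<Rightarrow> ('r, 'm) module \<Rightarrow> bool"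
  where "nondegenerate_module R M \<longleftrightarrow>
    (\<forall>x\<in>carrier M. (\<forall>a\<in>carrier R. a \<odot>\<^bsub>M\<^esub> x = \<zero>\<^bsub>M\<^esub>) \<longrightarrow> x = \<zero>\<^bsub>M\<^esub>)"

section \<open>The category \<open>R\<close>-Mod and hereditary rings\<close>

text \<open>
  A category of modules has to live in a universe. Here the universe is a type \<open>'m\<close>: the objects
  of \<open>R\<close>-Mod are the full nondegenerate modules whose carrier is a set of elements of \<open>'m\<close>.
  If \<open>'m\<close> is infinite and at least as large as \<open>R\<close>, then it contains copies of all modules
  generated by at most \<open>card 'm\<close> elements. Every module embeds into some such type.
  Morphisms are functions on carriers; two morphisms are equal if they agree on the carrier of their
  source. Monomorphism, epimorphism and projective object have their categorical meaning.
\<close>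

definition mod_object :: "('r, 'z) ring_scheme \<Rightarrow> ('r, 'm) module \<Rightarrow> bool"
  where "mod_object R M \<longleftrightarrow> left_module R M \<and> full_module R M \<and> nondegenerate_module R M"

definition mod_morphisms ::
    "('r, 'z) ring_scheme \<Rightarrow> ('r, 'm) module \<Rightarrow> ('r, 'm) module \<Rightarrow> ('m \<Rightarrow> 'm) set"
  where "mod_morphisms R M N = {f. f \<in> carrier M \<rightarrow> carrier N \<and>
    (\<forall>x\<in>carrier M. \<forall>y\<in>carrier M. f (x \<oplus>\<^bsub>M\<^esub> y) = f x \<oplus>\<^bsub>N\<^esub> f y) \<and>
    (\<forall>a\<in>carrier R. \<forall>x\<in>carrier M. f (a \<odot>\<^bsub>M\<^esub> x) = a \<odot>\<^bsub>N\<^esub> f x)}"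

definition mod_mono ::
    "('r, 'z) ring_scheme \<Rightarrow> ('r, 'm) module \<Rightarrow> ('r, 'm) module \<Rightarrow> ('m \<Rightarrow> 'm) \<Rightarrow> bool"
  where "mod_mono R M N f \<longleftrightarrow> f \<in> mod_morphisms R M N \<and>
    (\<forall>L :: ('r, 'm) module. mod_object R L \<longrightarrow>
      (\<forall>g\<in>mod_morphisms R L M. \<forall>h\<in>mod_morphisms R L M.
        (\<forall>x\<in>carrier L. f (g x) = f (h x)) \<longrightarrow> (\<forall>x\<in>carrier L. g x = h x)))"

definition mod_epi ::
    "('r, 'z) ring_scheme \<Rightarrow> ('r, 'm) module \<Rightarrow> ('r, 'm) module \<Rightarrow> ('m \<Rightarrow> 'm) \<Rightarrow> bool"
  where "mod_epi R M N f \<longleftrightarrow> f \<in> mod_morphisms R M N \<and>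
    (\<forall>L :: ('r, 'm) module. mod_object R L \<longrightarrow>
      (\<forall>g\<in>mod_morphisms R N L. \<forall>h\<in>mod_morphisms R N L.
        (\<forall>x\<in>carrier M. g (f x) = h (f x)) \<longrightarrow> (\<forall>y\<in>carrier N. g y = h y)))"

definition projective_object :: "('r, 'z) ring_scheme \<Rightarrow> ('r, 'm) module \<Rightarrow> bool"
  where "projective_object R P \<longleftrightarrow> mod_object R P \<and>
    (\<forall>(M :: ('r, 'm) module) (N :: ('r, 'm) module) p g.
      mod_object R M \<and> mod_object R N \<and> mod_epi R M N p \<and> g \<in> mod_morphisms R P N \<longrightarrow>
      (\<exists>h\<in>mod_morphisms R P M. \<forall>x\<in>carrier P. p (h x) = g x))"

definition left_hereditary :: "'m itself \<Rightarrow> ('r, 'z) ring_scheme \<Rightarrow> bool"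
  where "left_hereditary _ R \<longleftrightarrow>
    (\<forall>(P :: ('r, 'm) module) (Q :: ('r, 'm) module) i.
      projective_object R P \<and> mod_object R Q \<and> mod_mono R Q P i \<longrightarrow> projective_object R Q)"

text \<open>Right \<open>R\<close>-modules are left modules over the opposite ring.\<close>

definition right_hereditary :: "'m itself \<Rightarrow> ('r, 'z) ring_scheme \<Rightarrow> bool"
  where "right_hereditary U R \<longleftrightarrow> left_hereditary U (opposite_ring R)"

definition hereditary :: "'m itself \<Rightarrow> ('r, 'z) ring_scheme \<Rightarrow> bool"
  where "hereditary U R \<longleftrightarrow> nonunital_ring R \<and> left_hereditary U R \<and> right_hereditary U R"

section \<open>Separated graphs\<close>

text \<open>Source and range of an edge are its tail and its head; loops and parallel edges are allowed.\<close>

locale separated_graph = wf_digraph E for E :: "('v, 'e) pre_digraph" +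
  fixes C :: "'v \<Rightarrow> 'e set set"
  assumes verts_nonempty: "verts E \<noteq> {}"
    and partition: "v \<in> verts E \<Longrightarrow> partition_on {e \<in> arcs E. tail E e = v} (C v)"

definition all_classes :: "('v, 'e) pre_digraph \<Rightarrow> ('v \<Rightarrow> 'e set set) \<Rightarrow> 'e set set"
  where "all_classes E C = (\<Union>v\<in>verts E. C v)"

definition fin_classes :: "('v, 'e) pre_digraph \<Rightarrow> ('v \<Rightarrow> 'e set set) \<Rightarrow> 'e set set"
  where "fin_classes E C = {X \<in> all_classes E C. finite X}"

section \<open>Free algebras\<close>

text \<open>
  Words form a monoid, written additively because the product of \<^typ>\<open>'a \<Rightarrow>\<^sub>0 'b\<close> is the convolution
  product for an additive monoid of exponents. So \<open>'g free_word \<Rightarrow>\<^sub>0 'k\<close> is the free unital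
  \<open>'k\<close>-algebra on \<open>'g\<close>; the free non-unital algebra on a set of generators consists of the linear
  combinations of the nonempty words in these generators.
\<close>

datatype 'g free_word = Free_Word (letters: "'g list")

instantiation free_word :: (type) monoid_add
begin

definition zero_free_word :: "'a free_word"
  where "0 = Free_Word []"

definition plus_free_word :: "'a free_word \<Rightarrow> 'a free_word \<Rightarrow> 'a free_word"
  where "u + w = Free_Word (letters u @ letters w)"

instance
  by standard (simp_all add: zero_free_word_def plus_free_word_def)

end

definition free_algebra :: "'k::field itself \<Rightarrow> 'g set \<Rightarrow> ('g free_word \<Rightarrow>\<^sub>0 'k) ring"
  where "free_algebra _ G =
    \<lparr>carrier = {f. \<forall>w\<in>Poly_Mapping.keys f. letters w \<noteq> [] \<and> set (letters w) \<subseteq> G},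
     mult = (*), one = undefined, zero = 0, add = (+)\<rparr>"

definition algebra_ideal :: "'g set \<Rightarrow> ('g free_word \<Rightarrow>\<^sub>0 'k::field) set \<Rightarrow> bool"
  where "algebra_ideal G I \<longleftrightarrow> additive_subgroup I (free_algebra TYPE('k) G) \<and>
    (\<forall>c. \<forall>x\<in>I. Poly_Mapping.map ((*) c) x \<in> I) \<and>
    (\<forall>a\<in>carrier (free_algebra TYPE('k) G). \<forall>x\<in>I. a * x \<in> I \<and> x * a \<in> I)"

definition presented_algebra ::
    "'g set \<Rightarrow> ('g free_word \<Rightarrow>\<^sub>0 'k::field) set \<Rightarrow> ('g free_word \<Rightarrow>\<^sub>0 'k) set ring"
  where "presented_algebra G Rels =
    free_algebra TYPE('k) G Quot (\<Inter>{I. algebra_ideal G I \<and> Rels \<subseteq> I})"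

section \<open>Cohn--Leavitt algebras\<close>

datatype ('v, 'e) gen = Vertex 'v | Edge 'e | Ghost 'e

definition cl_generators :: "('v, 'e) pre_digraph \<Rightarrow> ('v, 'e) gen set"
  where "cl_generators E = Vertex ` verts E \<union> Edge ` arcs E \<union> Ghost ` arcs E"

definition gen_elem :: "'g \<Rightarrow> 'g free_word \<Rightarrow>\<^sub>0 'k::field"
  where "gen_elem g = Poly_Mapping.single (Free_Word [g]) 1"

abbreviation vertex_elem :: "'v \<Rightarrow> ('v, 'e) gen free_word \<Rightarrow>\<^sub>0 'k::field"
  where "vertex_elem v \<equiv> gen_elem (Vertex v)"

abbreviation edge_elem :: "'e \<Rightarrow> ('v, 'e) gen free_word \<Rightarrow>\<^sub>0 'k::field"
  where "edge_elem e \<equiv> gen_elem (Edge e)"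

abbreviation ghost_elem :: "'e \<Rightarrow> ('v, 'e) gen free_word \<Rightarrow>\<^sub>0 'k::field"
  where "ghost_elem e \<equiv> gen_elem (Ghost e)"

text \<open>The relations (V), (E1), (E2), (SCK1) and (SCK2), in this order.\<close>

definition cl_relations ::
    "('v, 'e) pre_digraph \<Rightarrow> ('v \<Rightarrow> 'e set set) \<Rightarrow> 'e set set
      \<Rightarrow> (('v, 'e) gen free_word \<Rightarrow>\<^sub>0 'k::field) set"
  where "cl_relations E C S =
    {vertex_elem v * vertex_elem v' - (if v = v' then vertex_elem v else 0)
      | v v'. v \<in> verts E \<and> v' \<in> verts E} \<union>
    {vertex_elem (tail E e) * edge_elem e - edge_elem e | e. e \<in> arcs E} \<union>
    {edge_elem e * vertex_elem (head E e) - edge_elem e | e. e \<in> arcs E} \<union>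
    {vertex_elem (head E e) * ghost_elem e - ghost_elem e | e. e \<in> arcs E} \<union>
    {ghost_elem e * vertex_elem (tail E e) - ghost_elem e | e. e \<in> arcs E} \<union>
    {ghost_elem e * edge_elem e' - (if e = e' then vertex_elem (head E e) else 0)
      | e e' X. X \<in> all_classes E C \<and> e \<in> X \<and> e' \<in> X} \<union>
    {vertex_elem v - (\<Sum>e\<in>X. edge_elem e * ghost_elem e)
      | v X. v \<in> verts E \<and> X \<in> S \<inter> C v}"

definition cohn_leavitt_algebra ::
    "'k::field itself \<Rightarrow> ('v, 'e) pre_digraph \<Rightarrow> ('v \<Rightarrow> 'e set set) \<Rightarrow> 'e set set
      \<Rightarrow> (('v, 'e) gen free_word \<Rightarrow>\<^sub>0 'k) set ring"
  where "cohn_leavitt_algebra _ E C S = presented_algebra (cl_generators E) (cl_relations E C S)"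

end

theory Submission
  imports Defs
begin

text \<open>
  Let \<open>R\<close> be the Cohn--Leavitt algebra. The reason why \<open>R\<close> is hereditary is that derivations on \<open>R\<close>
  can be lifted along surjections. Let \<open>i: Q \<rightarrow> P\<close> be a monomorphism into a projective module, let
  \<open>p: M \<rightarrow> N\<close> be an epimorphism and \<open>g: Q \<rightarrow> N\<close> a morphism that has to be lifted to \<open>M\<close>. There is a
  linear retraction \<open>\<pi>: P \<rightarrow> Q\<close> of \<open>i\<close> that commutes with the vertices. It is not a morphism; its
  failure is measured by the maps \<open>d\<^sub>\<gamma> = g \<circ> (\<pi>\<gamma> - \<gamma>\<pi>): P \<rightarrow> N\<close> for the generators \<open>\<gamma>\<close>. They define a
  derivation on \<open>R\<close> with values in the linear maps \<open>P \<rightarrow> N\<close>, and they vanish on \<open>iQ\<close>. Suppose that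
  they lift along \<open>p\<close> to a derivation \<open>D\<close> with values in the linear maps \<open>P \<rightarrow> M\<close> that still vanishes
  on \<open>iQ\<close>. Then the group of all \<open>(m, x)\<close> in \<open>M \<times> P\<close> with \<open>p m = g (\<pi> x)\<close> is a module by
  \<open>\<gamma> (m, x) = (\<gamma> m + D\<^sub>\<gamma> x, \<gamma> x)\<close>, and it maps onto \<open>P\<close>. As \<open>P\<close> is projective, there is a section
  \<open>P \<rightarrow> M \<times> P\<close>. The restriction to \<open>Q\<close> of its first component is a morphism, since \<open>D\<close> vanishes on
  \<open>iQ\<close>, and it lifts \<open>g\<close>, since \<open>\<pi>\<close> is the identity on \<open>Q\<close> (\<open>lift_from_section\<close>).

  The derivation \<open>D\<close> is chosen on generators. Put \<open>D\<^sub>v = 0\<close> for vertices, and for an edge \<open>e\<close> let \<open>D\<^sub>e\<close>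
  be any linear lift of \<open>d\<^sub>e\<close> that is zero on \<open>iQ\<close> and compatible with the vertices at both ends. For
  the ghost edge of \<open>e\<close>, the relation (SCK1) requires \<open>D\<^bsub>e*\<^esub> (e' x) = - e\<^sup>* D\<^bsub>e'\<^esub> x\<close> for all \<open>e'\<close> in the
  class \<open>X\<close> of \<open>e\<close>. The sum of the subspaces \<open>e'P\<close> is direct, even if \<open>X\<close> is infinite, because
  \<open>e'\<^sup>*\<close> recovers the components of an element. So this prescribes \<open>D\<^bsub>e*\<^esub>\<close> on a subspace of \<open>P\<close>, in a
  way that is compatible with the value zero on \<open>iQ\<close>, and every linear lift of \<open>d\<^bsub>e*\<^esub>\<close> that extends
  it can be taken, once it is made compatible with the vertices (\<open>exists_ghost_lift\<close>). The relation (SCK2) imposes nothing more: in the presence of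
  (SCK1) it says that the ghost edges of a class in \<open>S\<close> are jointly faithful, which is inherited from
  \<open>M\<close> and \<open>P\<close> by the extension (\<open>ext_cl_rep\<close>).

  All linear maps are obtained from \<open>linear_selection\<close>, which rests on Zorn's lemma. The passage
  between modules and actions of the generators is made by \<open>cl_rep_object\<close> and
  \<open>mod_object_rep_module\<close>. The involution that exchanges edges and ghost edges identifies \<open>R\<close> with
  its opposite; so the whole argument is carried out for an abstract ring that is presented by the
  relations, and it is applied to \<open>R\<close> and to its opposite.
\<close>

section \<open>The free algebra\<close>

lemma abelian_group_cong:
  assumes "abelian_group F" "carrier F' = carrier F" "add F' = add F" "zero F' = zero F"
  shows "abelian_group F'"
proof -
  interpret F: abelian_group F by fact
  show ?thesis
    by (rule abelian_groupI, unfold assms(2-4))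
      (use F.l_neg in \<open>auto simp: F.a_ac\<close>)
qed

lemma (in abelian_group) diff_eq_zeroD:
  assumes "x \<ominus> y = \<zero>" "x \<in> carrier G" "y \<in> carrier G"
  shows "x = y"
  using assms minus_equality[of x "\<ominus> y"] by (simp add: a_minus_def)

lemma free_word_poly_induct [consumes 1, case_names zero single add]:
  fixes f :: "'w \<Rightarrow>\<^sub>0 'k::comm_monoid_add"
  assumes "Poly_Mapping.keys f \<subseteq> W"
    and "P 0"
    and "\<And>w c. w \<in> W \<Longrightarrow> P (Poly_Mapping.single w c)"
    and add: "\<And>f g. \<lbrakk>P f; P g\<rbrakk> \<Longrightarrow> P (f + g)"
  shows "P f"
proof -
  have "P (\<Sum>w\<in>A. Poly_Mapping.single w (Poly_Mapping.lookup f w))" if "finite A" "A \<subseteq> W" for A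
    using that by (induction A rule: finite_induct) (auto intro: assms)
  moreover have "f = (\<Sum>w\<in>Poly_Mapping.keys f. Poly_Mapping.single w (Poly_Mapping.lookup f w))"
    by (rule poly_mapping_eqI)
      (auto simp: lookup_sum lookup_single when_def sum.delta' in_keys_iff
        simp flip: sum.delta[OF finite_keys])
  ultimately show ?thesis
    using assms(1) finite_keys by metis
qed

lemma single_central:
  fixes f :: "'w::monoid_add \<Rightarrow>\<^sub>0 'k::comm_semiring_1"
  shows "Poly_Mapping.single 0 c * f = f * Poly_Mapping.single 0 c"
proof -
  have "Poly_Mapping.keys f \<subseteq> UNIV" by simp
  then show ?thesis
    by (induction f rule: free_word_poly_induct) (simp_all add: mult_single algebra_simps)
qed

lemma single_Cons:
  "Poly_Mapping.single (Free_Word (g # l)) c = gen_elem g * Poly_Mapping.single (Free_Word l) c"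
  by (simp add: gen_elem_def mult_single plus_free_word_def)

lemma single_word_scalar:
  "Poly_Mapping.single w c = Poly_Mapping.single 0 c * Poly_Mapping.single w (1::'k::semiring_1)"
  by (simp add: mult_single)

context
  fixes G :: "'g set" and FA :: "('g free_word \<Rightarrow>\<^sub>0 'k::field) set"
  defines "FA \<equiv> carrier (free_algebra TYPE('k) G)"
begin

lemma free_algebra_carrier_iff:
  "f \<in> FA \<longleftrightarrow> Poly_Mapping.keys f \<subseteq> {w. letters w \<noteq> [] \<and> set (letters w) \<subseteq> G}"
  by (auto simp: FA_def free_algebra_def)

lemma free_algebra_zero: "0 \<in> FA"
  by (simp add: free_algebra_carrier_iff)

lemma free_algebra_add: "f \<in> FA \<Longrightarrow> g \<in> FA \<Longrightarrow> f + g \<in> FA"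
  using keys_add[of f g] by (auto simp: free_algebra_carrier_iff)

lemma free_algebra_uminus: "f \<in> FA \<Longrightarrow> - f \<in> FA"
  by (simp add: free_algebra_carrier_iff)

lemma free_algebra_diff: "f \<in> FA \<Longrightarrow> g \<in> FA \<Longrightarrow> f - g \<in> FA"
  using free_algebra_add[of f "- g"] free_algebra_uminus by simp

lemma free_algebra_mult: "f \<in> FA \<Longrightarrow> g \<in> FA \<Longrightarrow> f * g \<in> FA"
  using keys_mult[of f g] by (fastforce simp: free_algebra_carrier_iff plus_free_word_def)

lemma free_algebra_single:
  "letters w \<noteq> [] \<Longrightarrow> set (letters w) \<subseteq> G \<Longrightarrow> Poly_Mapping.single w c \<in> FA"
  by (simp add: free_algebra_carrier_iff)

lemma free_algebra_gen: "g \<in> G \<Longrightarrow> gen_elem g \<in> FA"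
  by (simp add: gen_elem_def free_algebra_single)

lemma free_algebra_scalar: "f \<in> FA \<Longrightarrow> Poly_Mapping.single 0 c * f \<in> FA"
  using keys_mult[of "Poly_Mapping.single 0 c" f]
  by (cases "c = 0") (auto simp: free_algebra_carrier_iff)

lemma free_algebra_sum: "(\<And>i. i \<in> A \<Longrightarrow> f i \<in> FA) \<Longrightarrow> sum f A \<in> FA"
  by (induction A rule: infinite_finite_induct) (auto intro: free_algebra_zero free_algebra_add)

lemma free_algebra_induct [consumes 1, case_names zero single add]:
  assumes "f \<in> FA"
    and "P 0"
    and "\<And>w c. letters w \<noteq> [] \<Longrightarrow> set (letters w) \<subseteq> G \<Longrightarrow> P (Poly_Mapping.single w c)"
    and "\<And>f g. \<lbrakk>f \<in> FA; g \<in> FA; P f; P g\<rbrakk> \<Longrightarrow> P (f + g)"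
  shows "P f"
proof -
  have "Poly_Mapping.keys f \<subseteq> {w. letters w \<noteq> [] \<and> set (letters w) \<subseteq> G}"
    using assms(1) by (simp add: free_algebra_carrier_iff)
  then have "f \<in> FA \<and> P f"
    by (induction f rule: free_word_poly_induct)
      (auto intro: assms free_algebra_zero free_algebra_add free_algebra_single)
  then show ?thesis ..
qed

lemma free_algebra_simps:
  "add (free_algebra TYPE('k) G) = (+)" "mult (free_algebra TYPE('k) G) = (*)"
  "zero (free_algebra TYPE('k) G) = 0"
  by (simp_all add: free_algebra_def)

lemma abelian_group_free_algebra: "abelian_group (free_algebra TYPE('k) G)"
proof (rule abelian_groupI, unfold free_algebra_simps)
  show "\<exists>y\<in>carrier (free_algebra TYPE('k) G). y + x = 0"
    if "x \<in> carrier (free_algebra TYPE('k) G)" for x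
    using free_algebra_uminus[of x] that by (intro bexI[of _ "- x"]) (auto simp: FA_def)
qed (use free_algebra_zero free_algebra_add in \<open>auto simp: FA_def ac_simps\<close>)

end

text \<open>
  Closure under negation is contained in closure under scalars, as \<open>- f = (- 1) f\<close>.
\<close>

lemma algebra_idealI:
  fixes I :: "('g free_word \<Rightarrow>\<^sub>0 'k::field) set"
  assumes carrier: "I \<subseteq> carrier (free_algebra TYPE('k) G)" and zero: "0 \<in> I"
    and add: "\<And>f g. \<lbrakk>f \<in> I; g \<in> I\<rbrakk> \<Longrightarrow> f + g \<in> I"
    and scalar: "\<And>c f. f \<in> I \<Longrightarrow> Poly_Mapping.single 0 c * f \<in> I"
    and mult: "\<And>f g. \<lbrakk>f \<in> carrier (free_algebra TYPE('k) G); g \<in> I\<rbrakk> \<Longrightarrow> f * g \<in> I \<and> g * f \<in> I"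
  shows "algebra_ideal G I"
proof -
  interpret A: abelian_group "free_algebra TYPE('k) G"
    by (rule abelian_group_free_algebra)
  have "subgroup I (add_monoid (free_algebra TYPE('k) G))"
  proof (rule A.add.subgroupI)
    fix f assume f: "f \<in> I"
    have "\<ominus>\<^bsub>free_algebra TYPE('k) G\<^esub> f = - f"
      using f carrier A.minus_equality[of "- f" f]
      by (auto simp: free_algebra_simps free_algebra_uminus)
    also have "\<dots> = Poly_Mapping.single 0 (- 1) * f"
      by (metis minus_mult_left mult_1 single_one single_uminus)
    finally show "\<ominus>\<^bsub>free_algebra TYPE('k) G\<^esub> f \<in> I"
      using scalar[OF f] by simp
  qed (use carrier zero add in \<open>auto simp: free_algebra_simps\<close>)
  then have "additive_subgroup I (free_algebra TYPE('k) G)"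
    by (rule additive_subgroup.intro)
  then show ?thesis
    using scalar mult by (simp add: algebra_ideal_def mult_map_scale_conv_mult)
qed

lemma algebra_idealD:
  fixes I :: "('g free_word \<Rightarrow>\<^sub>0 'k::field) set"
  assumes "algebra_ideal G I"
  shows "I \<subseteq> carrier (free_algebra TYPE('k) G)" "0 \<in> I"
    and "\<lbrakk>f \<in> I; g \<in> I\<rbrakk> \<Longrightarrow> f + g \<in> I"
    and "f \<in> I \<Longrightarrow> Poly_Mapping.single 0 c * f \<in> I"
    and "\<lbrakk>f \<in> carrier (free_algebra TYPE('k) G); g \<in> I\<rbrakk> \<Longrightarrow> f * g \<in> I"
    and "\<lbrakk>f \<in> carrier (free_algebra TYPE('k) G); g \<in> I\<rbrakk> \<Longrightarrow> g * f \<in> I"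
    and "f \<in> I \<Longrightarrow> - f \<in> I"
proof -
  interpret additive_subgroup I "free_algebra TYPE('k) G"
    using assms by (simp add: algebra_ideal_def)
  show "I \<subseteq> carrier (free_algebra TYPE('k) G)" by (rule a_subset)
  show "0 \<in> I" using zero_closed by (simp add: free_algebra_simps)
  show "f + g \<in> I" if "f \<in> I" "g \<in> I" for f g
    using a_closed[OF that] by (simp add: free_algebra_simps)
  show sc: "Poly_Mapping.single 0 c * f \<in> I" if "f \<in> I" for f c
    using assms that by (simp add: algebra_ideal_def mult_map_scale_conv_mult)
  show "f * g \<in> I" "g * f \<in> I" if "f \<in> carrier (free_algebra TYPE('k) G)" "g \<in> I"
    using assms that by (simp_all add: algebra_ideal_def)
  show "- f \<in> I" if "f \<in> I"
    using sc[OF that, of "- 1"] by (metis minus_mult_left mult_1 single_one single_uminus)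
qed

section \<open>Vector spaces and representations of the free algebra\<close>

locale vec_space = abelian_group F for F :: "('x, 'z) ring_scheme" (structure) +
  fixes sc :: "'k::field \<Rightarrow> 'x \<Rightarrow> 'x"
  assumes sc_closed: "x \<in> carrier F \<Longrightarrow> sc c x \<in> carrier F"
    and sc_add_left: "x \<in> carrier F \<Longrightarrow> sc (c + d) x = sc c x \<oplus> sc d x"
    and sc_add_right: "\<lbrakk>x \<in> carrier F; y \<in> carrier F\<rbrakk> \<Longrightarrow> sc c (x \<oplus> y) = sc c x \<oplus> sc c y"
    and sc_mult: "x \<in> carrier F \<Longrightarrow> sc (c * d) x = sc c (sc d x)"
    and sc_one: "x \<in> carrier F \<Longrightarrow> sc 1 x = x"
begin

lemma sc_zero: "x \<in> carrier F \<Longrightarrow> sc 0 x = \<zero>"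
  using sc_add_left[of x 0 0] sc_closed by (simp add: add.r_cancel_one')

lemma sc_zero_right: "sc c \<zero> = \<zero>"
  using sc_add_right[of \<zero> \<zero> c] sc_closed by (simp add: add.r_cancel_one')

lemma sc_neg_one: "x \<in> carrier F \<Longrightarrow> sc (- 1) x = \<ominus> x"
  by (metis add.inv_equality add.left_inverse sc_add_left sc_closed sc_one sc_zero)

lemma sc_minus: "x \<in> carrier F \<Longrightarrow> sc c (\<ominus> x) = \<ominus> sc c x"
  by (metis sc_closed sc_mult sc_neg_one mult.commute)

end

locale word_rep = vec_space F sc for F :: "('x, 'z) ring_scheme" (structure)
    and sc :: "'k::field \<Rightarrow> 'x \<Rightarrow> 'x" +
  fixes act :: "'g \<Rightarrow> 'x \<Rightarrow> 'x"
  assumes act_closed: "x \<in> carrier F \<Longrightarrow> act g x \<in> carrier F"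
    and act_add: "\<lbrakk>x \<in> carrier F; y \<in> carrier F\<rbrakk> \<Longrightarrow> act g (x \<oplus> y) = act g x \<oplus> act g y"
    and act_sc: "x \<in> carrier F \<Longrightarrow> act g (sc c x) = sc c (act g x)"

text \<open>
  The universal property of the free unital algebra: an arbitrary family of linear operators
  extends to an action of all noncommutative polynomials.
\<close>

definition word_eval :: "('x, 'z) ring_scheme \<Rightarrow> ('k::zero \<Rightarrow> 'x \<Rightarrow> 'x) \<Rightarrow> ('g \<Rightarrow> 'x \<Rightarrow> 'x)
    \<Rightarrow> ('g free_word \<Rightarrow>\<^sub>0 'k) \<Rightarrow> 'x \<Rightarrow> 'x"
  where "word_eval F sc act f x =
    (\<Oplus>\<^bsub>F\<^esub>w\<in>Poly_Mapping.keys f. sc (Poly_Mapping.lookup f w) (foldr act (letters w) x))"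

context word_rep
begin

abbreviation ev :: "('g free_word \<Rightarrow>\<^sub>0 'k) \<Rightarrow> 'x \<Rightarrow> 'x"
  where "ev \<equiv> word_eval F sc act"

lemma act_zero: "act g \<zero> = \<zero>"
  using act_add[of \<zero> \<zero> g] act_closed[of \<zero> g] by (simp add: add.r_cancel_one')

lemma act_minus: "x \<in> carrier F \<Longrightarrow> act g (\<ominus> x) = \<ominus> act g x"
  by (metis act_closed act_sc sc_neg_one)

lemma word_closed: "x \<in> carrier F \<Longrightarrow> foldr act l x \<in> carrier F"
  by (induction l) (auto intro: act_closed)

lemma word_add:
  "\<lbrakk>x \<in> carrier F; y \<in> carrier F\<rbrakk> \<Longrightarrow> foldr act l (x \<oplus> y) = foldr act l x \<oplus> foldr act l y"
  by (induction l) (auto simp: act_add word_closed)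

lemma word_sc: "x \<in> carrier F \<Longrightarrow> foldr act l (sc c x) = sc c (foldr act l x)"
  by (induction l) (auto simp: act_sc word_closed)

lemma ev_closed: "x \<in> carrier F \<Longrightarrow> ev f x \<in> carrier F"
  unfolding word_eval_def by (auto intro!: finsum_closed sc_closed word_closed)

lemma ev_zero: "ev 0 x = \<zero>"
  by (simp add: word_eval_def)

lemma ev_superset:
  assumes "x \<in> carrier F" "finite A" "Poly_Mapping.keys f \<subseteq> A"
  shows "ev f x = (\<Oplus>w\<in>A. sc (Poly_Mapping.lookup f w) (foldr act (letters w) x))"
  unfolding word_eval_def using assms
  by (intro add.finprod_mono_neutral_cong_left)
    (auto simp: in_keys_iff sc_zero sc_closed word_closed)

lemma ev_single: 
  assumes "x \<in> carrier F" 
  shows "ev (Poly_Mapping.single w c) x = sc c (foldr act (letters w) x)"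
  using assms by (subst ev_superset[of _ "{w}"]) (auto simp: sc_closed word_closed)

lemma ev_add:
  assumes x: "x \<in> carrier F"
  shows "ev (f + g) x = ev f x \<oplus> ev g x"
proof -
  let ?A = "Poly_Mapping.keys f \<union> Poly_Mapping.keys g"
  have "Poly_Mapping.keys (f + g) \<subseteq> ?A"
    by (rule keys_add)
  then show ?thesis
    using x by (simp add: ev_superset[where A = ?A] lookup_add sc_add_left word_closed sc_closed
        finsum_addf)
qed

lemma ev_add_right:
  assumes "x \<in> carrier F" "y \<in> carrier F"
  shows "ev f (x \<oplus> y) = ev f x \<oplus> ev f y"
  using assms unfolding word_eval_def
  by (simp add: word_add sc_add_right word_closed sc_closed finsum_addf)

lemma ev_mult:
  assumes x: "x \<in> carrier F"
  shows "ev (f * g) x = ev f (ev g x)"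
proof -
  have single: "ev (Poly_Mapping.single w c * g) x = ev (Poly_Mapping.single w c) (ev g x)" for w c
  proof -
    have "Poly_Mapping.keys g \<subseteq> UNIV" by simp
    then show ?thesis
    proof (induction g rule: free_word_poly_induct)
      case zero
      have "foldr act l \<zero> = \<zero>" for l
        by (induction l) (auto simp: act_zero)
      then show ?case by (simp add: ev_zero ev_single sc_zero_right)
    next
      case (single w' c')
      then show ?case
        using x by (simp add: mult_single ev_single sc_mult word_sc word_closed sc_closed
            plus_free_word_def)
    next
      case (add g h)
      then show ?case
        using x by (simp add: distrib_left ev_add ev_add_right ev_closed)
    qed
  qed
  have "Poly_Mapping.keys f \<subseteq> UNIV" by simp
  then show ?thesis
    by (induction f rule: free_word_poly_induct)
      (use x in \<open>auto simp: ev_zero single distrib_right ev_add ev_closed\<close>)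
qed

lemma ev_gen: "x \<in> carrier F \<Longrightarrow> ev (gen_elem g) x = act g x"
  by (simp add: gen_elem_def ev_single sc_one act_closed)

lemma ev_scalar: "x \<in> carrier F \<Longrightarrow> ev (Poly_Mapping.single 0 c) x = sc c x"
  by (simp add: ev_single zero_free_word_def)

lemma ev_sc: "x \<in> carrier F \<Longrightarrow> ev f (sc c x) = sc c (ev f x)"
  by (metis ev_closed ev_mult ev_scalar single_central)

lemma ev_uminus: "x \<in> carrier F \<Longrightarrow> ev (- f) x = \<ominus> ev f x"
  by (metis add.inv_equality ab_group_add_class.ab_left_minus ev_add ev_closed ev_zero)

lemma ev_diff: "x \<in> carrier F \<Longrightarrow> ev (f - g) x = ev f x \<ominus> ev g x"
  by (metis a_minus_def diff_conv_add_uminus ev_add ev_uminus)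

lemma ev_zero_right: "ev f \<zero> = \<zero>"
  using ev_add_right[of \<zero> \<zero> f] ev_closed[of \<zero> f] by (simp add: add.r_cancel_one')

end

text \<open>
  Only the generators in \<open>G\<close> have to be respected, since an element of the free algebra on \<open>G\<close>
  contains no other letters.
\<close>

lemma word_eval_commute:
  fixes sf :: "'k::field \<Rightarrow> 'x \<Rightarrow> 'x" and sh :: "'k \<Rightarrow> 'y \<Rightarrow> 'y"
  assumes "word_rep F sf af" "word_rep H sh ah"
    and closed: "\<And>x. x \<in> carrier F \<Longrightarrow> \<phi> x \<in> carrier H"
    and add: "\<And>x y. \<lbrakk>x \<in> carrier F; y \<in> carrier F\<rbrakk> \<Longrightarrow> \<phi> (x \<oplus>\<^bsub>F\<^esub> y) = \<phi> x \<oplus>\<^bsub>H\<^esub> \<phi> y"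
    and sc: "\<And>c x. x \<in> carrier F \<Longrightarrow> \<phi> (sf c x) = sh c (\<phi> x)"
    and act: "\<And>g x. \<lbrakk>g \<in> G; x \<in> carrier F\<rbrakk> \<Longrightarrow> \<phi> (af g x) = ah g (\<phi> x)"
    and f: "f \<in> carrier (free_algebra TYPE('k) G)"
    and x: "x \<in> carrier F"
  shows "\<phi> (word_eval F sf af f x) = word_eval H sh ah f (\<phi> x)"
proof -
  interpret F: word_rep F sf af by fact
  interpret H: word_rep H sh ah by fact
  have zero: "\<phi> \<zero>\<^bsub>F\<^esub> = \<zero>\<^bsub>H\<^esub>"
    using add[of "\<zero>\<^bsub>F\<^esub>" "\<zero>\<^bsub>F\<^esub>"] closed[of "\<zero>\<^bsub>F\<^esub>"] by (simp add: H.add.r_cancel_one')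
  have word: "\<phi> (foldr af l x) = foldr ah l (\<phi> x)" if "set l \<subseteq> G" for l
    using that by (induction l) (auto simp: act F.word_closed x)
  show ?thesis
    using f by (induction f rule: free_algebra_induct)
      (auto simp: F.ev_single H.ev_single F.ev_add H.ev_add x closed sc F.word_closed word add
        F.ev_closed F.ev_zero H.ev_zero zero)
qed

section \<open>Linear selections\<close>

text \<open>
  A vector space that is spanned by the images of a family of orthogonal projections. The family of
  vertices gives the grading of a module; the family that consists of the identity alone gives a
  plain vector space. The condition of being spanned is expressed by an induction principle, since
  \<open>J\<close> may be infinite and infinite sums have no meaning.
\<close>

locale graded_space = vec_space U su for U :: "('x, 'z) ring_scheme" (structure)
    and su :: "'k::field \<Rightarrow> 'x \<Rightarrow> 'x" +
  fixes J :: "'j set" and \<alpha> :: "'j \<Rightarrow> 'x \<Rightarrow> 'x"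
  assumes proj_closed: "\<lbrakk>i \<in> J; u \<in> carrier U\<rbrakk> \<Longrightarrow> \<alpha> i u \<in> carrier U"
    and proj_add: "\<lbrakk>i \<in> J; u \<in> carrier U; v \<in> carrier U\<rbrakk> \<Longrightarrow> \<alpha> i (u \<oplus> v) = \<alpha> i u \<oplus> \<alpha> i v"
    and proj_sc: "\<lbrakk>i \<in> J; u \<in> carrier U\<rbrakk> \<Longrightarrow> \<alpha> i (su c u) = su c (\<alpha> i u)"
    and proj_orth: "\<lbrakk>i \<in> J; j \<in> J; u \<in> carrier U\<rbrakk> \<Longrightarrow> \<alpha> i (\<alpha> j u) = (if i = j then \<alpha> i u else \<zero>)"
    and proj_span: "\<lbrakk>u \<in> carrier U; \<zero> \<in> D; \<And>x y. \<lbrakk>x \<in> D; y \<in> D\<rbrakk> \<Longrightarrow> x \<oplus> y \<in> D;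
      \<And>i. i \<in> J \<Longrightarrow> \<alpha> i u \<in> D\<rbrakk> \<Longrightarrow> u \<in> D"

lemma (in vec_space) trivially_graded: "graded_space F sc {()} (\<lambda>_ x. x)"
  by unfold_locales auto

locale two_graded_spaces =
  U: graded_space U su J \<alpha> + M: graded_space M sm J \<beta>
  for U :: "('x, 'z) ring_scheme" and su :: "'k::field \<Rightarrow> 'x \<Rightarrow> 'x" and J :: "'j set"
    and \<alpha> :: "'j \<Rightarrow> 'x \<Rightarrow> 'x"
    and M :: "('y, 'w) ring_scheme" and sm :: "'k \<Rightarrow> 'y \<Rightarrow> 'y" and \<beta> :: "'j \<Rightarrow> 'y \<Rightarrow> 'y"
begin

text \<open>
  A linear relation is a graded subspace of \<open>U \<times> M\<close>. Linear maps are constructed as such subspaces,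
  because these can be ordered by inclusion.
\<close>

definition linear_relation :: "('x \<times> 'y) set \<Rightarrow> bool"
  where "linear_relation T \<longleftrightarrow> T \<subseteq> carrier U \<times> carrier M \<and> (\<zero>\<^bsub>U\<^esub>, \<zero>\<^bsub>M\<^esub>) \<in> T \<and>
    (\<forall>u m v n. (u, m) \<in> T \<longrightarrow> (v, n) \<in> T \<longrightarrow> (u \<oplus>\<^bsub>U\<^esub> v, m \<oplus>\<^bsub>M\<^esub> n) \<in> T) \<and>
    (\<forall>c u m. (u, m) \<in> T \<longrightarrow> (su c u, sm c m) \<in> T) \<and>
    (\<forall>i\<in>J. \<forall>u m. (u, m) \<in> T \<longrightarrow> (\<alpha> i u, \<beta> i m) \<in> T)"

definition single_valued_at_zero :: "('x \<times> 'y) set \<Rightarrow> bool"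
  where "single_valued_at_zero T \<longleftrightarrow> (\<forall>m. (\<zero>\<^bsub>U\<^esub>, m) \<in> T \<longrightarrow> m = \<zero>\<^bsub>M\<^esub>)"

lemma linear_relation_carrier:
  "\<lbrakk>linear_relation T; (u, m) \<in> T\<rbrakk> \<Longrightarrow> u \<in> carrier U \<and> m \<in> carrier M"
  by (auto simp: linear_relation_def)

lemma linear_relation_add:
  "\<lbrakk>linear_relation T; (u, m) \<in> T; (v, n) \<in> T\<rbrakk> \<Longrightarrow> (u \<oplus>\<^bsub>U\<^esub> v, m \<oplus>\<^bsub>M\<^esub> n) \<in> T"
  by (simp add: linear_relation_def)

lemma linear_relation_sc: "\<lbrakk>linear_relation T; (u, m) \<in> T\<rbrakk> \<Longrightarrow> (su c u, sm c m) \<in> T"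
  by (simp add: linear_relation_def)

lemma linear_relation_proj:
  "\<lbrakk>linear_relation T; i \<in> J; (u, m) \<in> T\<rbrakk> \<Longrightarrow> (\<alpha> i u, \<beta> i m) \<in> T"
  by (simp add: linear_relation_def)

lemma linear_relation_diff:
  assumes "linear_relation T" "(u, m) \<in> T" "(v, n) \<in> T"
  shows "(u \<ominus>\<^bsub>U\<^esub> v, m \<ominus>\<^bsub>M\<^esub> n) \<in> T"
proof -
  have "(su (- 1) v, sm (- 1) n) \<in> T" "v \<in> carrier U" "n \<in> carrier M"
    using assms by (auto simp: linear_relation_def)
  then show ?thesis
    using assms by (auto simp: linear_relation_def U.sc_neg_one M.sc_neg_one a_minus_def)
qed

lemma linear_relation_unique:
  assumes "linear_relation T" "single_valued_at_zero T" "(u, m) \<in> T" "(u, n) \<in> T"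
  shows "m = n"
proof -
  have "u \<in> carrier U" "m \<in> carrier M" "n \<in> carrier M"
    using assms linear_relation_carrier by blast+
  moreover have "m \<ominus>\<^bsub>M\<^esub> n = \<zero>\<^bsub>M\<^esub>"
    using linear_relation_diff[OF assms(1,3,4)] assms(2) \<open>u \<in> carrier U\<close>
    by (simp add: single_valued_at_zero_def a_minus_def U.r_neg)
  ultimately show ?thesis
    by (blast intro: M.diff_eq_zeroD)
qed

lemma linear_relation_Union:
  assumes "\<C> \<noteq> {}" "\<And>T. T \<in> \<C> \<Longrightarrow> linear_relation T"
    and chain: "\<And>T T'. \<lbrakk>T \<in> \<C>; T' \<in> \<C>\<rbrakk> \<Longrightarrow> T \<subseteq> T' \<or> T' \<subseteq> T"
  shows "linear_relation (\<Union>\<C>)"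
proof -
  have "\<Union>\<C> \<subseteq> carrier U \<times> carrier M" "(\<zero>\<^bsub>U\<^esub>, \<zero>\<^bsub>M\<^esub>) \<in> \<Union>\<C>"
    using assms(1,2) unfolding linear_relation_def by blast+
  moreover have "(u \<oplus>\<^bsub>U\<^esub> v, m \<oplus>\<^bsub>M\<^esub> n) \<in> \<Union>\<C>"
    if um: "(u, m) \<in> \<Union>\<C>" and vn: "(v, n) \<in> \<Union>\<C>" for u m v n
  proof -
    from um obtain T where T: "T \<in> \<C>" "(u, m) \<in> T" by blast
    from vn obtain T' where T': "T' \<in> \<C>" "(v, n) \<in> T'" by blast
    obtain T'' where "T'' \<in> \<C>" "(u, m) \<in> T''" "(v, n) \<in> T''"
      using chain[OF T(1) T'(1)] T T' by blast
    then show ?thesis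
      using assms(2) unfolding linear_relation_def by blast
  qed
  moreover have "(su c u, sm c m) \<in> \<Union>\<C>" if "(u, m) \<in> \<Union>\<C>" for c u m
    using that assms(2) unfolding linear_relation_def by blast
  moreover have "(\<alpha> i u, \<beta> i m) \<in> \<Union>\<C>" if "(u, m) \<in> \<Union>\<C>" "i \<in> J" for i u m
    using that assms(2) unfolding linear_relation_def by blast
  ultimately show ?thesis
    unfolding linear_relation_def by blast
qed

text \<open>
  One more homogeneous vector can be added to the domain of a partial selection, because over a
  field a scalar multiple of it lies in the old domain only if the vector itself does.
\<close>

lemma linear_relation_extend:
  assumes T: "linear_relation T" and G: "linear_relation G" "G \<subseteq> T" "single_valued_at_zero G"
    and um: "(u, m) \<in> T" and i: "i \<in> J" and u: "\<alpha> i u \<notin> Domain G"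
  obtains G' where "linear_relation G'" "G' \<subseteq> T" "single_valued_at_zero G'" "G \<subset> G'"
proof -
  define x n where "x = \<alpha> i u" and "n = \<beta> i m"
  have xn: "(x, n) \<in> T" "x \<in> carrier U" "n \<in> carrier M" "u \<in> carrier U" "m \<in> carrier M"
    using linear_relation_carrier[OF T um] linear_relation_proj[OF T i um] i
    by (auto simp: x_def n_def U.proj_closed M.proj_closed)
  have hom: "\<alpha> j x = (if j = i then x else \<zero>\<^bsub>U\<^esub>)" "\<beta> j n = (if j = i then n else \<zero>\<^bsub>M\<^esub>)"
    if "j \<in> J" for j
    using that i xn by (auto simp: x_def n_def U.proj_orth M.proj_orth)
  define G' where "G' = {(y \<oplus>\<^bsub>U\<^esub> su c x, k \<oplus>\<^bsub>M\<^esub> sm c n) | y k c. (y, k) \<in> G}"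
  have GI: "(y \<oplus>\<^bsub>U\<^esub> su c x, k \<oplus>\<^bsub>M\<^esub> sm c n) \<in> G'" if "(y, k) \<in> G" for y k c
    using that by (auto simp: G'_def)
  have GE: "\<exists>y k c. p = (y \<oplus>\<^bsub>U\<^esub> su c x, k \<oplus>\<^bsub>M\<^esub> sm c n) \<and> (y, k) \<in> G \<and> y \<in> carrier U \<and> k \<in> carrier M"
    if "p \<in> G'" for p
    using that G(1) by (auto simp: G'_def linear_relation_def)
  have incl: "G \<subseteq> G'"
  proof
    fix p assume p: "p \<in> G"
    obtain y k where yk: "p = (y, k)" "(y, k) \<in> G" using p by (cases p) auto
    have "(y \<oplus>\<^bsub>U\<^esub> su 0 x, k \<oplus>\<^bsub>M\<^esub> sm 0 n) = (y, k)"
      using linear_relation_carrier[OF G(1) yk(2)] xn by (simp add: U.sc_zero M.sc_zero)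
    then show "p \<in> G'" using GI[OF yk(2), of 0] yk(1) by simp
  qed
  have "(\<zero>\<^bsub>U\<^esub>, \<zero>\<^bsub>M\<^esub>) \<in> G"
    using G(1) by (simp add: linear_relation_def)
  then have "(x, n) \<in> G'"
    using GI[of "\<zero>\<^bsub>U\<^esub>" "\<zero>\<^bsub>M\<^esub>" 1] xn by (simp add: U.sc_one M.sc_one)
  then have "G \<subset> G'"
    using incl u by (auto simp: x_def)
  moreover have "G' \<subseteq> T"
    using G(2) xn by (auto simp: G'_def intro!: linear_relation_add[OF T] linear_relation_sc[OF T])
  moreover have "single_valued_at_zero G'"
    unfolding single_valued_at_zero_def
  proof (intro allI impI)
    fix k' assume "(\<zero>\<^bsub>U\<^esub>, k') \<in> G'"
    then obtain y k c where yk: "y \<oplus>\<^bsub>U\<^esub> su c x = \<zero>\<^bsub>U\<^esub>" "k' = k \<oplus>\<^bsub>M\<^esub> sm c n" "(y, k) \<in> G"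
      "y \<in> carrier U" "k \<in> carrier M"
      using GE by fastforce
    \<comment> \<open>Otherwise \<open>x\<close> would be a multiple of an element of the domain of \<open>G\<close>.\<close>
    have "c = 0"
    proof (rule ccontr)
      assume c: "c \<noteq> 0"
      have "su c x = \<ominus>\<^bsub>U\<^esub> y"
        using yk(1,4) xn U.sc_closed U.minus_equality[of "su c x" y] by (simp add: U.a_comm)
      then have "x = su (- (1 / c)) y"
        using c xn yk(4) U.sc_mult[of x "1 / c" c] U.sc_mult[of y "1 / c" "- 1"]
        by (simp add: U.sc_one U.sc_neg_one)
      then have "(x, sm (- (1 / c)) k) \<in> G"
        using G(1) yk(3) by (auto simp: linear_relation_def)
      then show False
        using u by (auto simp: x_def)
    qed
    then show "k' = \<zero>\<^bsub>M\<^esub>"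
      using yk xn G(3) by (auto simp: single_valued_at_zero_def U.sc_zero M.sc_zero)
  qed
  moreover have "linear_relation G'"
    unfolding linear_relation_def
  proof (intro conjI allI impI ballI)
    show "G' \<subseteq> carrier U \<times> carrier M"
      using \<open>G' \<subseteq> T\<close> T by (auto simp: linear_relation_def)
    show "(\<zero>\<^bsub>U\<^esub>, \<zero>\<^bsub>M\<^esub>) \<in> G'"
      using incl G(1) by (auto simp: linear_relation_def)
  next
    fix a b a' b' assume ab: "(a, b) \<in> G'" and ab': "(a', b') \<in> G'"
    obtain y k c where 1: "a = y \<oplus>\<^bsub>U\<^esub> su c x" "b = k \<oplus>\<^bsub>M\<^esub> sm c n" "(y, k) \<in> G"
      "y \<in> carrier U" "k \<in> carrier M"
      using GE[OF ab] by auto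
    obtain y' k' c' where 2: "a' = y' \<oplus>\<^bsub>U\<^esub> su c' x" "b' = k' \<oplus>\<^bsub>M\<^esub> sm c' n" "(y', k') \<in> G"
      "y' \<in> carrier U" "k' \<in> carrier M"
      using GE[OF ab'] by auto
    have "a \<oplus>\<^bsub>U\<^esub> a' = (y \<oplus>\<^bsub>U\<^esub> y') \<oplus>\<^bsub>U\<^esub> su (c + c') x" "b \<oplus>\<^bsub>M\<^esub> b' = (k \<oplus>\<^bsub>M\<^esub> k') \<oplus>\<^bsub>M\<^esub> sm (c + c') n"
      using 1 2 xn by (simp_all add: U.sc_add_left M.sc_add_left U.sc_closed M.sc_closed
          U.a_ac M.a_ac)
    moreover have "(y \<oplus>\<^bsub>U\<^esub> y', k \<oplus>\<^bsub>M\<^esub> k') \<in> G"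
      using 1 2 by (intro linear_relation_add[OF G(1)])
    ultimately show "(a \<oplus>\<^bsub>U\<^esub> a', b \<oplus>\<^bsub>M\<^esub> b') \<in> G'"
      using GI by metis
  next
    fix d a b assume ab: "(a, b) \<in> G'"
    obtain y k c where 1: "a = y \<oplus>\<^bsub>U\<^esub> su c x" "b = k \<oplus>\<^bsub>M\<^esub> sm c n" "(y, k) \<in> G"
      "y \<in> carrier U" "k \<in> carrier M"
      using GE[OF ab] by auto
    have "su d a = su d y \<oplus>\<^bsub>U\<^esub> su (d * c) x" "sm d b = sm d k \<oplus>\<^bsub>M\<^esub> sm (d * c) n"
      using 1 xn by (simp_all add: U.sc_add_right M.sc_add_right U.sc_closed M.sc_closed
          U.sc_mult M.sc_mult)
    moreover have "(su d y, sm d k) \<in> G"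
      using 1 by (intro linear_relation_sc[OF G(1)])
    ultimately show "(su d a, sm d b) \<in> G'"
      using GI by metis
  next
    fix j a b assume j: "j \<in> J" and ab: "(a, b) \<in> G'"
    obtain y k c where 1: "a = y \<oplus>\<^bsub>U\<^esub> su c x" "b = k \<oplus>\<^bsub>M\<^esub> sm c n" "(y, k) \<in> G"
      "y \<in> carrier U" "k \<in> carrier M"
      using GE[OF ab] by auto
    have "\<alpha> j a = \<alpha> j y \<oplus>\<^bsub>U\<^esub> su (if j = i then c else 0) x"
      "\<beta> j b = \<beta> j k \<oplus>\<^bsub>M\<^esub> sm (if j = i then c else 0) n"
      using 1 xn j hom[OF j] by (auto simp: U.proj_add M.proj_add U.proj_sc M.proj_sc
          U.sc_closed M.sc_closed U.sc_zero M.sc_zero U.sc_zero_right M.sc_zero_right)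
    moreover have "(\<alpha> j y, \<beta> j k) \<in> G"
      using 1 j by (intro linear_relation_proj[OF G(1)])
    ultimately show "(\<alpha> j a, \<beta> j b) \<in> G'"
      using GI by metis
  qed
  ultimately show ?thesis
    using that by blast
qed

text \<open>
  The category of graded vector spaces is semisimple: a total linear relation contains a linear
  function, and this function can be prescribed on a subspace. By Zorn's lemma there is a maximal
  single-valued linear relation between the prescribed one and the given one, and it is total.
\<close>

theorem linear_selection:
  assumes T: "linear_relation T" and total: "carrier U \<subseteq> Domain T"
    and G0: "linear_relation G0" "G0 \<subseteq> T" "single_valued_at_zero G0"
  shows "\<exists>D. (\<forall>u\<in>carrier U. (u, D u) \<in> T) \<and>
    (\<forall>u\<in>carrier U. \<forall>v\<in>carrier U. D (u \<oplus>\<^bsub>U\<^esub> v) = D u \<oplus>\<^bsub>M\<^esub> D v) \<and>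
    (\<forall>c. \<forall>u\<in>carrier U. D (su c u) = sm c (D u)) \<and>
    (\<forall>i\<in>J. \<forall>u\<in>carrier U. D (\<alpha> i u) = \<beta> i (D u)) \<and>
    (\<forall>u m. (u, m) \<in> G0 \<longrightarrow> D u = m)"
proof -
  define \<G> where "\<G> = {G. linear_relation G \<and> single_valued_at_zero G \<and> G0 \<subseteq> G \<and> G \<subseteq> T}"
  have "\<exists>G\<in>\<G>. \<forall>G'\<in>\<G>. G \<subseteq> G' \<longrightarrow> G' = G"
  proof (rule subset_Zorn_nonempty)
    show "\<G> \<noteq> {}"
      using G0 by (auto simp: \<G>_def)
    fix \<C> assume ne: "\<C> \<noteq> {}" and ch: "subset.chain \<G> \<C>"
    have sub: "\<C> \<subseteq> \<G>" and lin: "\<And>T T'. \<lbrakk>T \<in> \<C>; T' \<in> \<C>\<rbrakk> \<Longrightarrow> T \<subseteq> T' \<or> T' \<subseteq> T"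
      using ch unfolding subset.chain_def by blast+
    have "linear_relation (\<Union>\<C>)"
      using ne sub lin by (intro linear_relation_Union) (auto simp: \<G>_def)
    then show "\<Union>\<C> \<in> \<G>"
      using ne sub unfolding \<G>_def single_valued_at_zero_def by blast
  qed
  then obtain G where G: "linear_relation G" "single_valued_at_zero G" "G0 \<subseteq> G" "G \<subseteq> T"
    and max: "\<And>G'. G' \<in> \<G> \<Longrightarrow> G \<subseteq> G' \<Longrightarrow> G' = G"
    by (auto simp: \<G>_def)
  have dom: "u \<in> Domain G" if u: "u \<in> carrier U" for u
  proof (rule U.proj_span[OF u])
    show "\<zero>\<^bsub>U\<^esub> \<in> Domain G"
      using G(1) by (auto simp: linear_relation_def)
    show "x \<oplus>\<^bsub>U\<^esub> y \<in> Domain G" if "x \<in> Domain G" "y \<in> Domain G" for x y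
      using that by (auto dest: linear_relation_add[OF G(1)])
    fix i assume i: "i \<in> J"
    obtain m where um: "(u, m) \<in> T" using total u by blast
    show "\<alpha> i u \<in> Domain G"
    proof (rule ccontr)
      assume "\<alpha> i u \<notin> Domain G"
      then obtain G' where "linear_relation G'" "G' \<subseteq> T" "single_valued_at_zero G'" "G \<subset> G'"
        using linear_relation_extend[OF T G(1,4,2) um i] by blast
      then show False
        using max[of G'] G(3) by (auto simp: \<G>_def)
    qed
  qed
  define D where "D u = (THE m. (u, m) \<in> G)" for u
  have D_eq: "D u = m" if "(u, m) \<in> G" for u m
    unfolding D_def using that linear_relation_unique[OF G(1,2)] by blast
  have D: "(u, D u) \<in> G" if "u \<in> carrier U" for u
    using dom[OF that] D_eq by auto
  show ?thesis
  proof (intro exI[of _ D] conjI ballI allI impI)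
    show "(u, D u) \<in> T" if "u \<in> carrier U" for u
      using D[OF that] G(4) by blast
    show "D (u \<oplus>\<^bsub>U\<^esub> v) = D u \<oplus>\<^bsub>M\<^esub> D v" if "u \<in> carrier U" "v \<in> carrier U" for u v
      using that D by (intro D_eq linear_relation_add[OF G(1)])
    show "D (su c u) = sm c (D u)" if "u \<in> carrier U" for c u
      using that D by (intro D_eq linear_relation_sc[OF G(1)])
    show "D (\<alpha> i u) = \<beta> i (D u)" if "i \<in> J" "u \<in> carrier U" for i u
      using that D by (intro D_eq linear_relation_proj[OF G(1)])
    show "D u = m" if "(u, m) \<in> G0" for u m
      using that G(3) D_eq by blast
  qed
qed

end

section \<open>Representations of a separated graph\<close>

text \<open>
  The relations, read as identities between operators on \<open>F\<close>. In place of (SCK2) there is the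
  condition \<open>ghosts_faithful\<close>, which is equivalent to it by \<open>vertex_eq_sum_edges\<close> below and is easy
  to verify for an extension of representations.
\<close>

locale cl_action = word_rep F sc act + separated_graph E C
  for F :: "('x, 'z) ring_scheme" (structure) and sc :: "'k::field \<Rightarrow> 'x \<Rightarrow> 'x"
    and act :: "('v, 'e) gen \<Rightarrow> 'x \<Rightarrow> 'x"
    and E :: "('v, 'e) pre_digraph" and C :: "'v \<Rightarrow> 'e set set" +
  fixes S :: "'e set set"
  assumes finite_S: "S \<subseteq> fin_classes E C"
    and vertices: "\<lbrakk>v \<in> verts E; w \<in> verts E; x \<in> carrier F\<rbrakk>
      \<Longrightarrow> act (Vertex v) (act (Vertex w) x) = (if v = w then act (Vertex v) x else \<zero>)"
    and tail_edge: "\<lbrakk>e \<in> arcs E; x \<in> carrier F\<rbrakk>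
      \<Longrightarrow> act (Vertex (tail E e)) (act (Edge e) x) = act (Edge e) x"
    and edge_head: "\<lbrakk>e \<in> arcs E; x \<in> carrier F\<rbrakk>
      \<Longrightarrow> act (Edge e) (act (Vertex (head E e)) x) = act (Edge e) x"
    and head_ghost: "\<lbrakk>e \<in> arcs E; x \<in> carrier F\<rbrakk>
      \<Longrightarrow> act (Vertex (head E e)) (act (Ghost e) x) = act (Ghost e) x"
    and ghost_tail: "\<lbrakk>e \<in> arcs E; x \<in> carrier F\<rbrakk>
      \<Longrightarrow> act (Ghost e) (act (Vertex (tail E e)) x) = act (Ghost e) x"
    and ghost_edge: "\<lbrakk>X \<in> all_classes E C; e \<in> X; e' \<in> X; x \<in> carrier F\<rbrakk>
      \<Longrightarrow> act (Ghost e) (act (Edge e') x) = (if e = e' then act (Vertex (head E e)) x else \<zero>)"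
    and ghosts_faithful: "\<lbrakk>v \<in> verts E; X \<in> S \<inter> C v; x \<in> carrier F;
      \<And>e. e \<in> X \<Longrightarrow> act (Ghost e) x = \<zero>\<rbrakk> \<Longrightarrow> act (Vertex v) x = \<zero>"

context separated_graph
begin

lemma class_subset:
  assumes "v \<in> verts E" "X \<in> C v"
  shows "X \<subseteq> {e \<in> arcs E. tail E e = v}"
  using partition_onD1[OF partition[OF assms(1)]] assms(2) by blast

lemma class_arcs:
  assumes "X \<in> all_classes E C" "e \<in> X"
  shows "e \<in> arcs E" "X \<in> C (tail E e)"
  using assms class_subset by (auto simp: all_classes_def)

lemma class_tail_eq:
  assumes "X \<in> all_classes E C" "e \<in> X" "e' \<in> X"
  shows "tail E e' = tail E e"
proof -
  obtain v where v: "v \<in> verts E" "X \<in> C v"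
    using assms(1) by (auto simp: all_classes_def)
  then show ?thesis
    using class_subset[OF v] assms(2,3) by auto
qed

lemma class_unique:
  assumes "X \<in> all_classes E C" "X' \<in> all_classes E C" "e \<in> X" "e \<in> X'"
  shows "X = X'"
proof -
  have "X \<in> C (tail E e)" "X' \<in> C (tail E e)" "tail E e \<in> verts E"
    using assms class_arcs by auto
  then have "disjnt X X' \<or> X = X'"
    using partition partition_onD2 unfolding disjoint_def disjnt_def by metis
  with assms show ?thesis by (auto simp: disjnt_def)
qed

lemma arc_in_class:
  assumes "e \<in> arcs E"
  shows "\<exists>X\<in>all_classes E C. e \<in> X"
proof -
  have v: "tail E e \<in> verts E" using assms by simp
  have "e \<in> \<Union> (C (tail E e))"
    using assms by (simp flip: partition_onD1[OF partition[OF v]])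
  with v show ?thesis by (auto simp: all_classes_def)
qed

lemma cl_relations_carrier:
  fixes S :: "'e set set"
  shows "cl_relations E C S \<subseteq> carrier (free_algebra TYPE('k::field) (cl_generators E))"
proof
  note intros = free_algebra_diff free_algebra_mult free_algebra_gen free_algebra_zero free_algebra_sum
  have gen: "vertex_elem v \<in> carrier (free_algebra TYPE('k) (cl_generators E))" if "v \<in> verts E" for v
    using that by (auto intro!: intros simp: cl_generators_def)
  have arc: "edge_elem e \<in> carrier (free_algebra TYPE('k) (cl_generators E))"
    "ghost_elem e \<in> carrier (free_algebra TYPE('k) (cl_generators E))" if "e \<in> arcs E" for e
    using that by (auto intro!: intros simp: cl_generators_def)
  have cl: "e \<in> arcs E" if "X \<in> C v" "v \<in> verts E" "e \<in> X" for e X v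
    using that class_arcs[of X e] by (auto simp: all_classes_def)
  fix f :: "('v, 'e) gen free_word \<Rightarrow>\<^sub>0 'k" assume "f \<in> cl_relations E C S"
  then show "f \<in> carrier (free_algebra TYPE('k) (cl_generators E))"
    unfolding cl_relations_def
    by (elim UnE CollectE exE conjE; hypsubst)
      (use class_arcs cl in \<open>auto intro!: intros gen arc split: if_splits\<close>)
qed

fun left_vertex :: "('v, 'e) gen \<Rightarrow> 'v"
  where "left_vertex (Vertex v) = v"
  | "left_vertex (Edge e) = tail E e"
  | "left_vertex (Ghost e) = head E e"

fun right_vertex :: "('v, 'e) gen \<Rightarrow> 'v"
  where "right_vertex (Vertex v) = v"
  | "right_vertex (Edge e) = head E e"
  | "right_vertex (Ghost e) = tail E e"

end

context cl_action
begin

lemma vertex_sum_vertex: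
  assumes x: "x \<in> carrier F" and v: "v \<in> verts E" and V: "finite V" "V \<subseteq> verts E"
  shows "ev (\<Sum>w\<in>V. vertex_elem w) (act (Vertex v) x) = (if v \<in> V then act (Vertex v) x else \<zero>)"
  using V by (induction V rule: finite_induct)
    (auto simp: ev_zero ev_add ev_gen act_closed vertices v x)

lemma vertex_sum_in:
  assumes "x \<in> carrier F" "finite V" "\<zero> \<in> D" "\<And>y z. \<lbrakk>y \<in> D; z \<in> D\<rbrakk> \<Longrightarrow> y \<oplus> z \<in> D"
    and "\<And>v. v \<in> V \<Longrightarrow> act (Vertex v) x \<in> D"
  shows "ev (\<Sum>v\<in>V. vertex_elem v) x \<in> D"
  using assms(2,5) by (induction V rule: finite_induct)
    (auto simp: ev_zero ev_add ev_gen assms)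

text \<open>
  The algebra has no unit if there are infinitely many vertices, but the finite sums of vertices are
  local units. A module is full and nondegenerate exactly if each of its elements is fixed by such
  a sum; in this form the condition passes to submodules, quotients and extensions.
\<close>

definition has_local_unit :: "'x \<Rightarrow> bool"
  where "has_local_unit x \<longleftrightarrow> (\<exists>V. finite V \<and> V \<subseteq> verts E \<and> ev (\<Sum>v\<in>V. vertex_elem v) x = x)"

lemma local_unit_mono:
  assumes x: "x \<in> carrier F" and W: "finite W" "W \<subseteq> verts E" and V: "V \<subseteq> W"
    and "ev (\<Sum>v\<in>V. vertex_elem v) x = x"
  shows "ev (\<Sum>v\<in>W. vertex_elem v) x = x"
proof -
  let ?D = "{y \<in> carrier F. ev (\<Sum>v\<in>W. vertex_elem v) y = y}"
  have "finite V"
    using V W finite_subset by blast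
  have "ev (\<Sum>v\<in>W. vertex_elem v) (act (Vertex v) x) = act (Vertex v) x" if "v \<in> V" for v
  proof -
    have "v \<in> W" "v \<in> verts E" using that W V by blast+
    then show ?thesis using vertex_sum_vertex[OF x _ W] by simp
  qed
  then have "ev (\<Sum>v\<in>V. vertex_elem v) x \<in> ?D"
    by (intro vertex_sum_in[OF x \<open>finite V\<close>]) (auto simp: ev_add_right act_closed ev_zero_right x)
  with assms show ?thesis by auto
qed

lemma has_local_unit_add:
  assumes "has_local_unit x" "has_local_unit y" and xy: "x \<in> carrier F" "y \<in> carrier F"
  shows "has_local_unit (x \<oplus> y)"
proof -
  obtain V where V: "finite V" "V \<subseteq> verts E" "ev (\<Sum>v\<in>V. vertex_elem v) x = x"
    using assms by (auto simp: has_local_unit_def)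
  obtain W where W: "finite W" "W \<subseteq> verts E" "ev (\<Sum>v\<in>W. vertex_elem v) y = y"
    using assms by (auto simp: has_local_unit_def)
  have "ev (\<Sum>v\<in>V \<union> W. vertex_elem v) (x \<oplus> y) = x \<oplus> y"
    using xy V W local_unit_mono[of x "V \<union> W" V] local_unit_mono[of y "V \<union> W" W]
    by (simp add: ev_add_right)
  then show ?thesis
    using V W unfolding has_local_unit_def by (intro exI[of _ "V \<union> W"]) auto
qed

lemma has_local_unit_sc: "\<lbrakk>has_local_unit x; x \<in> carrier F\<rbrakk> \<Longrightarrow> has_local_unit (sc c x)"
  unfolding has_local_unit_def by (metis ev_mult ev_scalar single_central)

lemma left_vertex_act:
  "\<lbrakk>g \<in> cl_generators E; x \<in> carrier F\<rbrakk> \<Longrightarrow> act (Vertex (left_vertex g)) (act g x) = act g x"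
  by (cases g) (auto simp: cl_generators_def vertices tail_edge head_ghost)

lemma act_right_vertex:
  "\<lbrakk>g \<in> cl_generators E; x \<in> carrier F\<rbrakk> \<Longrightarrow> act g (act (Vertex (right_vertex g)) x) = act g x"
  by (cases g) (auto simp: cl_generators_def vertices edge_head ghost_tail)

lemma has_local_unit_act:
  assumes g: "g \<in> cl_generators E" and x: "x \<in> carrier F"
  shows "has_local_unit (act g x)"
proof -
  have "left_vertex g \<in> verts E"
    using g by (cases g) (auto simp: cl_generators_def)
  then show ?thesis
    unfolding has_local_unit_def using x left_vertex_act[OF g x]
    by (intro exI[of _ "{left_vertex g}"]) (auto simp: ev_gen act_closed)
qed

lemma has_local_unit_ev:
  assumes f: "f \<in> carrier (free_algebra TYPE('k) (cl_generators E))" and x: "x \<in> carrier F"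
  shows "has_local_unit (ev f x)"
  using f
proof (induction f rule: free_algebra_induct)
  case (single w c)
  then obtain g l where "letters w = g # l" "g \<in> cl_generators E"
    by (cases "letters w") auto
  then show ?case
    using x by (auto simp: ev_single act_closed word_closed intro!: has_local_unit_sc has_local_unit_act)
next
  case (add f g)
  then show ?case
    using x by (auto simp: ev_add ev_closed intro!: has_local_unit_add)
next
  case zero
  show ?case
    unfolding has_local_unit_def by (rule exI[of _ "{}"]) (simp add: ev_zero)
qed

lemma ghost_sum_edges:
  assumes cl: "X \<in> all_classes E C" and "finite Y" "Y \<subseteq> X" "e \<in> X" and x: "x \<in> carrier F"
  shows "act (Ghost e) (ev (\<Sum>e\<in>Y. edge_elem e * ghost_elem e) x)
    = (if e \<in> Y then act (Ghost e) x else \<zero>)"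
  using assms(2-4)
  by (induction Y rule: finite_induct)
    (auto simp: ev_zero act_zero ev_add ev_mult ev_gen act_add act_closed ev_closed x
      ghost_edge[OF cl] head_ghost class_arcs[OF cl])

text \<open>
  The element \<open>vx - \<Sum>ee\<^sup>*x\<close>, where \<open>e\<close> runs through the class \<open>X\<close>, is killed by every \<open>e\<^sup>*\<close> with
  \<open>e \<in> X\<close> by (SCK1), and it is fixed by \<open>v\<close>. Hence it is zero if the ghost edges in \<open>X\<close> are jointly
  faithful on the image of \<open>v\<close>.
\<close>

lemma vertex_eq_sum_edges:
  assumes v: "v \<in> verts E" and X: "X \<in> S" "X \<in> C v" and x: "x \<in> carrier F"
  shows "ev (\<Sum>e\<in>X. edge_elem e * ghost_elem e) x = act (Vertex v) x"
proof -
  let ?y = "\<lambda>Y. ev (\<Sum>e\<in>Y. edge_elem e * ghost_elem e) x"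
  have cl: "X \<in> all_classes E C" and fin: "finite X"
    using v X finite_S by (auto simp: all_classes_def fin_classes_def)
  have arc: "e \<in> arcs E \<and> tail E e = v" if "e \<in> X" for e
    using class_subset[OF v X(2)] that by blast
  have step: "ev (edge_elem e * ghost_elem e + f) x = act (Edge e) (act (Ghost e) x) \<oplus> ev f x" for e f
    using x by (simp add: ev_add ev_mult ev_gen act_closed)
  note ghost = ghost_sum_edges[OF cl _ _ _ x]
  have vertex: "act (Vertex v) (?y Y) = ?y Y" if "finite Y" "Y \<subseteq> X" for Y
    using that
  proof (induction Y rule: finite_induct)
    case (insert e Y)
    then have "act (Vertex v) (act (Edge e) (act (Ghost e) x)) = act (Edge e) (act (Ghost e) x)"
      using arc[of e] tail_edge[of e] x act_closed by auto
    with insert show ?case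
      by (simp add: step act_add act_closed ev_closed x)
  qed (simp add: ev_zero act_zero)
  let ?z = "act (Vertex v) x \<ominus> ?y X"
  have "act (Ghost e) ?z = \<zero>" if "e \<in> X" for e
    using that arc[OF that] ghost_tail[of e x] ghost[OF fin subset_refl that] x
    by (auto simp: a_minus_def act_add act_minus act_closed ev_closed r_neg)
  then have "act (Vertex v) ?z = \<zero>"
    using v X x by (intro ghosts_faithful[of v X]) (auto simp: act_closed ev_closed)
  then have "?z = \<zero>"
    using v x vertex[OF fin subset_refl]
    by (auto simp: a_minus_def act_add act_minus act_closed ev_closed vertices)
  then show ?thesis
    using diff_eq_zeroD[of "act (Vertex v) x" "?y X"] x by (simp add: act_closed ev_closed)
qed

lemma relations_act_trivially:
  assumes f: "f \<in> cl_relations E C S" and x: "x \<in> carrier F"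
  shows "ev f x = \<zero>"
proof -
  have eq: "ev (g - h) x = \<zero>" if "ev g x = ev h x" for g h
    using that x by (simp add: ev_diff a_minus_def r_neg ev_closed)
  show ?thesis
    using f unfolding cl_relations_def
    by (elim UnE CollectE exE conjE; hypsubst)
      (use x in \<open>auto intro!: eq simp: ev_mult ev_gen act_closed vertices tail_edge edge_head
        head_ghost ghost_tail ghost_edge vertex_eq_sum_edges ev_zero split: if_splits\<close>)
qed

end

locale cl_rep = cl_action +
  assumes local_unit: "x \<in> carrier F \<Longrightarrow> has_local_unit x"
begin

lemma vertex_graded: "graded_space F sc (verts E) (\<lambda>v. act (Vertex v))"
proof unfold_locales
  fix u D
  assume u: "u \<in> carrier F" "\<zero> \<in> D" "\<And>x y. \<lbrakk>x \<in> D; y \<in> D\<rbrakk> \<Longrightarrow> x \<oplus> y \<in> D"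
    "\<And>i. i \<in> verts E \<Longrightarrow> act (Vertex i) u \<in> D"
  obtain V where V: "finite V" "V \<subseteq> verts E" "ev (\<Sum>v\<in>V. vertex_elem v) u = u"
    using local_unit[OF u(1)] by (auto simp: has_local_unit_def)
  have "ev (\<Sum>v\<in>V. vertex_elem v) u \<in> D"
    using V u by (intro vertex_sum_in) auto
  with V show "u \<in> D" by simp
qed (auto simp: act_closed act_add act_sc vertices)

end

section \<open>Modules over the Cohn--Leavitt algebra as representations\<close>

context left_module
begin

lemma smult_zero: "a \<in> carrier R \<Longrightarrow> a \<odot>\<^bsub>M\<^esub> \<zero>\<^bsub>M\<^esub> = \<zero>\<^bsub>M\<^esub>"
  using smult_r_distr[of a "\<zero>\<^bsub>M\<^esub>" "\<zero>\<^bsub>M\<^esub>"] smult_closed[of a "\<zero>\<^bsub>M\<^esub>"]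
  by (simp add: add.r_cancel_one')

lemma smult_minus:
  assumes "a \<in> carrier R" "x \<in> carrier M"
  shows "a \<odot>\<^bsub>M\<^esub> (\<ominus>\<^bsub>M\<^esub> x) = \<ominus>\<^bsub>M\<^esub> (a \<odot>\<^bsub>M\<^esub> x)"
  using assms smult_r_distr[of a "\<ominus>\<^bsub>M\<^esub> x" x] minus_equality[of "a \<odot>\<^bsub>M\<^esub> (\<ominus>\<^bsub>M\<^esub> x)" "a \<odot>\<^bsub>M\<^esub> x"]
  by (simp add: smult_zero smult_closed l_neg)

lemma smult_diff:
  assumes "a \<in> carrier R" "x \<in> carrier M" "y \<in> carrier M"
  shows "a \<odot>\<^bsub>M\<^esub> (x \<ominus>\<^bsub>M\<^esub> y) = a \<odot>\<^bsub>M\<^esub> x \<ominus>\<^bsub>M\<^esub> a \<odot>\<^bsub>M\<^esub> y"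
  using assms by (simp add: a_minus_def smult_r_distr smult_minus)

text \<open>
  The set of the products \<open>a y\<close> is closed under negation, because \<open>- (a y) = a (- y)\<close>; so the group
  generated by it is the set of its finite sums.
\<close>

lemma full_module_induct [consumes 3, case_names smult add]:
  assumes full: "full_module R M" and x: "x \<in> carrier M" and R: "carrier R \<noteq> {}"
    and smult: "\<And>a y. \<lbrakk>a \<in> carrier R; y \<in> carrier M\<rbrakk> \<Longrightarrow> P (a \<odot>\<^bsub>M\<^esub> y)"
    and add: "\<And>x y. \<lbrakk>x \<in> carrier M; y \<in> carrier M; P x; P y\<rbrakk> \<Longrightarrow> P (x \<oplus>\<^bsub>M\<^esub> y)"
  shows "P x"
proof -
  have "x \<in> generate (add_monoid M) {a \<odot>\<^bsub>M\<^esub> x | a x. a \<in> carrier R \<and> x \<in> carrier M}"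
    using full x by (simp add: full_module_def)
  then have "x \<in> carrier M \<and> P x"
  proof (induction x rule: generate.induct)
    case one
    obtain a where "a \<in> carrier R" using R by blast
    then show ?case
      using smult[of a "\<zero>\<^bsub>M\<^esub>"] by (simp add: smult_zero)
  next
    case (incl h)
    then show ?case
      using smult smult_closed by auto
  next
    case (inv h)
    then obtain a y where "h = a \<odot>\<^bsub>M\<^esub> y" "a \<in> carrier R" "y \<in> carrier M" by blast
    moreover have "inv\<^bsub>add_monoid M\<^esub> h = \<ominus>\<^bsub>M\<^esub> h"
      by (simp add: a_inv_def)
    ultimately show ?case
      using smult[of a "\<ominus>\<^bsub>M\<^esub> y"] smult_closed by (simp add: smult_minus)
  next
    case (eng h h')
    then show ?case
      using add by simp
  qed
  then show ?thesis ..
qed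

end

lemma mod_morphismsD:
  assumes "f \<in> mod_morphisms R M N"
  shows "x \<in> carrier M \<Longrightarrow> f x \<in> carrier N"
    and "\<lbrakk>x \<in> carrier M; y \<in> carrier M\<rbrakk> \<Longrightarrow> f (x \<oplus>\<^bsub>M\<^esub> y) = f x \<oplus>\<^bsub>N\<^esub> f y"
    and "\<lbrakk>a \<in> carrier R; x \<in> carrier M\<rbrakk> \<Longrightarrow> f (a \<odot>\<^bsub>M\<^esub> x) = a \<odot>\<^bsub>N\<^esub> f x"
  using assms by (auto simp: mod_morphisms_def)

lemma projective_objectD:
  assumes "projective_object R P" "mod_object R M" "mod_object R N" "mod_epi R M N p"
    and "g \<in> mod_morphisms R P N"
  shows "\<exists>h\<in>mod_morphisms R P M. \<forall>x\<in>carrier P. p (h x) = g x"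
  using assms by (simp add: projective_object_def)

text \<open>
  A ring \<open>R\<close> together with a surjection \<open>\<rho>\<close> of the free algebra onto it whose kernel is the ideal
  generated by the relations. The locale covers the Cohn--Leavitt algebra and its opposite ring at
  once. In \<open>rho_kernel\<close> the generated ideal is replaced by an arbitrary ideal \<open>I\<close> that contains the
  relations, which is the form in which the universal property is applied.
\<close>

locale cl_presentation = separated_graph E C + R: nonunital_ring R
  for E :: "('v, 'e) pre_digraph" and C :: "'v \<Rightarrow> 'e set set" and R :: "('r, 'z) ring_scheme" +
  fixes S :: "'e set set" and \<rho> :: "(('v, 'e) gen free_word \<Rightarrow>\<^sub>0 'k::field) \<Rightarrow> 'r"
  assumes finite_S: "S \<subseteq> fin_classes E C"
    and rho_closed: "f \<in> carrier (free_algebra TYPE('k) (cl_generators E)) \<Longrightarrow> \<rho> f \<in> carrier R"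
    and rho_surj: "a \<in> carrier R \<Longrightarrow> \<exists>f\<in>carrier (free_algebra TYPE('k) (cl_generators E)). a = \<rho> f"
    and rho_add: "\<lbrakk>f \<in> carrier (free_algebra TYPE('k) (cl_generators E));
      g \<in> carrier (free_algebra TYPE('k) (cl_generators E))\<rbrakk> \<Longrightarrow> \<rho> (f + g) = \<rho> f \<oplus>\<^bsub>R\<^esub> \<rho> g"
    and rho_mult: "\<lbrakk>f \<in> carrier (free_algebra TYPE('k) (cl_generators E));
      g \<in> carrier (free_algebra TYPE('k) (cl_generators E))\<rbrakk> \<Longrightarrow> \<rho> (f * g) = \<rho> f \<otimes>\<^bsub>R\<^esub> \<rho> g"
    and rho_relation: "\<lbrakk>f \<in> carrier (free_algebra TYPE('k) (cl_generators E));
      g \<in> carrier (free_algebra TYPE('k) (cl_generators E));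
      f - g \<in> cl_relations E C S\<rbrakk> \<Longrightarrow> \<rho> f = \<rho> g"
    and rho_kernel: "\<lbrakk>f \<in> carrier (free_algebra TYPE('k) (cl_generators E));
      g \<in> carrier (free_algebra TYPE('k) (cl_generators E)); \<rho> f = \<rho> g;
      algebra_ideal (cl_generators E) I; cl_relations E C S \<subseteq> I\<rbrakk> \<Longrightarrow> f - g \<in> I"
begin

abbreviation G where "G \<equiv> cl_generators E"
abbreviation FA where "FA \<equiv> carrier (free_algebra TYPE('k) (cl_generators E))"

lemma G_simps [simp]: 
  "Vertex v \<in> G \<longleftrightarrow> v \<in> verts E" "Edge e \<in> G \<longleftrightarrow> e \<in> arcs E" "Ghost e \<in> G \<longleftrightarrow> e \<in> arcs E"
  by (auto simp: cl_generators_def)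

lemmas FA_intros = free_algebra_zero free_algebra_add free_algebra_diff free_algebra_mult
  free_algebra_gen free_algebra_scalar free_algebra_sum

text \<open>
  A full nondegenerate module carries a canonical scalar multiplication, although modules are only
  assumed to be abelian groups: \<open>c x\<close> is the element on which each \<open>a \<in> R\<close> acts as \<open>c a\<close> acts on
  \<open>x\<close>. It is unique by nondegeneracy. It exists by fullness, for \<open>c (\<Sum>a\<^sub>jx\<^sub>j) = \<Sum>(c a\<^sub>j)x\<^sub>j\<close>.
\<close>

definition scal :: "('r, 'm) module \<Rightarrow> 'k \<Rightarrow> 'm \<Rightarrow> 'm"
  where "scal M c x = (THE y. y \<in> carrier M \<and>
    (\<forall>f\<in>FA. \<rho> f \<odot>\<^bsub>M\<^esub> y = \<rho> (Poly_Mapping.single 0 c * f) \<odot>\<^bsub>M\<^esub> x))"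

text \<open>
  The value zero for letters that are not generators makes it possible to evaluate polynomials in
  arbitrary letters.
\<close>

definition gact :: "('r, 'm) module \<Rightarrow> ('v, 'e) gen \<Rightarrow> 'm \<Rightarrow> 'm"
  where "gact M g x = (if g \<in> G then \<rho> (gen_elem g) \<odot>\<^bsub>M\<^esub> x else \<zero>\<^bsub>M\<^esub>)"

lemma obj_eqI:
  assumes M: "mod_object R M" and xy: "x \<in> carrier M" "y \<in> carrier M"
    and eq: "\<And>f. f \<in> FA \<Longrightarrow> \<rho> f \<odot>\<^bsub>M\<^esub> x = \<rho> f \<odot>\<^bsub>M\<^esub> y"
  shows "x = y"
proof -
  interpret M: left_module R M using M by (simp add: mod_object_def)
  have "a \<odot>\<^bsub>M\<^esub> (x \<ominus>\<^bsub>M\<^esub> y) = \<zero>\<^bsub>M\<^esub>" if "a \<in> carrier R" for a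
  proof -
    obtain f where "f \<in> FA" "a = \<rho> f" using rho_surj[OF \<open>a \<in> carrier R\<close>] by blast
    then have "a \<odot>\<^bsub>M\<^esub> (x \<ominus>\<^bsub>M\<^esub> y) = a \<odot>\<^bsub>M\<^esub> y \<ominus>\<^bsub>M\<^esub> a \<odot>\<^bsub>M\<^esub> y"
      using that xy eq by (simp add: M.smult_diff)
    then show ?thesis
      using that xy by (simp add: a_minus_def M.r_neg M.smult_closed)
  qed
  then have "x \<ominus>\<^bsub>M\<^esub> y = \<zero>\<^bsub>M\<^esub>"
    using M xy by (simp add: mod_object_def nondegenerate_module_def)
  then show ?thesis
    using xy by (rule M.diff_eq_zeroD)
qed

lemma scal_char:
  assumes M: "mod_object R M" and x: "x \<in> carrier M"
  shows "scal M c x \<in> carrier M"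
    and "f \<in> FA \<Longrightarrow> \<rho> f \<odot>\<^bsub>M\<^esub> scal M c x = \<rho> (Poly_Mapping.single 0 c * f) \<odot>\<^bsub>M\<^esub> x"
proof -
  interpret M: left_module R M using M by (simp add: mod_object_def)
  let ?c = "Poly_Mapping.single 0 c :: ('v, 'e) gen free_word \<Rightarrow>\<^sub>0 'k"
  let ?P = "\<lambda>x y. y \<in> carrier M \<and> (\<forall>f\<in>FA. \<rho> f \<odot>\<^bsub>M\<^esub> y = \<rho> (?c * f) \<odot>\<^bsub>M\<^esub> x)"
  have "full_module R M" "carrier R \<noteq> {}"
    using M R.zero_closed by (auto simp: mod_object_def)
  from this(1) x this(2) have "\<exists>y. ?P x y"
  proof (induction x rule: M.full_module_induct)
    case (smult a y)
    obtain h where h: "h \<in> FA" "a = \<rho> h"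
      using rho_surj smult by blast
    have "\<rho> f \<odot>\<^bsub>M\<^esub> (\<rho> (?c * h) \<odot>\<^bsub>M\<^esub> y) = \<rho> (?c * f) \<odot>\<^bsub>M\<^esub> (\<rho> h \<odot>\<^bsub>M\<^esub> y)" if f: "f \<in> FA" for f
    proof -
      have "f * (?c * h) = (?c * f) * h"
        using single_central[of c f] by (metis mult.assoc)
      then show ?thesis
        using f h smult by (simp add: rho_closed FA_intros flip: M.smult_assoc rho_mult)
    qed
    then show ?case
      using h smult by (intro exI[of _ "\<rho> (?c * h) \<odot>\<^bsub>M\<^esub> y"])
        (auto simp: rho_closed FA_intros M.smult_closed)
  next
    case (add x y)
    then obtain x' y' where "?P x x'" "?P y y'" by blast
    with add show ?case
      by (intro exI[of _ "x' \<oplus>\<^bsub>M\<^esub> y'"]) (auto simp: M.smult_r_distr rho_closed FA_intros)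
  qed
  moreover have "y = y'" if "?P x y" "?P x y'" for y y'
    by (rule obj_eqI[OF M]) (use that in auto)
  ultimately have "\<exists>!y. ?P x y"
    by (rule ex_ex1I)
  then have "?P x (scal M c x)"
    unfolding scal_def by (rule theI')
  then show "scal M c x \<in> carrier M"
    and "f \<in> FA \<Longrightarrow> \<rho> f \<odot>\<^bsub>M\<^esub> scal M c x = \<rho> (?c * f) \<odot>\<^bsub>M\<^esub> x"
    by blast+
qed

lemma scal_smult:
  assumes M: "mod_object R M" and x: "x \<in> carrier M" and f: "f \<in> FA"
  shows "\<rho> (Poly_Mapping.single 0 c * f) \<odot>\<^bsub>M\<^esub> x = scal M c (\<rho> f \<odot>\<^bsub>M\<^esub> x)"
proof -
  interpret M: left_module R M using M by (simp add: mod_object_def)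
  have comm: "h * (Poly_Mapping.single 0 c * f) = (Poly_Mapping.single 0 c * h) * f"
    for h :: "('v, 'e) gen free_word \<Rightarrow>\<^sub>0 'k"
    using single_central[of c h] by (metis mult.assoc)
  show ?thesis
    by (rule obj_eqI[OF M])
        (use x f comm in \<open>auto simp: M.smult_closed scal_char[OF M] rho_closed FA_intros simp flip: M.smult_assoc rho_mult\<close>)
qed

lemma word_rep_object:
  assumes M: "mod_object R M"
  shows "word_rep M (scal M) (gact M)"
proof -
  interpret M: left_module R M using M by (simp add: mod_object_def)
  have c: "scal M c x \<in> carrier M" if "x \<in> carrier M" for c x
    using that by (rule scal_char[OF M])
  have g: "gact M g x \<in> carrier M" if "x \<in> carrier M" for g x
    using that by (auto simp: gact_def M.smult_closed rho_closed FA_intros)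
  show ?thesis
  proof unfold_locales
    show "scal M (c + d) x = scal M c x \<oplus>\<^bsub>M\<^esub> scal M d x" if "x \<in> carrier M" for c d x
      by (rule obj_eqI[OF M])
        (use that in \<open>auto simp: c scal_char[OF M] M.smult_r_distr rho_closed FA_intros single_add distrib_right
          rho_add M.smult_l_distr\<close>)
    show "scal M c (x \<oplus>\<^bsub>M\<^esub> y) = scal M c x \<oplus>\<^bsub>M\<^esub> scal M c y"
      if "x \<in> carrier M" "y \<in> carrier M" for c x y
      by (rule obj_eqI[OF M])
        (use that in \<open>auto simp: c scal_char[OF M] M.smult_r_distr rho_closed FA_intros\<close>)
    show "scal M (c * d) x = scal M c (scal M d x)" if "x \<in> carrier M" for c d x
    proof -
      have comm: "Poly_Mapping.single 0 (c * d) * f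
          = Poly_Mapping.single 0 d * (Poly_Mapping.single 0 c * f)"
        for f :: "('v, 'e) gen free_word \<Rightarrow>\<^sub>0 'k"
        by (simp add: mult_single mult.commute flip: mult.assoc)
      show ?thesis
        by (rule obj_eqI[OF M])
        (use that comm in \<open>auto simp: c scal_char[OF M] FA_intros\<close>)
    qed
    show "scal M 1 x = x" if "x \<in> carrier M" for x
      by (rule obj_eqI[OF M])
        (use that in \<open>auto simp: c scal_char[OF M]\<close>)
    show "gact M g (x \<oplus>\<^bsub>M\<^esub> y) = gact M g x \<oplus>\<^bsub>M\<^esub> gact M g y"
      if "x \<in> carrier M" "y \<in> carrier M" for g x y
      using that by (auto simp: gact_def M.smult_r_distr rho_closed FA_intros)
    show "gact M g (scal M c x) = scal M c (gact M g x)" if "x \<in> carrier M" for g c x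
    proof (cases "g \<in> G")
      case False
      have "scal M c \<zero>\<^bsub>M\<^esub> = \<zero>\<^bsub>M\<^esub>"
        by (rule obj_eqI[OF M]) (auto simp: c scal_char[OF M] M.smult_zero rho_closed FA_intros)
      with False show ?thesis by (simp add: gact_def)
    qed (use that in \<open>auto simp: gact_def scal_char[OF M] scal_smult[OF M] FA_intros\<close>)
  qed (use c g in auto)
qed

lemma smult_eq_ev:
  assumes M: "mod_object R M" and x: "x \<in> carrier M" and f: "f \<in> FA"
  shows "\<rho> f \<odot>\<^bsub>M\<^esub> x = word_eval M (scal M) (gact M) f x"
proof -
  interpret M: left_module R M using M by (simp add: mod_object_def)
  interpret W: word_rep M "scal M" "gact M" using M by (rule word_rep_object)
  have word: "\<rho> (Poly_Mapping.single (Free_Word l) 1) \<odot>\<^bsub>M\<^esub> x = foldr (gact M) l x"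
    if "l \<noteq> []" "set l \<subseteq> G" for l
    using that
  proof (induction l rule: list_nonempty_induct)
    case (single g)
    then show ?case by (simp add: gact_def gen_elem_def)
  next
    case (cons g l)
    then have "Poly_Mapping.single (Free_Word l) (1 :: 'k) \<in> FA"
      by (intro free_algebra_single) auto
    with cons x show ?case
      by (simp add: single_Cons rho_mult FA_intros M.smult_assoc rho_closed gact_def)
  qed
  have single: "\<rho> (Poly_Mapping.single w c) \<odot>\<^bsub>M\<^esub> x = W.ev (Poly_Mapping.single w c) x"
    if "letters w \<noteq> []" "set (letters w) \<subseteq> G" for w c
  proof -
    have "Poly_Mapping.single w (1 :: 'k) \<in> FA"
      using that by (intro free_algebra_single) auto
    then show ?thesis
      using that word[of "letters w"] x
      by (subst single_word_scalar) (simp add: scal_smult[OF M] W.ev_single)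
  qed
  show ?thesis
    using f
  proof (induction f rule: free_algebra_induct)
    case zero
    have "\<rho> 0 \<oplus>\<^bsub>R\<^esub> \<rho> 0 = \<rho> 0"
      using rho_add[of 0 0] by (simp add: FA_intros)
    then have "\<rho> 0 \<odot>\<^bsub>M\<^esub> x = \<zero>\<^bsub>M\<^esub>"
      using M.smult_l_distr[of "\<rho> 0" "\<rho> 0" x] x
      by (simp add: rho_closed FA_intros M.smult_closed M.add.r_cancel_one')
    then show ?case by (simp add: W.ev_zero)
  next
    case (add f g)
    then show ?case
      using x by (simp add: rho_add M.smult_l_distr rho_closed W.ev_add)
  qed (rule single)
qed

lemma cl_rep_object:
  assumes M: "mod_object R M"
  shows "cl_rep M (scal M) (gact M) E C S"
proof -
  interpret M: left_module R M using M by (simp add: mod_object_def)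
  interpret W: word_rep M "scal M" "gact M" using M by (rule word_rep_object)
  have rel: "W.ev f x = W.ev g x"
    if "f \<in> FA" "g \<in> FA" "f - g \<in> cl_relations E C S" "x \<in> carrier M" for f g x
    using that rho_relation[of f g] smult_eq_ev[OF M] by metis
  note ev = W.ev_mult W.ev_gen W.act_closed W.ev_zero
  interpret A: cl_action M "scal M" "gact M" E C S
  proof unfold_locales
    show "gact M (Vertex v) (gact M (Vertex w) x) = (if v = w then gact M (Vertex v) x else \<zero>\<^bsub>M\<^esub>)"
      if "v \<in> verts E" "w \<in> verts E" "x \<in> carrier M" for v w x
    proof -
      have "vertex_elem v * vertex_elem w - (if v = w then vertex_elem v else 0)
          \<in> cl_relations E C S"
        using that unfolding cl_relations_def by blast
      then show ?thesis
        using rel[of "vertex_elem v * vertex_elem w" "if v = w then vertex_elem v else 0" x] that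
        by (auto simp: ev FA_intros split: if_splits)
    qed
    show "gact M (Vertex (tail E e)) (gact M (Edge e) x) = gact M (Edge e) x"
      if "e \<in> arcs E" "x \<in> carrier M" for e x
    proof -
      have "vertex_elem (tail E e) * edge_elem e - edge_elem e \<in> cl_relations E C S"
        using that unfolding cl_relations_def by blast
      then show ?thesis
        using rel[of "vertex_elem (tail E e) * edge_elem e" "edge_elem e" x] that by (auto simp: ev FA_intros)
    qed
    show "gact M (Edge e) (gact M (Vertex (head E e)) x) = gact M (Edge e) x"
      if "e \<in> arcs E" "x \<in> carrier M" for e x
    proof -
      have "edge_elem e * vertex_elem (head E e) - edge_elem e \<in> cl_relations E C S"
        using that unfolding cl_relations_def by blast
      then show ?thesis
        using rel[of "edge_elem e * vertex_elem (head E e)" "edge_elem e" x] that by (auto simp: ev FA_intros)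
    qed
    show "gact M (Vertex (head E e)) (gact M (Ghost e) x) = gact M (Ghost e) x"
      if "e \<in> arcs E" "x \<in> carrier M" for e x
    proof -
      have "vertex_elem (head E e) * ghost_elem e - ghost_elem e \<in> cl_relations E C S"
        using that unfolding cl_relations_def by blast
      then show ?thesis
        using rel[of "vertex_elem (head E e) * ghost_elem e" "ghost_elem e" x] that by (auto simp: ev FA_intros)
    qed
    show "gact M (Ghost e) (gact M (Vertex (tail E e)) x) = gact M (Ghost e) x"
      if "e \<in> arcs E" "x \<in> carrier M" for e x
    proof -
      have "ghost_elem e * vertex_elem (tail E e) - ghost_elem e \<in> cl_relations E C S"
        using that unfolding cl_relations_def by blast
      then show ?thesis
        using rel[of "ghost_elem e * vertex_elem (tail E e)" "ghost_elem e" x] that by (auto simp: ev FA_intros)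
    qed
    show "gact M (Ghost e) (gact M (Edge e') x)
        = (if e = e' then gact M (Vertex (head E e)) x else \<zero>\<^bsub>M\<^esub>)"
      if "X \<in> all_classes E C" "e \<in> X" "e' \<in> X" "x \<in> carrier M" for X e e' x
    proof -
      have "ghost_elem e * edge_elem e' - (if e = e' then vertex_elem (head E e) else 0)
          \<in> cl_relations E C S"
        using that unfolding cl_relations_def by blast
      then show ?thesis
        using rel[of "ghost_elem e * edge_elem e'" "if e = e' then vertex_elem (head E e) else 0" x]
          that class_arcs[of X e] class_arcs[of X e']
        by (auto simp: ev FA_intros split: if_splits)
    qed
    show "gact M (Vertex v) x = \<zero>\<^bsub>M\<^esub>"
      if v: "v \<in> verts E" "X \<in> S \<inter> C v" and x: "x \<in> carrier M"
        and gh: "\<And>e. e \<in> X \<Longrightarrow> gact M (Ghost e) x = \<zero>\<^bsub>M\<^esub>" for v X x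
    proof -
      have cl: "X \<in> all_classes E C" and fin: "finite X"
        using v finite_S by (auto simp: all_classes_def fin_classes_def)
      have "W.ev (\<Sum>e\<in>X. edge_elem e * ghost_elem e) x = \<zero>\<^bsub>M\<^esub>"
        using fin gh by (induction X rule: finite_induct)
          (auto simp: ev x W.ev_add W.act_zero)
      moreover have "vertex_elem v - (\<Sum>e\<in>X. edge_elem e * ghost_elem e) \<in> cl_relations E C S"
        using v unfolding cl_relations_def by blast
      ultimately show ?thesis
        using rel[of "vertex_elem v" "\<Sum>e\<in>X. edge_elem e * ghost_elem e" x] v x class_arcs[OF cl]
        by (auto simp: ev FA_intros)
    qed
  qed (rule finite_S)
  show ?thesis
  proof unfold_locales
    fix x assume x: "x \<in> carrier M"
    have "full_module R M" "carrier R \<noteq> {}"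
      using M R.zero_closed by (auto simp: mod_object_def)
    from this(1) x this(2) show "A.has_local_unit x"
    proof (induction x rule: M.full_module_induct)
      case (smult a y)
      then obtain f where "f \<in> FA" "a = \<rho> f"
        using rho_surj by blast
      with smult show ?case
        using A.has_local_unit_ev by (simp add: smult_eq_ev[OF M])
    qed (auto intro: A.has_local_unit_add)
  qed
qed

text \<open>
  The converse construction: a representation becomes a module by evaluating an arbitrary
  preimage of the given ring element in the free algebra.
\<close>

definition rep_module :: "('r, 'x) module \<Rightarrow> ('k \<Rightarrow> 'x \<Rightarrow> 'x) \<Rightarrow> (('v, 'e) gen \<Rightarrow> 'x \<Rightarrow> 'x)
    \<Rightarrow> ('r, 'x) module"
  where "rep_module F sc act =
    F\<lparr>smult := (\<lambda>a. word_eval F sc act (SOME f. f \<in> FA \<and> \<rho> f = a))\<rparr>"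

lemma rep_module_simps [simp]:
  "carrier (rep_module F sc act) = carrier F" "add (rep_module F sc act) = add F"
  "zero (rep_module F sc act) = zero F"
  by (simp_all add: rep_module_def)

lemma mod_objectI:
  assumes M: "left_module R M"
    and unit: "\<And>x. x \<in> carrier M \<Longrightarrow>
      \<exists>V. finite V \<and> V \<subseteq> verts E \<and> \<rho> (\<Sum>v\<in>V. vertex_elem v) \<odot>\<^bsub>M\<^esub> x = x"
  shows "mod_object R M"
proof -
  interpret M: left_module R M by (rule M)
  let ?H = "{a \<odot>\<^bsub>M\<^esub> x | a x. a \<in> carrier R \<and> x \<in> carrier M}"
  have unit': "\<exists>a\<in>carrier R. a \<odot>\<^bsub>M\<^esub> x = x" if x: "x \<in> carrier M" for x
  proof -
    obtain V where V: "finite V" "V \<subseteq> verts E" "\<rho> (\<Sum>v\<in>V. vertex_elem v) \<odot>\<^bsub>M\<^esub> x = x"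
      using unit[OF x] by blast
    have "\<rho> (\<Sum>v\<in>V. vertex_elem v) \<in> carrier R"
      using V(2) by (intro rho_closed FA_intros) auto
    with V(3) show ?thesis by blast
  qed
  have "?H \<subseteq> carrier M"
    using M.smult_closed by auto
  then have "generate (add_monoid M) ?H \<subseteq> carrier M"
    using M.add.generate_incl by simp
  moreover have "carrier M \<subseteq> ?H"
    using unit' by (smt (verit) mem_Collect_eq subsetI)
  ultimately have "full_module R M"
    unfolding full_module_def using generate.incl[of _ ?H "add_monoid M"] by blast
  moreover have "nondegenerate_module R M"
    unfolding nondegenerate_module_def using unit' by metis
  ultimately show ?thesis
    using M by (simp add: mod_object_def)
qed

lemma object_local_unit:
  assumes M: "mod_object R M" and x: "x \<in> carrier M"
  shows "\<exists>V. finite V \<and> V \<subseteq> verts E \<and> \<rho> (\<Sum>v\<in>V. vertex_elem v) \<odot>\<^bsub>M\<^esub> x = x"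
proof -
  interpret A: cl_rep M "scal M" "gact M" E C S using M by (rule cl_rep_object)
  obtain V where V: "finite V" "V \<subseteq> verts E" "A.ev (\<Sum>v\<in>V. vertex_elem v) x = x"
    using A.local_unit[OF x] by (auto simp: A.has_local_unit_def)
  moreover have "(\<Sum>v\<in>V. vertex_elem v) \<in> FA"
    using V(2) by (intro FA_intros) auto
  ultimately show ?thesis
    using smult_eq_ev[OF M x] by metis
qed

context
  fixes F :: "('r, 'x) module" and sc :: "'k \<Rightarrow> 'x \<Rightarrow> 'x" and act :: "('v, 'e) gen \<Rightarrow> 'x \<Rightarrow> 'x"
  assumes rep: "cl_rep F sc act E C S"
begin

interpretation F: cl_rep F sc act E C S by (rule rep)

lemma ev_kernel_ideal: "algebra_ideal G {f \<in> FA. \<forall>x\<in>carrier F. F.ev f x = \<zero>\<^bsub>F\<^esub>}"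
  by (rule algebra_idealI)
    (auto simp: FA_intros F.ev_add F.ev_mult F.ev_scalar F.ev_closed F.ev_zero F.ev_zero_right
      F.sc_zero_right)

text \<open>
  The polynomials that act as zero form an ideal that contains the relations. So the evaluation
  factors through \<open>R\<close>.
\<close>

lemma rho_eq_imp_ev_eq:
  assumes "f \<in> FA" "g \<in> FA" "\<rho> f = \<rho> g" "x \<in> carrier F"
  shows "F.ev f x = F.ev g x"
proof -
  have "cl_relations E C S \<subseteq> FA"
    by (rule cl_relations_carrier)
  then have "f - g \<in> {f \<in> FA. \<forall>x\<in>carrier F. F.ev f x = \<zero>\<^bsub>F\<^esub>}"
    using F.relations_act_trivially by (intro rho_kernel[OF assms(1-3) ev_kernel_ideal]) auto
  then have "F.ev f x \<ominus>\<^bsub>F\<^esub> F.ev g x = \<zero>\<^bsub>F\<^esub>"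
    using assms(4) by (simp add: F.ev_diff)
  then show ?thesis
    by (rule F.diff_eq_zeroD) (simp_all add: F.ev_closed assms(4))
qed

lemma rep_module_smult:
  assumes "f \<in> FA" "x \<in> carrier F"
  shows "\<rho> f \<odot>\<^bsub>rep_module F sc act\<^esub> x = F.ev f x"
proof -
  define g where "g = (SOME g. g \<in> FA \<and> \<rho> g = \<rho> f)"
  have "g \<in> FA \<and> \<rho> g = \<rho> f"
    unfolding g_def by (rule someI[of _ f]) (use assms in auto)
  then have "F.ev g x = F.ev f x"
    using assms by (intro rho_eq_imp_ev_eq) auto
  then show ?thesis
    by (simp add: rep_module_def g_def)
qed

lemma mod_object_rep_module: "mod_object R (rep_module F sc act)"
proof (rule mod_objectI)
  let ?M = "rep_module F sc act"
  have "abelian_group ?M"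
    by (rule abelian_group_cong[OF F.abelian_group_axioms]) simp_all
  then show "left_module R ?M"
  proof (rule left_module.intro)
    show "left_module_axioms R ?M"
    proof
      fix a x assume ax: "a \<in> carrier R" "x \<in> carrier ?M"
      then obtain f where f: "f \<in> FA" "a = \<rho> f" using rho_surj by blast
      show "a \<odot>\<^bsub>?M\<^esub> x \<in> carrier ?M"
        using ax f by (simp add: rep_module_smult F.ev_closed)
      show "a \<odot>\<^bsub>?M\<^esub> (x \<oplus>\<^bsub>?M\<^esub> y) = a \<odot>\<^bsub>?M\<^esub> x \<oplus>\<^bsub>?M\<^esub> a \<odot>\<^bsub>?M\<^esub> y" if "y \<in> carrier ?M" for y
        using ax f that by (simp add: rep_module_smult F.ev_add_right)
      fix b assume "b \<in> carrier R"
      then obtain g where g: "g \<in> FA" "b = \<rho> g" using rho_surj by blast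
      show "(a \<oplus>\<^bsub>R\<^esub> b) \<odot>\<^bsub>?M\<^esub> x = a \<odot>\<^bsub>?M\<^esub> x \<oplus>\<^bsub>?M\<^esub> b \<odot>\<^bsub>?M\<^esub> x"
        using ax f g rep_module_smult[of "f + g" x]
        by (simp add: rep_module_smult F.ev_add rho_add FA_intros)
      show "(a \<otimes>\<^bsub>R\<^esub> b) \<odot>\<^bsub>?M\<^esub> x = a \<odot>\<^bsub>?M\<^esub> (b \<odot>\<^bsub>?M\<^esub> x)"
        using ax f g rep_module_smult[of "f * g" x]
        by (simp add: rep_module_smult F.ev_mult F.ev_closed rho_mult FA_intros)
    qed
  qed
  fix x assume "x \<in> carrier ?M"
  then have x: "x \<in> carrier F" by simp
  obtain V where V: "finite V" "V \<subseteq> verts E" "F.ev (\<Sum>v\<in>V. vertex_elem v) x = x"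
    using F.local_unit[OF x] by (auto simp: F.has_local_unit_def)
  moreover have "(\<Sum>v\<in>V. vertex_elem v) \<in> FA"
    using V(2) by (intro FA_intros) auto
  ultimately show "\<exists>V. finite V \<and> V \<subseteq> verts E \<and> \<rho> (\<Sum>v\<in>V. vertex_elem v) \<odot>\<^bsub>?M\<^esub> x = x"
    using x by (intro exI[of _ V]) (auto simp: rep_module_smult)
qed

lemma gact_rep_module: "\<lbrakk>g \<in> G; x \<in> carrier F\<rbrakk> \<Longrightarrow> gact (rep_module F sc act) g x = act g x"
  by (simp add: gact_def rep_module_smult FA_intros F.ev_gen)

lemma scal_rep_module:
  assumes x: "x \<in> carrier F"
  shows "scal (rep_module F sc act) c x = sc c x"
proof (rule obj_eqI[OF mod_object_rep_module])
  fix f assume f: "f \<in> FA"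
  have "F.ev f (sc c x) = F.ev (Poly_Mapping.single 0 c * f) x"
    using x by (simp add: single_central F.ev_mult F.ev_scalar)
  then show "\<rho> f \<odot>\<^bsub>rep_module F sc act\<^esub> scal (rep_module F sc act) c x
      = \<rho> f \<odot>\<^bsub>rep_module F sc act\<^esub> sc c x"
    using x f by (simp add: scal_char[OF mod_object_rep_module] rep_module_smult F.sc_closed FA_intros)
qed (use x scal_char[OF mod_object_rep_module] in \<open>auto simp: F.sc_closed\<close>)

end

lemma morphism_scal:
  assumes M: "mod_object R M" and N: "mod_object R N" and f: "f \<in> mod_morphisms R M N"
    and x: "x \<in> carrier M"
  shows "f (scal M c x) = scal N c (f x)"
proof (rule obj_eqI[OF N])
  fix h assume h: "h \<in> FA"
  have "\<rho> h \<odot>\<^bsub>N\<^esub> f (scal M c x) = f (\<rho> h \<odot>\<^bsub>M\<^esub> scal M c x)"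
    using mod_morphismsD(3)[OF f rho_closed[OF h] scal_char(1)[OF M x]] by simp
  also have "\<dots> = \<rho> h \<odot>\<^bsub>N\<^esub> scal N c (f x)"
    using f h x scal_char[OF M] scal_char[OF N]
    by (simp add: mod_morphismsD[OF f] rho_closed FA_intros)
  finally show "\<rho> h \<odot>\<^bsub>N\<^esub> f (scal M c x) = \<rho> h \<odot>\<^bsub>N\<^esub> scal N c (f x)" .
qed (use x scal_char[OF M] scal_char[OF N] in \<open>auto simp: mod_morphismsD[OF f]\<close>)

lemma morphism_gact:
  assumes M: "mod_object R M" and N: "mod_object R N" and f: "f \<in> mod_morphisms R M N"
    and x: "x \<in> carrier M"
  shows "f (gact M g x) = gact N g (f x)"
proof -
  interpret M: left_module R M using M by (simp add: mod_object_def)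
  interpret N: left_module R N using N by (simp add: mod_object_def)
  have "f \<zero>\<^bsub>M\<^esub> = \<zero>\<^bsub>N\<^esub>"
    using mod_morphismsD(2)[OF f, of "\<zero>\<^bsub>M\<^esub>" "\<zero>\<^bsub>M\<^esub>"] mod_morphismsD(1)[OF f, of "\<zero>\<^bsub>M\<^esub>"]
    by (simp add: N.add.r_cancel_one')
  then show ?thesis
    using f x by (auto simp: gact_def mod_morphismsD[OF f] rho_closed FA_intros)
qed

lemma mod_morphismI:
  assumes M: "mod_object R M" and N: "mod_object R N"
    and closed: "\<And>x. x \<in> carrier M \<Longrightarrow> f x \<in> carrier N"
    and add: "\<And>x y. \<lbrakk>x \<in> carrier M; y \<in> carrier M\<rbrakk> \<Longrightarrow> f (x \<oplus>\<^bsub>M\<^esub> y) = f x \<oplus>\<^bsub>N\<^esub> f y"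
    and scal: "\<And>c x. x \<in> carrier M \<Longrightarrow> f (scal M c x) = scal N c (f x)"
    and gact: "\<And>g x. \<lbrakk>g \<in> G; x \<in> carrier M\<rbrakk> \<Longrightarrow> f (gact M g x) = gact N g (f x)"
  shows "f \<in> mod_morphisms R M N"
proof -
  have "f (a \<odot>\<^bsub>M\<^esub> x) = a \<odot>\<^bsub>N\<^esub> f x" if a: "a \<in> carrier R" and x: "x \<in> carrier M" for a x
  proof -
    obtain h where h: "h \<in> FA" "a = \<rho> h" using rho_surj[OF a] by blast
    have "f (word_eval M (scal M) (gact M) h x) = word_eval N (scal N) (gact N) h (f x)"
      by (rule word_eval_commute[where \<phi> = f, OF word_rep_object[OF M] word_rep_object[OF N]])
        (use closed add scal gact h(1) x in auto)
    with h show ?thesis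
      by (simp add: smult_eq_ev[OF M x] smult_eq_ev[OF N closed[OF x]])
  qed
  then show ?thesis
    using closed add by (auto simp: mod_morphisms_def)
qed

end

section \<open>Monomorphisms and epimorphisms\<close>

context cl_presentation
begin

lemma mod_object_left_module: "mod_object R M \<Longrightarrow> left_module R M"
  by (simp add: mod_object_def)

lemma morphism_zero:
  assumes M: "mod_object R M" and N: "mod_object R N" and f: "f \<in> mod_morphisms R M N"
  shows "f \<zero>\<^bsub>M\<^esub> = \<zero>\<^bsub>N\<^esub>"
proof -
  interpret M: left_module R M using M by (rule mod_object_left_module)
  interpret N: left_module R N using N by (rule mod_object_left_module)
  show ?thesis
    using mod_morphismsD(2)[OF f, of "\<zero>\<^bsub>M\<^esub>" "\<zero>\<^bsub>M\<^esub>"] mod_morphismsD(1)[OF f, of "\<zero>\<^bsub>M\<^esub>"]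
    by (simp add: N.add.r_cancel_one')
qed

lemma morphism_minus:
  assumes M: "mod_object R M" and N: "mod_object R N" and f: "f \<in> mod_morphisms R M N"
    and x: "x \<in> carrier M"
  shows "f (\<ominus>\<^bsub>M\<^esub> x) = \<ominus>\<^bsub>N\<^esub> f x"
proof -
  interpret M: left_module R M using M by (rule mod_object_left_module)
  interpret N: left_module R N using N by (rule mod_object_left_module)
  show ?thesis
    using mod_morphismsD(2)[OF f, of "\<ominus>\<^bsub>M\<^esub> x" x] x morphism_zero[OF M N f]
      N.minus_equality[of "f (\<ominus>\<^bsub>M\<^esub> x)" "f x"]
    by (simp add: M.l_neg mod_morphismsD(1)[OF f])
qed

lemma morphism_diff:
  assumes M: "mod_object R M" and N: "mod_object R N" and f: "f \<in> mod_morphisms R M N"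
    and x: "x \<in> carrier M" and y: "y \<in> carrier M"
  shows "f (x \<ominus>\<^bsub>M\<^esub> y) = f x \<ominus>\<^bsub>N\<^esub> f y"
proof -
  interpret M: left_module R M using M by (rule mod_object_left_module)
  show ?thesis
    using x y morphism_minus[OF M N f y] by (simp add: a_minus_def mod_morphismsD(2)[OF f])
qed

text \<open>
  The kernel of a morphism inherits the local units, so it is an object, and its inclusion and the
  zero map have the same composite with the monomorphism.
\<close>

lemma mono_injective:
  assumes Q: "mod_object R Q" and P: "mod_object R P" and mono: "mod_mono R Q P i"
  shows "inj_on i (carrier Q)"
proof -
  interpret Q: left_module R Q using Q by (rule mod_object_left_module)
  interpret P: left_module R P using P by (rule mod_object_left_module)
  have i: "i \<in> mod_morphisms R Q P"
    using mono by (simp add: mod_mono_def)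
  note i_simps = mod_morphismsD[OF i] morphism_zero[OF Q P i] morphism_minus[OF Q P i]
  define L where "L = Q\<lparr>carrier := {x \<in> carrier Q. i x = \<zero>\<^bsub>P\<^esub>}\<rparr>"
  have L_simps: "carrier L = {x \<in> carrier Q. i x = \<zero>\<^bsub>P\<^esub>}" "add L = add Q" "zero L = zero Q"
    "smult L = smult Q"
    by (simp_all add: L_def)
  have "abelian_group L"
  proof (rule abelian_groupI, unfold L_simps)
    fix x assume "x \<in> {x \<in> carrier Q. i x = \<zero>\<^bsub>P\<^esub>}"
    then show "\<exists>y\<in>{x \<in> carrier Q. i x = \<zero>\<^bsub>P\<^esub>}. y \<oplus>\<^bsub>Q\<^esub> x = \<zero>\<^bsub>Q\<^esub>"
      by (intro bexI[of _ "\<ominus>\<^bsub>Q\<^esub> x"]) (auto simp: i_simps Q.l_neg)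
  qed (auto simp: i_simps Q.a_ac)
  then have "left_module R L"
    by (intro left_module.intro, assumption, unfold_locales)
      (auto simp: L_simps i_simps Q.smult_closed Q.smult_l_distr Q.smult_r_distr Q.smult_assoc
        P.smult_zero)
  then have L: "mod_object R L"
    using object_local_unit[OF Q] by (intro mod_objectI) (auto simp: L_simps)
  have incl: "(\<lambda>x. x) \<in> mod_morphisms R L Q" and zero: "(\<lambda>x. \<zero>\<^bsub>Q\<^esub>) \<in> mod_morphisms R L Q"
    by (auto simp: mod_morphisms_def L_simps Q.smult_zero)
  have "\<forall>g\<in>mod_morphisms R L Q. \<forall>h\<in>mod_morphisms R L Q.
      (\<forall>x\<in>carrier L. i (g x) = i (h x)) \<longrightarrow> (\<forall>x\<in>carrier L. g x = h x)"
    using mono L by (simp add: mod_mono_def)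
  from bspec[OF bspec[OF this incl] zero] have "\<forall>x\<in>carrier L. x = \<zero>\<^bsub>Q\<^esub>"
    by (auto simp: L_simps i_simps)
  then have ker: "x = \<zero>\<^bsub>Q\<^esub>" if "x \<in> carrier Q" "i x = \<zero>\<^bsub>P\<^esub>" for x
    using that by (auto simp: L_simps)
  show ?thesis
  proof (rule inj_onI)
    fix x y assume xy: "x \<in> carrier Q" "y \<in> carrier Q" "i x = i y"
    then have "x \<ominus>\<^bsub>Q\<^esub> y = \<zero>\<^bsub>Q\<^esub>"
      by (intro ker) (auto simp: morphism_diff[OF Q P i] a_minus_def P.r_neg i_simps)
    then show "x = y"
      using xy(1,2) by (rule Q.diff_eq_zeroD)
  qed
qed

lemma epi_if_surjective:
  assumes p: "p \<in> mod_morphisms R M N" and surj: "p ` carrier M = carrier N"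
  shows "mod_epi R M N p"
  using assms unfolding mod_epi_def by (metis imageE)

lemma ungraded_pair:
  assumes "mod_object R P" "mod_object R M"
  shows "two_graded_spaces P (scal P) {()} (\<lambda>_ x. x) M (scal M) (\<lambda>_ x. x)"
proof -
  interpret P: word_rep P "scal P" "gact P" using assms(1) by (rule word_rep_object)
  interpret M: word_rep M "scal M" "gact M" using assms(2) by (rule word_rep_object)
  show ?thesis
    using P.trivially_graded M.trivially_graded by (rule two_graded_spaces.intro)
qed

text \<open>
  The cokernel of \<open>p\<close> must be an object of the same universe. Therefore it is realised on the kernel
  of a linear retraction \<open>\<pi>\<close> onto the image of \<open>p\<close>, with the action transported along \<open>r = 1 - \<pi>\<close>.
  Then \<open>r\<close> and the zero map have the same composite with the epimorphism, so \<open>r = 0\<close>.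
\<close>

lemma epi_surjective:
  assumes M: "mod_object R M" and N: "mod_object R N" and epi: "mod_epi R M N p"
  shows "p ` carrier M = carrier N"
proof -
  interpret M: left_module R M using M by (rule mod_object_left_module)
  interpret N: left_module R N using N by (rule mod_object_left_module)
  interpret WN: cl_rep N "scal N" "gact N" E C S using N by (rule cl_rep_object)
  have p: "p \<in> mod_morphisms R M N"
    using epi by (simp add: mod_epi_def)
  note p_simps = mod_morphismsD[OF p]
  interpret NN: two_graded_spaces N "scal N" "{()}" "\<lambda>_ x. x" N "scal N" "\<lambda>_ x. x"
    using N N by (rule ungraded_pair)
  let ?I = "p ` carrier M"
  have I: "?I \<subseteq> carrier N" "\<zero>\<^bsub>N\<^esub> \<in> ?I" "\<And>x y. \<lbrakk>x \<in> ?I; y \<in> ?I\<rbrakk> \<Longrightarrow> x \<oplus>\<^bsub>N\<^esub> y \<in> ?I"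
    "\<And>c x. x \<in> ?I \<Longrightarrow> scal N c x \<in> ?I" "\<And>a x. \<lbrakk>a \<in> carrier R; x \<in> ?I\<rbrakk> \<Longrightarrow> a \<odot>\<^bsub>N\<^esub> x \<in> ?I"
  proof -
    show "?I \<subseteq> carrier N" using p_simps by auto
    show "\<zero>\<^bsub>N\<^esub> \<in> ?I" using morphism_zero[OF M N p] M.zero_closed by (metis imageI)
    show "x \<oplus>\<^bsub>N\<^esub> y \<in> ?I" if "x \<in> ?I" "y \<in> ?I" for x y
      using that by (auto simp flip: p_simps(2))
    show "scal N c x \<in> ?I" if "x \<in> ?I" for c x
      using that scal_char(1)[OF M] by (auto simp flip: morphism_scal[OF M N p])
    show "a \<odot>\<^bsub>N\<^esub> x \<in> ?I" if "a \<in> carrier R" "x \<in> ?I" for a x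
      using that M.smult_closed by (auto simp flip: p_simps(3))
  qed
  let ?D = "{(x, x) | x. x \<in> ?I}"
  have T: "NN.linear_relation (carrier N \<times> ?I)" and D: "NN.linear_relation ?D"
    using I WN.sc_closed unfolding NN.linear_relation_def by auto
  have D_zero: "NN.single_valued_at_zero ?D" and D_sub: "?D \<subseteq> carrier N \<times> ?I"
    and total: "carrier N \<subseteq> Domain (carrier N \<times> ?I)"
    using I by (auto simp: NN.single_valued_at_zero_def)
  obtain \<pi> where "\<forall>x\<in>carrier N. (x, \<pi> x) \<in> carrier N \<times> ?I"
    "\<forall>x\<in>carrier N. \<forall>y\<in>carrier N. \<pi> (x \<oplus>\<^bsub>N\<^esub> y) = \<pi> x \<oplus>\<^bsub>N\<^esub> \<pi> y"
    "\<forall>x y. (x, y) \<in> ?D \<longrightarrow> \<pi> x = y"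
    using NN.linear_selection[OF T total D D_sub D_zero] by (elim exE conjE) (rule that)
  then have pi: "\<And>x. x \<in> carrier N \<Longrightarrow> \<pi> x \<in> ?I"
    "\<And>x y. \<lbrakk>x \<in> carrier N; y \<in> carrier N\<rbrakk> \<Longrightarrow> \<pi> (x \<oplus>\<^bsub>N\<^esub> y) = \<pi> x \<oplus>\<^bsub>N\<^esub> \<pi> y"
    "\<And>x. x \<in> ?I \<Longrightarrow> \<pi> x = x"
    by blast+
  have pi_carrier: "\<pi> x \<in> carrier N" if "x \<in> carrier N" for x
    using pi(1) that I by blast
  have pi_zero: "\<pi> \<zero>\<^bsub>N\<^esub> = \<zero>\<^bsub>N\<^esub>"
    using pi(3) I(2) by blast
  have pi_minus: "\<pi> (\<ominus>\<^bsub>N\<^esub> x) = \<ominus>\<^bsub>N\<^esub> \<pi> x" if "x \<in> carrier N" for x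
    using pi(2)[of "\<ominus>\<^bsub>N\<^esub> x" x] that N.minus_equality[of "\<pi> (\<ominus>\<^bsub>N\<^esub> x)" "\<pi> x"]
    by (simp add: N.l_neg pi_zero pi_carrier)
  define r where "r x = x \<ominus>\<^bsub>N\<^esub> \<pi> x" for x
  have r_closed: "r x \<in> carrier N" if "x \<in> carrier N" for x
    using that by (simp add: r_def pi_carrier)
  have r_add: "r (x \<oplus>\<^bsub>N\<^esub> y) = r x \<oplus>\<^bsub>N\<^esub> r y" if "x \<in> carrier N" "y \<in> carrier N" for x y
    using that pi_carrier by (simp add: r_def a_minus_def pi(2) N.minus_add N.a_ac)
  have pi_r: "\<pi> (r x) = \<zero>\<^bsub>N\<^esub>" if "x \<in> carrier N" for x
    using that pi_carrier pi(1)[OF that] by (simp add: r_def a_minus_def pi(2,3) pi_minus N.r_neg)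
  have r_ker: "r x = x" if "x \<in> carrier N" "\<pi> x = \<zero>\<^bsub>N\<^esub>" for x
    using that by (simp add: r_def a_minus_def)
  have r_I: "r x = \<zero>\<^bsub>N\<^esub>" if "x \<in> ?I" for x
    using that I(1) pi(3)[OF that] by (auto simp: r_def a_minus_def N.r_neg)
  have r_smult: "r (a \<odot>\<^bsub>N\<^esub> r x) = r (a \<odot>\<^bsub>N\<^esub> x)" if "a \<in> carrier R" "x \<in> carrier N" for a x
  proof -
    have "x = r x \<oplus>\<^bsub>N\<^esub> \<pi> x"
      using that pi_carrier by (simp add: r_def a_minus_def N.a_assoc N.l_neg)
    then have "r (a \<odot>\<^bsub>N\<^esub> x) = r (a \<odot>\<^bsub>N\<^esub> r x \<oplus>\<^bsub>N\<^esub> a \<odot>\<^bsub>N\<^esub> \<pi> x)"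
      using that pi_carrier r_closed by (metis N.smult_r_distr)
    also have "\<dots> = r (a \<odot>\<^bsub>N\<^esub> r x) \<oplus>\<^bsub>N\<^esub> \<zero>\<^bsub>N\<^esub>"
      using that pi_carrier r_closed pi(1) I(5) by (simp add: r_add N.smult_closed r_I)
    finally show ?thesis
      using that by (simp add: N.smult_closed r_closed)
  qed
  define V where "V = N\<lparr>carrier := {x \<in> carrier N. \<pi> x = \<zero>\<^bsub>N\<^esub>}, smult := (\<lambda>a x. r (a \<odot>\<^bsub>N\<^esub> x))\<rparr>"
  have V_simps: "carrier V = {x \<in> carrier N. \<pi> x = \<zero>\<^bsub>N\<^esub>}" "add V = add N" "zero V = zero N"
    "smult V = (\<lambda>a x. r (a \<odot>\<^bsub>N\<^esub> x))"
    by (simp_all add: V_def)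
  have "abelian_group V"
  proof (rule abelian_groupI, unfold V_simps)
    fix x assume "x \<in> {x \<in> carrier N. \<pi> x = \<zero>\<^bsub>N\<^esub>}"
    then show "\<exists>y\<in>{x \<in> carrier N. \<pi> x = \<zero>\<^bsub>N\<^esub>}. y \<oplus>\<^bsub>N\<^esub> x = \<zero>\<^bsub>N\<^esub>"
      by (intro bexI[of _ "\<ominus>\<^bsub>N\<^esub> x"]) (auto simp: pi_minus N.l_neg)
  qed (auto simp: pi(2) pi_zero N.a_ac)
  then have "left_module R V"
    by (intro left_module.intro, assumption, unfold_locales)
      (auto simp: V_simps pi_r r_closed N.smult_closed N.smult_l_distr N.smult_r_distr N.smult_assoc
        r_add r_smult)
  then have V: "mod_object R V"
  proof (rule mod_objectI)
    fix x assume "x \<in> carrier V"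
    then have x: "x \<in> carrier N" "\<pi> x = \<zero>\<^bsub>N\<^esub>" by (auto simp: V_simps)
    obtain W where "finite W" "W \<subseteq> verts E" "\<rho> (\<Sum>v\<in>W. vertex_elem v) \<odot>\<^bsub>N\<^esub> x = x"
      using object_local_unit[OF N x(1)] by blast
    then show "\<exists>W. finite W \<and> W \<subseteq> verts E \<and> \<rho> (\<Sum>v\<in>W. vertex_elem v) \<odot>\<^bsub>V\<^esub> x = x"
      using x by (intro exI[of _ W]) (simp add: V_simps r_ker)
  qed
  have "r \<in> mod_morphisms R N V" "(\<lambda>x. \<zero>\<^bsub>V\<^esub>) \<in> mod_morphisms R N V"
    using r_closed pi_r r_add r_smult pi_zero N.smult_zero r_ker
    by (auto simp: mod_morphisms_def V_simps)
  moreover have "\<forall>x\<in>carrier M. r (p x) = \<zero>\<^bsub>V\<^esub>"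
    using r_I by (simp add: V_simps)
  ultimately have rz: "r y = \<zero>\<^bsub>N\<^esub>" if "y \<in> carrier N" for y
    using epi V that unfolding mod_epi_def by (metis V_simps(3))
  have "y \<in> ?I" if y: "y \<in> carrier N" for y
  proof -
    have "y = \<pi> y"
      using rz[OF y] y pi_carrier[OF y] unfolding r_def by (rule N.diff_eq_zeroD)
    then show ?thesis using pi(1)[OF y] by simp
  qed
  with I(1) show ?thesis by blast
qed

end

section \<open>Lifting derivations\<close>

text \<open>
  The data of a lifting problem for the module \<open>Q\<close>, considered as a subobject of \<open>P\<close> by means of
  \<open>i\<close>. The locales that extend this one fix, step by step, the choices from which a solution is
  constructed.
\<close>

locale lifting_problem = cl_presentation E C R S \<rho>
  for E :: "('v, 'e) pre_digraph" and C and R :: "('r, 'z) ring_scheme" and S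
    and \<rho> :: "(('v, 'e) gen free_word \<Rightarrow>\<^sub>0 'k::field) \<Rightarrow> 'r" +
  fixes P Q M N :: "('r, 'm) module" and i p g :: "'m \<Rightarrow> 'm"
  assumes P: "mod_object R P" and Q: "mod_object R Q" and M: "mod_object R M" and N: "mod_object R N"
    and i: "i \<in> mod_morphisms R Q P" and inj: "inj_on i (carrier Q)"
    and p: "p \<in> mod_morphisms R M N" and surj: "p ` carrier M = carrier N"
    and g: "g \<in> mod_morphisms R Q N"
begin

sublocale P: cl_rep P "scal P" "gact P" E C S by (rule cl_rep_object[OF P])
sublocale Q: cl_rep Q "scal Q" "gact Q" E C S by (rule cl_rep_object[OF Q])
sublocale M: cl_rep M "scal M" "gact M" E C S by (rule cl_rep_object[OF M])
sublocale N: cl_rep N "scal N" "gact N" E C S by (rule cl_rep_object[OF N])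
sublocale PM: two_graded_spaces P "scal P" "{()}" "\<lambda>_ x. x" M "scal M" "\<lambda>_ x. x"
  by (rule ungraded_pair[OF P M])

lemmas i_simps = mod_morphismsD(1,2)[OF i] morphism_zero[OF Q P i] morphism_minus[OF Q P i]
  morphism_scal[OF Q P i] morphism_gact[OF Q P i]
lemmas p_simps = mod_morphismsD(1,2)[OF p] morphism_zero[OF M N p] morphism_minus[OF M N p]
  morphism_scal[OF M N p] morphism_gact[OF M N p]
lemmas g_simps = mod_morphismsD(1,2)[OF g] morphism_zero[OF Q N g] morphism_minus[OF Q N g]
  morphism_scal[OF Q N g] morphism_gact[OF Q N g]

lemma exists_graded_retraction:
  obtains \<pi> where "\<And>x. x \<in> carrier P \<Longrightarrow> \<pi> x \<in> carrier Q"
    and "\<And>x y. \<lbrakk>x \<in> carrier P; y \<in> carrier P\<rbrakk> \<Longrightarrow> \<pi> (x \<oplus>\<^bsub>P\<^esub> y) = \<pi> x \<oplus>\<^bsub>Q\<^esub> \<pi> y"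
    and "\<And>c x. x \<in> carrier P \<Longrightarrow> \<pi> (scal P c x) = scal Q c (\<pi> x)"
    and "\<And>v x. \<lbrakk>v \<in> verts E; x \<in> carrier P\<rbrakk> \<Longrightarrow> \<pi> (gact P (Vertex v) x) = gact Q (Vertex v) (\<pi> x)"
    and "\<And>q. q \<in> carrier Q \<Longrightarrow> \<pi> (i q) = q"
proof -
  interpret PQ: two_graded_spaces P "scal P" "verts E" "\<lambda>v. gact P (Vertex v)"
    Q "scal Q" "\<lambda>v. gact Q (Vertex v)"
    using P.vertex_graded Q.vertex_graded by (rule two_graded_spaces.intro)
  let ?G = "{(i q, q) | q. q \<in> carrier Q}"
  have T: "PQ.linear_relation (carrier P \<times> carrier Q)"
    unfolding PQ.linear_relation_def
    by (auto simp: P.sc_closed Q.sc_closed P.act_closed Q.act_closed)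
  have G: "PQ.linear_relation ?G"
    unfolding PQ.linear_relation_def
    by (auto simp: i_simps Q.sc_closed Q.act_closed Q.zero_closed simp flip: i_simps(2,3,5,6))
  have G_zero: "PQ.single_valued_at_zero ?G"
    unfolding PQ.single_valued_at_zero_def
    using inj by (auto simp: inj_on_def simp flip: i_simps(3))
  have G_sub: "?G \<subseteq> carrier P \<times> carrier Q"
    by (auto simp: i_simps)
  have total: "carrier P \<subseteq> Domain (carrier P \<times> carrier Q)"
    using Q.zero_closed by blast
  obtain \<pi> where pi: "\<forall>x\<in>carrier P. (x, \<pi> x) \<in> carrier P \<times> carrier Q"
    "\<forall>x\<in>carrier P. \<forall>y\<in>carrier P. \<pi> (x \<oplus>\<^bsub>P\<^esub> y) = \<pi> x \<oplus>\<^bsub>Q\<^esub> \<pi> y"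
    "\<forall>c. \<forall>x\<in>carrier P. \<pi> (scal P c x) = scal Q c (\<pi> x)"
    "\<forall>v\<in>verts E. \<forall>x\<in>carrier P. \<pi> (gact P (Vertex v) x) = gact Q (Vertex v) (\<pi> x)"
    "\<forall>x q. (x, q) \<in> ?G \<longrightarrow> \<pi> x = q"
    using PQ.linear_selection[OF T total G G_sub G_zero] by (elim exE conjE) (rule that)
  show ?thesis
    by (rule that[of \<pi>]) (use pi in auto)
qed

end

locale lifting_with_retraction = lifting_problem E C R S \<rho> P Q M N i p g
  for E :: "('v, 'e) pre_digraph" and C and R :: "('r, 'z) ring_scheme" and S
    and \<rho> :: "(('v, 'e) gen free_word \<Rightarrow>\<^sub>0 'k::field) \<Rightarrow> 'r"
    and P Q M N :: "('r, 'm) module" and i p g +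
  fixes \<pi>
  assumes pi_closed: "x \<in> carrier P \<Longrightarrow> \<pi> x \<in> carrier Q"
    and pi_add: "\<lbrakk>x \<in> carrier P; y \<in> carrier P\<rbrakk> \<Longrightarrow> \<pi> (x \<oplus>\<^bsub>P\<^esub> y) = \<pi> x \<oplus>\<^bsub>Q\<^esub> \<pi> y"
    and pi_scal: "x \<in> carrier P \<Longrightarrow> \<pi> (scal P c x) = scal Q c (\<pi> x)"
    and pi_vertex: "\<lbrakk>v \<in> verts E; x \<in> carrier P\<rbrakk>
      \<Longrightarrow> \<pi> (gact P (Vertex v) x) = gact Q (Vertex v) (\<pi> x)"
    and pi_i: "q \<in> carrier Q \<Longrightarrow> \<pi> (i q) = q"
begin

lemma pi_zero: "\<pi> \<zero>\<^bsub>P\<^esub> = \<zero>\<^bsub>Q\<^esub>"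
  using pi_i[OF Q.zero_closed] by (simp add: i_simps)

text \<open>
  The derivation \<open>g \<circ> (\<pi>\<gamma> - \<gamma>\<pi>)\<close>, that is, \<open>g\<close> applied to the commutator of \<open>\<pi>\<close> with \<open>\<gamma>\<close>. It
  vanishes on \<open>iQ\<close> because \<open>\<pi>i\<close> is the identity, and it is zero for the vertices because \<open>\<pi>\<close> commutes
  with them.
\<close>

definition defect :: "('v, 'e) gen \<Rightarrow> 'm \<Rightarrow> 'm"
  where "defect \<gamma> x = g (\<pi> (gact P \<gamma> x) \<ominus>\<^bsub>Q\<^esub> gact Q \<gamma> (\<pi> x))"

lemma defect_eq:
  "x \<in> carrier P \<Longrightarrow> defect \<gamma> x = g (\<pi> (gact P \<gamma> x)) \<ominus>\<^bsub>N\<^esub> gact N \<gamma> (g (\<pi> x))"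
  by (simp add: defect_def a_minus_def g_simps pi_closed P.act_closed Q.act_closed)

lemma g_pi_closed: "x \<in> carrier P \<Longrightarrow> g (\<pi> x) \<in> carrier N"
  by (simp add: g_simps pi_closed)

lemma defect_closed: "x \<in> carrier P \<Longrightarrow> defect \<gamma> x \<in> carrier N"
  by (simp add: defect_eq g_pi_closed P.act_closed N.act_closed)

lemma defect_add:
  "\<lbrakk>x \<in> carrier P; y \<in> carrier P\<rbrakk> \<Longrightarrow> defect \<gamma> (x \<oplus>\<^bsub>P\<^esub> y) = defect \<gamma> x \<oplus>\<^bsub>N\<^esub> defect \<gamma> y"
  by (simp add: defect_eq a_minus_def P.act_add pi_add g_simps pi_closed P.act_closed N.act_add
      N.act_closed N.minus_add N.a_ac)

lemma defect_scal: "x \<in> carrier P \<Longrightarrow> defect \<gamma> (scal P c x) = scal N c (defect \<gamma> x)"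
proof -
  assume x: "x \<in> carrier P"
  have "scal N c (\<ominus>\<^bsub>N\<^esub> y) = \<ominus>\<^bsub>N\<^esub> scal N c y" if "y \<in> carrier N" for y
    using that by (metis N.sc_closed N.sc_mult N.sc_neg_one mult.commute)
  with x show ?thesis
    by (simp add: defect_eq a_minus_def P.act_sc pi_scal g_simps pi_closed P.act_closed N.act_sc
        N.act_closed N.sc_add_right P.sc_closed)
qed

lemma defect_zero: "defect \<gamma> \<zero>\<^bsub>P\<^esub> = \<zero>\<^bsub>N\<^esub>"
  by (simp add: defect_eq P.act_zero N.act_zero pi_zero g_simps a_minus_def)

lemma defect_i: "q \<in> carrier Q \<Longrightarrow> defect \<gamma> (i q) = \<zero>\<^bsub>N\<^esub>"
  by (simp add: defect_def pi_i Q.act_closed a_minus_def Q.r_neg g_simps flip: i_simps(6))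

lemma defect_vertex: "\<lbrakk>v \<in> verts E; x \<in> carrier P\<rbrakk> \<Longrightarrow> defect (Vertex v) x = \<zero>\<^bsub>N\<^esub>"
  by (simp add: defect_def pi_vertex Q.act_closed pi_closed a_minus_def Q.r_neg g_simps)

text \<open>
  The Leibniz rule: the left-hand side is the value of the derivation on the product \<open>\<gamma>\<eta>\<close>.
\<close>

lemma defect_comp:
  assumes x: "x \<in> carrier P"
  shows "gact N \<gamma> (defect \<eta> x) \<oplus>\<^bsub>N\<^esub> defect \<gamma> (gact P \<eta> x)
    = g (\<pi> (gact P \<gamma> (gact P \<eta> x))) \<ominus>\<^bsub>N\<^esub> gact N \<gamma> (gact N \<eta> (g (\<pi> x)))"
proof -
  let ?a = "gact N \<gamma> (g (\<pi> (gact P \<eta> x)))" and ?b = "gact N \<gamma> (gact N \<eta> (g (\<pi> x)))"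
    and ?c = "g (\<pi> (gact P \<gamma> (gact P \<eta> x)))"
  have abc: "?a \<in> carrier N" "?b \<in> carrier N" "?c \<in> carrier N"
    using x by (simp_all add: P.act_closed N.act_closed g_pi_closed)
  have "gact N \<gamma> (defect \<eta> x) \<oplus>\<^bsub>N\<^esub> defect \<gamma> (gact P \<eta> x)
    = (?a \<oplus>\<^bsub>N\<^esub> \<ominus>\<^bsub>N\<^esub> ?b) \<oplus>\<^bsub>N\<^esub> (?c \<oplus>\<^bsub>N\<^esub> \<ominus>\<^bsub>N\<^esub> ?a)"
    using x by (simp add: defect_eq P.act_closed a_minus_def N.act_add N.act_minus N.act_closed
        g_pi_closed)
  also have "\<dots> = (?c \<oplus>\<^bsub>N\<^esub> \<ominus>\<^bsub>N\<^esub> ?b) \<oplus>\<^bsub>N\<^esub> (?a \<oplus>\<^bsub>N\<^esub> \<ominus>\<^bsub>N\<^esub> ?a)"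
    using abc by (simp only: N.a_ac N.a_closed N.a_inv_closed)
  finally show ?thesis
    using abc by (simp add: a_minus_def N.r_neg)
qed

definition lifts :: "('v, 'e) gen \<Rightarrow> ('m \<Rightarrow> 'm) \<Rightarrow> bool"
  where "lifts \<gamma> D \<longleftrightarrow> (\<forall>x\<in>carrier P. D x \<in> carrier M \<and> p (D x) = defect \<gamma> x) \<and>
    (\<forall>x\<in>carrier P. \<forall>y\<in>carrier P. D (x \<oplus>\<^bsub>P\<^esub> y) = D x \<oplus>\<^bsub>M\<^esub> D y) \<and>
    (\<forall>c. \<forall>x\<in>carrier P. D (scal P c x) = scal M c (D x)) \<and>
    (\<forall>q\<in>carrier Q. D (i q) = \<zero>\<^bsub>M\<^esub>)"

lemma liftsD:
  assumes "lifts \<gamma> D"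
  shows "x \<in> carrier P \<Longrightarrow> D x \<in> carrier M"
    and "x \<in> carrier P \<Longrightarrow> p (D x) = defect \<gamma> x"
    and "\<lbrakk>x \<in> carrier P; y \<in> carrier P\<rbrakk> \<Longrightarrow> D (x \<oplus>\<^bsub>P\<^esub> y) = D x \<oplus>\<^bsub>M\<^esub> D y"
    and "x \<in> carrier P \<Longrightarrow> D (scal P c x) = scal M c (D x)"
    and "q \<in> carrier Q \<Longrightarrow> D (i q) = \<zero>\<^bsub>M\<^esub>"
  using assms by (auto simp: lifts_def)

lemma lifts_zero: "lifts \<gamma> D \<Longrightarrow> D \<zero>\<^bsub>P\<^esub> = \<zero>\<^bsub>M\<^esub>"
  using liftsD(5)[of \<gamma> D "\<zero>\<^bsub>Q\<^esub>"] by (simp add: i_simps)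

lemma exists_lift_extending:
  assumes G0: "PM.linear_relation G0" "PM.single_valued_at_zero G0"
    and defect: "\<And>x m. (x, m) \<in> G0 \<Longrightarrow> p m = defect \<gamma> x"
    and i0: "\<And>q. q \<in> carrier Q \<Longrightarrow> (i q, \<zero>\<^bsub>M\<^esub>) \<in> G0"
  obtains D where "lifts \<gamma> D" "\<And>x m. (x, m) \<in> G0 \<Longrightarrow> D x = m"
proof -
  let ?T = "{(x, m). x \<in> carrier P \<and> m \<in> carrier M \<and> p m = defect \<gamma> x}"
  have T: "PM.linear_relation ?T"
    unfolding PM.linear_relation_def
    by (auto simp: p_simps defect_zero defect_add defect_scal P.sc_closed M.sc_closed)
  have total: "carrier P \<subseteq> Domain ?T"
  proof
    fix x assume x: "x \<in> carrier P"
    then have "defect \<gamma> x \<in> p ` carrier M"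
      using defect_closed surj by simp
    then obtain m where "m \<in> carrier M" "defect \<gamma> x = p m" by blast
    with x show "x \<in> Domain ?T" by auto
  qed
  have G0_sub: "G0 \<subseteq> ?T"
    using G0(1) defect by (auto simp: PM.linear_relation_def)
  obtain D where D: "\<forall>x\<in>carrier P. (x, D x) \<in> ?T"
    "\<forall>x\<in>carrier P. \<forall>y\<in>carrier P. D (x \<oplus>\<^bsub>P\<^esub> y) = D x \<oplus>\<^bsub>M\<^esub> D y"
    "\<forall>c. \<forall>x\<in>carrier P. D (scal P c x) = scal M c (D x)"
    "\<forall>x m. (x, m) \<in> G0 \<longrightarrow> D x = m"
    using PM.linear_selection[OF T total G0(1) G0_sub G0(2)] by (elim exE conjE) (rule that)
  have "lifts \<gamma> D"
    using D i0 by (auto simp: lifts_def)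
  then show ?thesis
    using that D(4) by blast
qed

definition homogeneous_lift :: "('v, 'e) gen \<Rightarrow> ('m \<Rightarrow> 'm) \<Rightarrow> bool"
  where "homogeneous_lift \<gamma> D \<longleftrightarrow> lifts \<gamma> D \<and>
    (\<forall>x\<in>carrier P. D (gact P (Vertex (right_vertex \<gamma>)) x) = D x) \<and>
    (\<forall>x\<in>carrier P. gact M (Vertex (left_vertex \<gamma>)) (D x) = D x)"

text \<open>
  A lift is made compatible with the vertices at the ends of \<open>\<gamma>\<close> by multiplying it with them on
  both sides. It remains a lift because the defect is compatible with these vertices already.
\<close>

lemma lifts_homogenise:
  assumes D: "lifts \<gamma> D" and \<gamma>: "\<gamma> \<in> G"
  defines "D' \<equiv> \<lambda>x. gact M (Vertex (left_vertex \<gamma>)) (D (gact P (Vertex (right_vertex \<gamma>)) x))"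
  shows "homogeneous_lift \<gamma> D'"
proof -
  let ?l = "left_vertex \<gamma>" and ?r = "right_vertex \<gamma>"
  have v: "?l \<in> verts E" "?r \<in> verts E"
    using \<gamma> by (cases \<gamma>; auto)+
  have "gact N (Vertex ?l) (defect \<gamma> (gact P (Vertex ?r) x)) = defect \<gamma> x" if "x \<in> carrier P" for x
  proof -
    have "defect \<gamma> (gact P (Vertex ?r) x) = defect \<gamma> x"
      using that v \<gamma>
      by (simp add: defect_eq P.act_closed P.act_right_vertex pi_vertex g_simps pi_closed
          N.act_right_vertex)
    moreover have "gact N (Vertex ?l) (g (\<pi> (gact P \<gamma> x))) = g (\<pi> (gact P \<gamma> x))"
    proof -
      have "gact Q (Vertex ?l) (\<pi> (gact P \<gamma> x)) = \<pi> (gact P \<gamma> x)"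
        using that \<gamma> pi_vertex[OF v(1), of "gact P \<gamma> x"] by (simp add: P.act_closed P.left_vertex_act)
      with that show ?thesis
        by (simp add: P.act_closed pi_closed flip: g_simps(6))
    qed
    then have "gact N (Vertex ?l) (defect \<gamma> x) = defect \<gamma> x"
      using that \<gamma>
      by (simp add: defect_eq a_minus_def P.act_closed N.act_closed N.act_add N.act_minus
          g_pi_closed N.left_vertex_act)
    ultimately show ?thesis by simp
  qed
  then have "lifts \<gamma> D'"
    using v
    by (auto simp: lifts_def D'_def liftsD[OF D] P.act_closed M.act_closed p_simps P.act_add M.act_add
        P.act_sc M.act_sc M.act_zero Q.act_closed simp flip: i_simps(6))
  moreover have "D' (gact P (Vertex ?r) x) = D' x" "gact M (Vertex ?l) (D' x) = D' x"
    if "x \<in> carrier P" for x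
    using that v by (simp_all add: D'_def P.vertices M.vertices liftsD[OF D] P.act_closed)
  ultimately show ?thesis
    by (simp add: homogeneous_lift_def)
qed

lemma exists_edge_lift:
  assumes "e \<in> arcs E"
  shows "\<exists>D. homogeneous_lift (Edge e) D"
proof -
  let ?G = "{(i q, \<zero>\<^bsub>M\<^esub>) | q. q \<in> carrier Q}"
  have "PM.linear_relation ?G"
    unfolding PM.linear_relation_def
    by (auto simp: i_simps M.sc_zero_right Q.sc_closed Q.zero_closed simp flip: i_simps(2,3,5))
  moreover have "PM.single_valued_at_zero ?G"
    by (auto simp: PM.single_valued_at_zero_def)
  ultimately obtain D where "lifts (Edge e) D"
    by (rule exists_lift_extending[of ?G "Edge e"]) (auto simp: p_simps defect_i)
  then show ?thesis
    using lifts_homogenise[of "Edge e" D] assms by auto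
qed

end

locale lifting_with_edges = lifting_with_retraction E C R S \<rho> P Q M N i p g \<pi>
  for E :: "('v, 'e) pre_digraph" and C and R :: "('r, 'z) ring_scheme" and S
    and \<rho> :: "(('v, 'e) gen free_word \<Rightarrow>\<^sub>0 'k::field) \<Rightarrow> 'r"
    and P Q M N :: "('r, 'm) module" and i p g \<pi> +
  fixes DE
  assumes DE: "e \<in> arcs E \<Longrightarrow> homogeneous_lift (Edge e) (DE e)"
begin

lemma DE_lifts: "e \<in> arcs E \<Longrightarrow> lifts (Edge e) (DE e)"
  using DE by (simp add: homogeneous_lift_def)

lemma DE_homogeneous:
  assumes "e \<in> arcs E" "x \<in> carrier P"
  shows "DE e (gact P (Vertex (head E e)) x) = DE e x"
    and "gact M (Vertex (tail E e)) (DE e x) = DE e x"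
  using DE[OF assms(1)] assms(2) by (auto simp: homogeneous_lift_def)

context
  fixes X e
  assumes X: "X \<in> all_classes E C" and e: "e \<in> X"
begin

lemma X_arcs: "e' \<in> X \<Longrightarrow> e' \<in> arcs E"
  using class_arcs[OF X] by blast

lemma X_DE: "e' \<in> X \<Longrightarrow> lifts (Edge e') (DE e')"
  by (simp add: DE_lifts X_arcs)

text \<open>
  This is the derivative of the relation (SCK1), as the vertices contribute nothing. It shows that
  the values prescribed for the lift of a ghost edge are lifts of the defect.
\<close>

lemma defect_ghost_edge:
  assumes "e' \<in> X" "x \<in> carrier P"
  shows "defect (Ghost e) (gact P (Edge e') x) = \<ominus>\<^bsub>N\<^esub> gact N (Ghost e) (defect (Edge e') x)"
proof -
  have "g (\<pi> (gact P (Ghost e) (gact P (Edge e') x)))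
      = gact N (Ghost e) (gact N (Edge e') (g (\<pi> x)))"
    using assms X_arcs[OF e] X_arcs[OF assms(1)]
    by (simp add: P.ghost_edge[OF X e] N.ghost_edge[OF X e] pi_vertex pi_zero g_simps pi_closed)
  then have "defect (Ghost e) (gact P (Edge e') x) \<oplus>\<^bsub>N\<^esub> gact N (Ghost e) (defect (Edge e') x) = \<zero>\<^bsub>N\<^esub>"
    using defect_comp[OF assms(2), of "Ghost e" "Edge e'"] assms
    by (simp add: N.a_comm N.act_closed defect_closed P.act_closed a_minus_def N.r_neg g_pi_closed)
  then show ?thesis
    using assms N.minus_equality by (simp add: N.act_closed defect_closed P.act_closed)
qed

text \<open>
  The subspace on which the lift for \<open>e\<^sup>*\<close> is prescribed is the sum of \<open>iQ\<close> and all \<open>e'P\<close> with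
  \<open>e' \<in> X\<close>. Modulo \<open>iQ\<close> the component of \<open>y\<close> in \<open>e'P\<close> is \<open>e'e'\<^sup>*y\<close>, so \<open>y\<close> belongs to this subspace if and only
  if \<open>y - \<Sum>e'e'\<^sup>*y \<in> iQ\<close> for some finite set \<open>Y\<close> of summation indices \<open>e'\<close>; and then the prescribed
  value is \<open>- \<Sum>e\<^sup>*D\<^bsub>e'\<^esub>(e'\<^sup>*y)\<close>. This description makes the value at zero visibly zero.
\<close>

abbreviation edge_part
  where "edge_part Y y \<equiv> P.ev (\<Sum>e'\<in>Y. edge_elem e' * ghost_elem e') y"

definition ghost_value
  where "ghost_value Y y =
    (\<Oplus>\<^bsub>M\<^esub>e'\<in>Y. \<ominus>\<^bsub>M\<^esub> gact M (Ghost e) (DE e' (gact P (Ghost e') y)))"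

definition decomposes
  where "decomposes Y y \<longleftrightarrow> finite Y \<and> Y \<subseteq> X \<and> y \<in> carrier P \<and>
    (\<exists>q\<in>carrier Q. y = i q \<oplus>\<^bsub>P\<^esub> edge_part Y y)"

lemma edge_part_closed: "y \<in> carrier P \<Longrightarrow> edge_part Y y \<in> carrier P"
  by (rule P.ev_closed)

lemma edge_part_insert:
  "\<lbrakk>finite Y; e' \<notin> Y; y \<in> carrier P\<rbrakk>
    \<Longrightarrow> edge_part (insert e' Y) y = gact P (Edge e') (gact P (Ghost e') y) \<oplus>\<^bsub>P\<^esub> edge_part Y y"
  by (simp add: P.ev_add P.ev_mult P.ev_gen P.act_closed)

lemma ghost_term_closed:
  "\<lbrakk>e' \<in> X; y \<in> carrier P\<rbrakk>
    \<Longrightarrow> \<ominus>\<^bsub>M\<^esub> gact M (Ghost e) (DE e' (gact P (Ghost e') y)) \<in> carrier M"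
  by (simp add: M.act_closed liftsD(1)[OF X_DE] P.act_closed)

lemma ghost_value_closed:
  "\<lbrakk>Y \<subseteq> X; y \<in> carrier P\<rbrakk> \<Longrightarrow> ghost_value Y y \<in> carrier M"
  unfolding ghost_value_def by (rule M.finsum_closed) (use ghost_term_closed in auto)

lemma ghost_value_empty: "ghost_value {} y = \<zero>\<^bsub>M\<^esub>"
  by (simp add: ghost_value_def)

lemma ghost_value_insert:
  "\<lbrakk>finite Y; e' \<notin> Y; insert e' Y \<subseteq> X; y \<in> carrier P\<rbrakk> \<Longrightarrow> ghost_value (insert e' Y) y
    = \<ominus>\<^bsub>M\<^esub> gact M (Ghost e) (DE e' (gact P (Ghost e') y)) \<oplus>\<^bsub>M\<^esub> ghost_value Y y"
  unfolding ghost_value_def by (rule M.finsum_insert) (use ghost_term_closed in auto)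

lemma ghost_value_add:
  "\<lbrakk>finite Y; Y \<subseteq> X; y \<in> carrier P; z \<in> carrier P\<rbrakk>
    \<Longrightarrow> ghost_value Y (y \<oplus>\<^bsub>P\<^esub> z) = ghost_value Y y \<oplus>\<^bsub>M\<^esub> ghost_value Y z"
proof (induction Y rule: finite_induct)
  case (insert e' Y)
  have "\<ominus>\<^bsub>M\<^esub> gact M (Ghost e) (DE e' (gact P (Ghost e') (y \<oplus>\<^bsub>P\<^esub> z)))
    = \<ominus>\<^bsub>M\<^esub> gact M (Ghost e) (DE e' (gact P (Ghost e') y))
      \<oplus>\<^bsub>M\<^esub> \<ominus>\<^bsub>M\<^esub> gact M (Ghost e) (DE e' (gact P (Ghost e') z))"
    using insert.prems
    by (simp add: P.act_add P.act_closed liftsD[OF X_DE] M.act_add M.act_closed M.minus_add)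
  with insert show ?case
    by (simp add: ghost_value_insert ghost_value_closed ghost_term_closed M.a_ac M.act_closed
        liftsD(1)[OF X_DE] P.act_closed)
qed (simp add: ghost_value_empty)

lemma ghost_value_scal:
  "\<lbrakk>finite Y; Y \<subseteq> X; y \<in> carrier P\<rbrakk> \<Longrightarrow> ghost_value Y (scal P c y) = scal M c (ghost_value Y y)"
proof (induction Y rule: finite_induct)
  case (insert e' Y)
  then have "ghost_value (insert e' Y) (scal P c y)
    = scal M c (\<ominus>\<^bsub>M\<^esub> gact M (Ghost e) (DE e' (gact P (Ghost e') y))) \<oplus>\<^bsub>M\<^esub> scal M c (ghost_value Y y)"
    by (simp add: ghost_value_insert P.sc_closed P.act_sc P.act_closed liftsD[OF X_DE] M.act_sc
        M.sc_minus M.act_closed)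
  with insert.hyps insert.prems show ?case
    using ghost_term_closed by (simp add: ghost_value_insert M.sc_add_right ghost_value_closed)
qed (simp add: ghost_value_empty M.sc_zero_right)

lemma p_ghost_value:
  "\<lbrakk>finite Y; Y \<subseteq> X; y \<in> carrier P\<rbrakk> \<Longrightarrow> p (ghost_value Y y) = defect (Ghost e) (edge_part Y y)"
proof (induction Y rule: finite_induct)
  case (insert e' Y)
  then have "p (ghost_value (insert e' Y) y)
    = \<ominus>\<^bsub>N\<^esub> gact N (Ghost e) (defect (Edge e') (gact P (Ghost e') y)) \<oplus>\<^bsub>N\<^esub> defect (Ghost e) (edge_part Y y)"
    using ghost_term_closed[of e' y]
    by (simp add: ghost_value_insert ghost_value_closed p_simps liftsD[OF X_DE] P.act_closed M.act_closed)
  with insert.hyps insert.prems show ?case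
    using defect_ghost_edge[of e' "gact P (Ghost e') y"]
    by (simp add: edge_part_insert defect_add P.act_closed edge_part_closed del: sum.insert)
qed (simp add: ghost_value_empty P.ev_zero p_simps defect_zero)

text \<open>
  If \<open>Y\<close> suffices for \<open>y\<close>, then for every further index \<open>e'\<close> the element \<open>e'\<^sup>*y\<close> lies in \<open>iQ\<close>, where
  \<open>D\<^bsub>e'\<^esub>\<close> vanishes. So larger sets of indices do not change the value, and two elements can be
  handled with a common set of indices.
\<close>

lemma decomposes_insert:
  assumes dec: "decomposes Y y" and e0: "e0 \<in> X" "e0 \<notin> Y"
  shows "decomposes (insert e0 Y) y \<and> ghost_value (insert e0 Y) y = ghost_value Y y"
proof -
  obtain q where Y: "finite Y" "Y \<subseteq> X" and y: "y \<in> carrier P" and q: "q \<in> carrier Q"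
    and yq: "y = i q \<oplus>\<^bsub>P\<^esub> edge_part Y y"
    using dec by (auto simp: decomposes_def)
  have "gact P (Ghost e0) y = gact P (Ghost e0) (i q) \<oplus>\<^bsub>P\<^esub> gact P (Ghost e0) (edge_part Y y)"
    using q y by (subst yq) (simp add: P.act_add i_simps edge_part_closed)
  also have "\<dots> = i (gact Q (Ghost e0) q)"
    using P.ghost_sum_edges[OF X Y e0(1) y] e0(2) q by (simp add: i_simps Q.act_closed P.act_closed)
  finally have ghost: "gact P (Ghost e0) y = i (gact Q (Ghost e0) q)" .
  define q' where "q' = gact Q (Edge e0) (gact Q (Ghost e0) q)"
  have q': "q' \<in> carrier Q"
    using q by (simp add: q'_def Q.act_closed)
  have part: "edge_part (insert e0 Y) y = i q' \<oplus>\<^bsub>P\<^esub> edge_part Y y"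
    using edge_part_insert[OF Y(1) e0(2) y] q by (simp add: ghost q'_def i_simps Q.act_closed)
  have "i (q \<ominus>\<^bsub>Q\<^esub> q') \<oplus>\<^bsub>P\<^esub> edge_part (insert e0 Y) y
    = (i q \<oplus>\<^bsub>P\<^esub> edge_part Y y) \<oplus>\<^bsub>P\<^esub> (\<ominus>\<^bsub>P\<^esub> i q' \<oplus>\<^bsub>P\<^esub> i q')"
    unfolding part using q q' edge_part_closed[OF y]
    by (simp add: a_minus_def i_simps P.a_ac del: P.l_neg P.r_neg)
  also have "\<dots> = y"
    using q' y yq[symmetric] by (simp add: P.l_neg i_simps)
  finally have "decomposes (insert e0 Y) y"
    unfolding decomposes_def using Y e0 y q q' by (intro conjI bexI[of _ "q \<ominus>\<^bsub>Q\<^esub> q'"]) auto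
  moreover have "ghost_value (insert e0 Y) y = ghost_value Y y"
    using Y e0 y q
    by (simp add: ghost_value_insert ghost liftsD(5)[OF X_DE] Q.act_closed M.act_zero ghost_value_closed)
  ultimately show ?thesis ..
qed

lemma decomposes_mono:
  assumes dec: "decomposes Y y" and Z: "finite Z" "Z \<subseteq> X"
  shows "decomposes (Y \<union> Z) y \<and> ghost_value (Y \<union> Z) y = ghost_value Y y"
  using Z
proof (induction Z rule: finite_induct)
  case (insert e0 Z)
  then show ?case
    using decomposes_insert[of "Y \<union> Z" y e0] by (cases "e0 \<in> Y \<union> Z") (auto simp: insert_absorb)
qed (use dec in simp)

definition ghost_relation
  where "ghost_relation = {(y, ghost_value Y y) | Y y. decomposes Y y}"

lemma ghost_relationI: "decomposes Y y \<Longrightarrow> m = ghost_value Y y \<Longrightarrow> (y, m) \<in> ghost_relation"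
  by (auto simp: ghost_relation_def)

lemma ghost_relationE:
  assumes "(y, m) \<in> ghost_relation"
  obtains Y q where "finite Y" "Y \<subseteq> X" "y \<in> carrier P" "q \<in> carrier Q" "decomposes Y y"
    "y = i q \<oplus>\<^bsub>P\<^esub> edge_part Y y" "m = ghost_value Y y"
  using assms that by (auto simp: ghost_relation_def decomposes_def)

lemma ghost_relation_i:
  assumes "q \<in> carrier Q"
  shows "(i q, \<zero>\<^bsub>M\<^esub>) \<in> ghost_relation"
proof (rule ghost_relationI)
  show "decomposes {} (i q)"
    unfolding decomposes_def using assms by (auto simp: i_simps P.ev_zero)
qed (simp add: ghost_value_empty)

lemma ghost_relation_edge:
  assumes e': "e' \<in> X" and x: "x \<in> carrier P"
  shows "(gact P (Edge e') x, \<ominus>\<^bsub>M\<^esub> gact M (Ghost e) (DE e' x)) \<in> ghost_relation"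
proof (rule ghost_relationI)
  have r: "gact P (Ghost e') (gact P (Edge e') x) = gact P (Vertex (head E e')) x"
    using P.ghost_edge[OF X e' e' x] by simp
  have arc: "e' \<in> arcs E"
    using e' by (rule X_arcs)
  have "edge_part {e'} (gact P (Edge e') x) = gact P (Edge e') x"
    using edge_part_insert[of "{}" e' "gact P (Edge e') x"] x arc
    by (simp add: P.ev_zero P.act_closed r P.edge_head del: sum.insert)
  then show "decomposes {e'} (gact P (Edge e') x)"
    unfolding decomposes_def using e' x Q.zero_closed
    by (auto simp: P.act_closed i_simps intro!: bexI[of _ "\<zero>\<^bsub>Q\<^esub>"])
  show "\<ominus>\<^bsub>M\<^esub> gact M (Ghost e) (DE e' x) = ghost_value {e'} (gact P (Edge e') x)"
    using ghost_value_insert[of "{}" e' "gact P (Edge e') x"] ghost_term_closed[of e' "gact P (Edge e') x"]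
      e' x arc
    by (simp add: ghost_value_empty P.act_closed r DE_homogeneous)
qed

lemma ghost_relation_linear: "PM.linear_relation ghost_relation"
  unfolding PM.linear_relation_def
proof (intro conjI allI impI ballI)
  show "ghost_relation \<subseteq> carrier P \<times> carrier M"
    by (auto elim!: ghost_relationE intro: ghost_value_closed)
  show "(\<zero>\<^bsub>P\<^esub>, \<zero>\<^bsub>M\<^esub>) \<in> ghost_relation"
    using ghost_relation_i[of "\<zero>\<^bsub>Q\<^esub>"] by (simp add: i_simps)
next
  fix y m z n assume "(y, m) \<in> ghost_relation" "(z, n) \<in> ghost_relation"
  then obtain Y Z where Y: "finite Y" "Y \<subseteq> X" "decomposes Y y" "m = ghost_value Y y" "y \<in> carrier P"
    and Z: "finite Z" "Z \<subseteq> X" "decomposes Z z" "n = ghost_value Z z" "z \<in> carrier P"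
    by (elim ghost_relationE)
  let ?U = "Y \<union> Z"
  have 1: "decomposes ?U y" "ghost_value ?U y = m"
    using decomposes_mono[OF Y(3) Z(1,2)] Y by simp_all
  have 2: "decomposes ?U z" "ghost_value ?U z = n"
    using decomposes_mono[OF Z(3) Y(1,2)] Z by (simp_all add: Un_commute)
  obtain q where q: "q \<in> carrier Q" "y = i q \<oplus>\<^bsub>P\<^esub> edge_part ?U y"
    using 1(1) by (auto simp: decomposes_def)
  obtain q' where q': "q' \<in> carrier Q" "z = i q' \<oplus>\<^bsub>P\<^esub> edge_part ?U z"
    using 2(1) by (auto simp: decomposes_def)
  have "i (q \<oplus>\<^bsub>Q\<^esub> q') \<oplus>\<^bsub>P\<^esub> edge_part ?U (y \<oplus>\<^bsub>P\<^esub> z)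
    = (i q \<oplus>\<^bsub>P\<^esub> edge_part ?U y) \<oplus>\<^bsub>P\<^esub> (i q' \<oplus>\<^bsub>P\<^esub> edge_part ?U z)"
    using q(1) q'(1) Y(5) Z(5) edge_part_closed
    by (simp add: i_simps P.ev_add_right P.a_ac)
  then have "y \<oplus>\<^bsub>P\<^esub> z = i (q \<oplus>\<^bsub>Q\<^esub> q') \<oplus>\<^bsub>P\<^esub> edge_part ?U (y \<oplus>\<^bsub>P\<^esub> z)"
    using q(2) q'(2) by simp
  then have "decomposes ?U (y \<oplus>\<^bsub>P\<^esub> z)"
    unfolding decomposes_def using Y Z q q' by (intro conjI bexI[of _ "q \<oplus>\<^bsub>Q\<^esub> q'"]) auto
  then show "(y \<oplus>\<^bsub>P\<^esub> z, m \<oplus>\<^bsub>M\<^esub> n) \<in> ghost_relation"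
    using Y Z 1 2 by (intro ghost_relationI[of ?U]) (auto simp: ghost_value_add)
next
  fix c y m assume "(y, m) \<in> ghost_relation"
  then obtain Y q where Y: "finite Y" "Y \<subseteq> X" "y \<in> carrier P" "q \<in> carrier Q"
    "y = i q \<oplus>\<^bsub>P\<^esub> edge_part Y y" "m = ghost_value Y y"
    by (rule ghost_relationE)
  have "scal P c y = i (scal Q c q) \<oplus>\<^bsub>P\<^esub> edge_part Y (scal P c y)"
  proof -
    have "scal P c (i q \<oplus>\<^bsub>P\<^esub> edge_part Y y) = i (scal Q c q) \<oplus>\<^bsub>P\<^esub> edge_part Y (scal P c y)"
      using Y(3,4) edge_part_closed[of y Y]
      by (simp add: P.ev_sc P.sc_add_right i_simps)
    with Y(5) show ?thesis by simp
  qed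
  then have "decomposes Y (scal P c y)"
    unfolding decomposes_def using Y by (auto simp: P.sc_closed Q.sc_closed)
  then show "(scal P c y, scal M c m) \<in> ghost_relation"
    using Y by (intro ghost_relationI[of Y]) (auto simp: ghost_value_scal)
qed

lemma ghost_relation_single_valued: "PM.single_valued_at_zero ghost_relation"
  unfolding PM.single_valued_at_zero_def
proof (intro allI impI)
  fix m assume "(\<zero>\<^bsub>P\<^esub>, m) \<in> ghost_relation"
  then obtain Y where Y: "finite Y" "Y \<subseteq> X" "m = ghost_value Y \<zero>\<^bsub>P\<^esub>"
    by (rule ghost_relationE)
  have "ghost_value Y \<zero>\<^bsub>P\<^esub> = \<zero>\<^bsub>M\<^esub>"
    using ghost_value_scal[OF Y(1,2) P.zero_closed, of 0] Y
    by (simp add: P.sc_zero M.sc_zero ghost_value_closed)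
  with Y show "m = \<zero>\<^bsub>M\<^esub>" by simp
qed

lemma p_ghost_relation:
  assumes "(y, m) \<in> ghost_relation"
  shows "p m = defect (Ghost e) y"
proof -
  obtain Y q where Y: "finite Y" "Y \<subseteq> X" "y \<in> carrier P" "q \<in> carrier Q"
    "y = i q \<oplus>\<^bsub>P\<^esub> edge_part Y y" "m = ghost_value Y y"
    using assms by (rule ghost_relationE)
  have "defect (Ghost e) (i q \<oplus>\<^bsub>P\<^esub> edge_part Y y) = p m"
    using Y(1-4,6) edge_part_closed[OF Y(3), of Y]
    by (simp add: defect_add i_simps defect_i p_ghost_value defect_closed)
  with Y(5) show ?thesis by simp
qed

lemma exists_ghost_lift_class:
  "\<exists>D. homogeneous_lift (Ghost e) D \<and> (\<forall>e'\<in>X. \<forall>x\<in>carrier P.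
    D (gact P (Edge e') x) = \<ominus>\<^bsub>M\<^esub> gact M (Ghost e) (DE e' x))"
proof -
  obtain D where D: "lifts (Ghost e) D" "\<And>y m. (y, m) \<in> ghost_relation \<Longrightarrow> D y = m"
    using exists_lift_extending[of ghost_relation "Ghost e"] ghost_relation_linear
      ghost_relation_single_valued p_ghost_relation ghost_relation_i by blast
  let ?D = "\<lambda>x. gact M (Vertex (left_vertex (Ghost e))) (D (gact P (Vertex (right_vertex (Ghost e))) x))"
  have e_arc: "Ghost e \<in> G"
    using X_arcs[OF e] by simp
  have "homogeneous_lift (Ghost e) ?D"
    by (rule lifts_homogenise[OF D(1) e_arc])
  moreover have "?D (gact P (Edge e') x) = \<ominus>\<^bsub>M\<^esub> gact M (Ghost e) (DE e' x)"
    if e': "e' \<in> X" and x: "x \<in> carrier P" for e' x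
  proof -
    have tail: "tail E e' = tail E e"
      using X e e' by (rule class_tail_eq)
    have "gact P (Vertex (tail E e)) (gact P (Edge e') x) = gact P (Edge e') x"
      using P.tail_edge[OF X_arcs[OF e'] x] by (simp add: tail)
    then have "?D (gact P (Edge e') x)
      = gact M (Vertex (head E e)) (\<ominus>\<^bsub>M\<^esub> gact M (Ghost e) (DE e' x))"
      using D(2)[OF ghost_relation_edge[OF e' x]] by simp
    then show ?thesis
      using M.head_ghost[OF X_arcs[OF e]] x
      by (simp add: M.act_minus M.act_closed liftsD(1)[OF X_DE[OF e']])
  qed
  ultimately show ?thesis by blast
qed

end

lemma exists_ghost_lift:
  assumes e: "e \<in> arcs E"
  shows "\<exists>D. homogeneous_lift (Ghost e) D \<and> (\<forall>X\<in>all_classes E C. e \<in> X \<longrightarrow>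
    (\<forall>e'\<in>X. \<forall>x\<in>carrier P. D (gact P (Edge e') x) = \<ominus>\<^bsub>M\<^esub> gact M (Ghost e) (DE e' x)))"
proof -
  obtain X where X: "X \<in> all_classes E C" "e \<in> X"
    using arc_in_class[OF e] by blast
  have "X' = X" if "X' \<in> all_classes E C" "e \<in> X'" for X'
    using class_unique that X by blast
  with exists_ghost_lift_class[OF X] show ?thesis by metis
qed

end

section \<open>The extension of modules defined by a derivation\<close>

text \<open>
  The map \<open>pair\<close> encodes elements of \<open>M \<times> P\<close> as elements of the universe, so that the extension is
  an object of the category in which \<open>P\<close> is projective.
\<close>

locale lifting_with_derivation = lifting_with_edges E C R S \<rho> P Q M N i p g \<pi> DE
  for E :: "('v, 'e) pre_digraph" and C and R :: "('r, 'z) ring_scheme" and S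
    and \<rho> :: "(('v, 'e) gen free_word \<Rightarrow>\<^sub>0 'k::field) \<Rightarrow> 'r"
    and P Q M N :: "('r, 'm) module" and i p g \<pi> DE +
  fixes DG and pair :: "'m \<Rightarrow> 'm \<Rightarrow> 'm"
  assumes DG: "e \<in> arcs E \<Longrightarrow> homogeneous_lift (Ghost e) (DG e)"
    and DG_edge: "\<lbrakk>X \<in> all_classes E C; e \<in> X; e' \<in> X; x \<in> carrier P\<rbrakk>
      \<Longrightarrow> DG e (gact P (Edge e') x) = \<ominus>\<^bsub>M\<^esub> gact M (Ghost e) (DE e' x)"
    and inj_pair: "inj (\<lambda>(m, x). pair m x)"
begin

definition first :: "'m \<Rightarrow> 'm"
  where "first z = fst (inv_into UNIV (\<lambda>(m, x). pair m x) z)"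

definition second :: "'m \<Rightarrow> 'm"
  where "second z = snd (inv_into UNIV (\<lambda>(m, x). pair m x) z)"

lemma first_pair [simp]: "first (pair m x) = m" and second_pair [simp]: "second (pair m x) = x"
  using inv_f_f[OF inj_pair, of "(m, x)"] by (simp_all add: first_def second_def)

lemma pair_eq_iff [simp]: "pair m x = pair m' x' \<longleftrightarrow> m = m' \<and> x = x'"
  by (metis first_pair second_pair)

lemma DG_lifts: "e \<in> arcs E \<Longrightarrow> lifts (Ghost e) (DG e)"
  using DG by (simp add: homogeneous_lift_def)

lemma DG_homogeneous:
  assumes "e \<in> arcs E" "x \<in> carrier P"
  shows "DG e (gact P (Vertex (tail E e)) x) = DG e x"
    and "gact M (Vertex (head E e)) (DG e x) = DG e x"
  using DG[OF assms(1)] assms(2) by (auto simp: homogeneous_lift_def)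

definition deriv :: "('v, 'e) gen \<Rightarrow> 'm \<Rightarrow> 'm"
  where "deriv \<gamma> x = (if \<gamma> \<in> G then case \<gamma> of Vertex v \<Rightarrow> \<zero>\<^bsub>M\<^esub> | Edge e \<Rightarrow> DE e x | Ghost e \<Rightarrow> DG e x
    else \<zero>\<^bsub>M\<^esub>)"

lemma deriv_simps [simp]:
  "v \<in> verts E \<Longrightarrow> deriv (Vertex v) x = \<zero>\<^bsub>M\<^esub>"
  "e \<in> arcs E \<Longrightarrow> deriv (Edge e) x = DE e x"
  "e \<in> arcs E \<Longrightarrow> deriv (Ghost e) x = DG e x"
  by (simp_all add: deriv_def)

lemma deriv_lifts: "lifts \<gamma> (deriv \<gamma>)"
proof (cases "\<gamma> \<in> G")
  case False
  then have "defect \<gamma> x = \<zero>\<^bsub>N\<^esub>" if "x \<in> carrier P" for x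
    using that by (simp add: defect_def gact_def pi_zero g_simps a_minus_def)
  with False show ?thesis
    by (auto simp: lifts_def deriv_def p_simps M.sc_zero_right)
next
  case True
  show ?thesis
  proof (cases \<gamma>)
    case (Vertex v)
    with True show ?thesis
      by (auto simp: lifts_def p_simps M.sc_zero_right defect_vertex)
  next
    case (Edge e)
    with True have "deriv \<gamma> = DE e" by auto
    with True Edge show ?thesis by (simp add: DE_lifts)
  next
    case (Ghost e)
    with True have "deriv \<gamma> = DG e" by auto
    with True Ghost show ?thesis by (simp add: DG_lifts)
  qed
qed

lemmas deriv_closed = liftsD(1)[OF deriv_lifts]
lemmas p_deriv = liftsD(2)[OF deriv_lifts]
lemmas deriv_add = liftsD(3)[OF deriv_lifts]
lemmas deriv_scal = liftsD(4)[OF deriv_lifts]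
lemmas deriv_i = liftsD(5)[OF deriv_lifts]
lemmas deriv_zero = lifts_zero[OF deriv_lifts]

text \<open>
  The pullback of \<open>p: M \<rightarrow> N\<close> and \<open>g \<circ> \<pi>: P \<rightarrow> N\<close>, with the action twisted by the derivation. The
  twist compensates for the fact that \<open>\<pi>\<close> is not a morphism.
\<close>

definition ext :: "('r, 'm) module"
  where "ext = \<lparr>carrier = {pair m x | m x. m \<in> carrier M \<and> x \<in> carrier P \<and> p m = g (\<pi> x)},
    mult = undefined, one = undefined, zero = pair \<zero>\<^bsub>M\<^esub> \<zero>\<^bsub>P\<^esub>,
    add = (\<lambda>z w. pair (first z \<oplus>\<^bsub>M\<^esub> first w) (second z \<oplus>\<^bsub>P\<^esub> second w)), smult = undefined\<rparr>"

definition ext_scal :: "'k \<Rightarrow> 'm \<Rightarrow> 'm"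
  where "ext_scal c z = pair (scal M c (first z)) (scal P c (second z))"

definition ext_act :: "('v, 'e) gen \<Rightarrow> 'm \<Rightarrow> 'm"
  where "ext_act \<gamma> z =
    pair (gact M \<gamma> (first z) \<oplus>\<^bsub>M\<^esub> deriv \<gamma> (second z)) (gact P \<gamma> (second z))"

lemma ext_carrier:
  "pair m x \<in> carrier ext \<longleftrightarrow> m \<in> carrier M \<and> x \<in> carrier P \<and> p m = g (\<pi> x)"
  by (auto simp: ext_def)

lemma ext_cases:
  assumes "z \<in> carrier ext"
  obtains m x where "z = pair m x" "m \<in> carrier M" "x \<in> carrier P" "p m = g (\<pi> x)"
  using assms by (auto simp: ext_def)

lemma ext_zero: "\<zero>\<^bsub>ext\<^esub> = pair \<zero>\<^bsub>M\<^esub> \<zero>\<^bsub>P\<^esub>"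
  by (simp add: ext_def)

lemma ext_add: "pair m x \<oplus>\<^bsub>ext\<^esub> pair n y = pair (m \<oplus>\<^bsub>M\<^esub> n) (x \<oplus>\<^bsub>P\<^esub> y)"
  by (simp add: ext_def)

lemma ext_scal_pair: "ext_scal c (pair m x) = pair (scal M c m) (scal P c x)"
  by (simp add: ext_scal_def)

lemma ext_act_pair: "ext_act \<gamma> (pair m x) = pair (gact M \<gamma> m \<oplus>\<^bsub>M\<^esub> deriv \<gamma> x) (gact P \<gamma> x)"
  by (simp add: ext_act_def)

lemmas ext_simps = ext_carrier ext_zero ext_add ext_scal_pair ext_act_pair
lemmas closed = M.act_closed P.act_closed deriv_closed M.sc_closed P.sc_closed

lemma ext_abelian_group: "abelian_group ext"
proof (rule abelian_groupI)
  fix z assume "z \<in> carrier ext"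
  then obtain m x where z: "z = pair m x" "m \<in> carrier M" "x \<in> carrier P" "p m = g (\<pi> x)"
    by (rule ext_cases)
  have "\<pi> (\<ominus>\<^bsub>P\<^esub> x) = \<ominus>\<^bsub>Q\<^esub> \<pi> x"
    using pi_scal[OF z(3), of "- 1"] z by (simp add: P.sc_neg_one Q.sc_neg_one pi_closed)
  with z show "\<exists>w\<in>carrier ext. w \<oplus>\<^bsub>ext\<^esub> z = \<zero>\<^bsub>ext\<^esub>"
    by (intro bexI[of _ "pair (\<ominus>\<^bsub>M\<^esub> m) (\<ominus>\<^bsub>P\<^esub> x)"])
      (auto simp: ext_simps p_simps g_simps pi_closed M.l_neg P.l_neg)
qed (auto elim!: ext_cases simp: ext_simps p_simps g_simps pi_add pi_closed pi_zero M.a_ac P.a_ac)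

lemma ext_act_closed:
  assumes "z \<in> carrier ext"
  shows "ext_act \<gamma> z \<in> carrier ext"
proof -
  obtain m x where z: "z = pair m x" "m \<in> carrier M" "x \<in> carrier P" "p m = g (\<pi> x)"
    using assms by (rule ext_cases)
  let ?a = "gact N \<gamma> (g (\<pi> x))" and ?b = "g (\<pi> (gact P \<gamma> x))"
  have ab: "?a \<in> carrier N" "?b \<in> carrier N"
    using z by (simp_all add: N.act_closed P.act_closed g_pi_closed)
  have "p (gact M \<gamma> m \<oplus>\<^bsub>M\<^esub> deriv \<gamma> x) = ?a \<oplus>\<^bsub>N\<^esub> (?b \<oplus>\<^bsub>N\<^esub> \<ominus>\<^bsub>N\<^esub> ?a)"
    using z by (simp add: p_simps closed p_deriv defect_eq a_minus_def)
  also have "\<dots> = ?b \<oplus>\<^bsub>N\<^esub> (?a \<oplus>\<^bsub>N\<^esub> \<ominus>\<^bsub>N\<^esub> ?a)"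
    using ab by (simp only: N.a_ac N.a_closed N.a_inv_closed)
  also have "\<dots> = ?b"
    using ab by (simp add: N.r_neg)
  finally show ?thesis
    using z by (simp add: ext_simps closed)
qed

lemma ext_word_rep: "word_rep ext ext_scal ext_act"
proof (intro word_rep.intro vec_space.intro ext_abelian_group)
  show "vec_space_axioms ext ext_scal"
    by unfold_locales
      (auto elim!: ext_cases simp: ext_simps closed p_simps g_simps pi_scal pi_closed
        M.sc_add_left P.sc_add_left M.sc_add_right P.sc_add_right M.sc_mult P.sc_mult M.sc_one P.sc_one)
  show "word_rep_axioms ext ext_scal ext_act"
    by unfold_locales
      (auto elim!: ext_cases simp: ext_act_closed, auto simp: ext_simps closed M.act_add P.act_add
        deriv_add M.act_sc P.act_sc deriv_scal M.sc_add_right M.a_ac)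
qed

lemma ext_cl_rep: "cl_rep ext ext_scal ext_act E C S"
proof -
  interpret X: word_rep ext ext_scal ext_act by (rule ext_word_rep)
  interpret X: cl_action ext ext_scal ext_act E C S
  proof unfold_locales
    fix v w z assume "v \<in> verts E" "w \<in> verts E" "z \<in> carrier ext"
    then show "ext_act (Vertex v) (ext_act (Vertex w) z)
      = (if v = w then ext_act (Vertex v) z else \<zero>\<^bsub>ext\<^esub>)"
      by (auto elim!: ext_cases simp: ext_simps closed M.vertices P.vertices)
  next
    fix e z assume ez: "e \<in> arcs E" "z \<in> carrier ext"
    then obtain m x where z: "z = pair m x" "m \<in> carrier M" "x \<in> carrier P"
      by (auto elim: ext_cases)
    note DE_closed = liftsD(1)[OF DE_lifts[OF ez(1)]] and DG_closed = liftsD(1)[OF DG_lifts[OF ez(1)]]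
    note homogeneous = DE_homogeneous[OF ez(1)] DG_homogeneous[OF ez(1)]
    show "ext_act (Vertex (tail E e)) (ext_act (Edge e) z) = ext_act (Edge e) z"
      using ez z by (simp add: ext_simps closed M.act_add M.tail_edge P.tail_edge DE_closed homogeneous)
    show "ext_act (Edge e) (ext_act (Vertex (head E e)) z) = ext_act (Edge e) z"
      using ez z by (simp add: ext_simps closed M.edge_head P.edge_head homogeneous)
    show "ext_act (Vertex (head E e)) (ext_act (Ghost e) z) = ext_act (Ghost e) z"
      using ez z by (simp add: ext_simps closed M.act_add M.head_ghost P.head_ghost DG_closed homogeneous)
    show "ext_act (Ghost e) (ext_act (Vertex (tail E e)) z) = ext_act (Ghost e) z"
      using ez z by (simp add: ext_simps closed M.ghost_tail P.ghost_tail homogeneous)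
  next
    fix X e e' z assume X: "X \<in> all_classes E C" "e \<in> X" "e' \<in> X" and "z \<in> carrier ext"
    then obtain m x where z: "z = pair m x" "m \<in> carrier M" "x \<in> carrier P"
      by (auto elim: ext_cases)
    have arcs: "e \<in> arcs E" "e' \<in> arcs E"
      using X class_arcs by blast+
    let ?d = "gact M (Ghost e) (DE e' x)"
    have d: "?d \<in> carrier M"
      using z arcs by (simp add: M.act_closed liftsD(1)[OF DE_lifts])
    \<comment> \<open>By the choice of \<open>DG e\<close> the two derivation terms cancel.\<close>
    have "ext_act (Ghost e) (ext_act (Edge e') z)
      = pair (gact M (Ghost e) (gact M (Edge e') m) \<oplus>\<^bsub>M\<^esub> (?d \<oplus>\<^bsub>M\<^esub> \<ominus>\<^bsub>M\<^esub> ?d))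
          (gact P (Ghost e) (gact P (Edge e') x))"
      using z arcs d
      by (simp add: ext_simps M.act_add closed liftsD(1)[OF DE_lifts] DG_edge[OF X] M.a_assoc
          del: M.r_neg)
    also have "\<dots> = pair (gact M (Ghost e) (gact M (Edge e') m)) (gact P (Ghost e) (gact P (Edge e') x))"
      using z d by (simp add: M.r_neg closed)
    finally show "ext_act (Ghost e) (ext_act (Edge e') z)
      = (if e = e' then ext_act (Vertex (head E e)) z else \<zero>\<^bsub>ext\<^esub>)"
      using z arcs by (simp add: M.ghost_edge[OF X] P.ghost_edge[OF X] ext_simps closed)
  next
    fix v X z
    assume v: "v \<in> verts E" and X: "X \<in> S \<inter> C v" and "z \<in> carrier ext"
      and ghosts: "\<And>e. e \<in> X \<Longrightarrow> ext_act (Ghost e) z = \<zero>\<^bsub>ext\<^esub>"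
    then obtain m x where z: "z = pair m x" "m \<in> carrier M" "x \<in> carrier P"
      by (auto elim: ext_cases)
    have e: "e \<in> arcs E" "tail E e = v" if "e \<in> X" for e
      using class_subset[OF v] X that by blast+
    have "gact P (Ghost e) x = \<zero>\<^bsub>P\<^esub>" if "e \<in> X" for e
      using ghosts[OF that] by (simp add: z(1) ext_simps)
    then have vx: "gact P (Vertex v) x = \<zero>\<^bsub>P\<^esub>"
      using P.ghosts_faithful v X z(3) by blast
    \<comment> \<open>As \<open>v\<close> kills \<open>x\<close> and \<open>DG e x = DG e (v x)\<close>, the derivation terms vanish.\<close>
    have "gact M (Ghost e) m = \<zero>\<^bsub>M\<^esub>" if "e \<in> X" for e
    proof -
      have "deriv (Ghost e) x = deriv (Ghost e) (gact P (Vertex v) x)"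
        using DG_homogeneous(1)[OF e(1)[OF that] z(3)] e[OF that] by simp
      then have "deriv (Ghost e) x = \<zero>\<^bsub>M\<^esub>"
        by (simp only: vx deriv_zero)
      then show ?thesis
        using ghosts[OF that] z by (simp add: ext_simps closed del: deriv_simps)
    qed
    then have "gact M (Vertex v) m = \<zero>\<^bsub>M\<^esub>"
      using M.ghosts_faithful v X z(2) by blast
    with vx v z show "ext_act (Vertex v) z = \<zero>\<^bsub>ext\<^esub>"
      by (simp add: ext_simps)
  qed (rule finite_S)
  show ?thesis
  proof unfold_locales
    fix z assume z': "z \<in> carrier ext"
    then obtain m x where z: "z = pair m x" "m \<in> carrier M" "x \<in> carrier P"
      by (auto elim: ext_cases)
    have ev: "X.ev (\<Sum>v\<in>V. vertex_elem v) z
      = pair (M.ev (\<Sum>v\<in>V. vertex_elem v) m) (P.ev (\<Sum>v\<in>V. vertex_elem v) x)"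
      if "finite V" "V \<subseteq> verts E" for V
      using that
      by (induction V rule: finite_induct)
        (use z z' in \<open>auto simp: X.ev_zero M.ev_zero P.ev_zero X.ev_add M.ev_add P.ev_add X.ev_gen
          M.ev_gen P.ev_gen ext_simps closed\<close>)
    obtain V where V: "finite V" "V \<subseteq> verts E" "M.ev (\<Sum>v\<in>V. vertex_elem v) m = m"
      using M.local_unit[OF z(2)] by (auto simp: M.has_local_unit_def)
    obtain W where W: "finite W" "W \<subseteq> verts E" "P.ev (\<Sum>v\<in>W. vertex_elem v) x = x"
      using P.local_unit[OF z(3)] by (auto simp: P.has_local_unit_def)
    have "X.ev (\<Sum>v\<in>V \<union> W. vertex_elem v) z = z"
      using ev[of "V \<union> W"] V W z M.local_unit_mono[of m "V \<union> W" V] P.local_unit_mono[of x "V \<union> W" W]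
      by simp
    then show "X.has_local_unit z"
      unfolding X.has_local_unit_def using V W by (intro exI[of _ "V \<union> W"]) auto
  qed
qed

abbreviation ext_module :: "('r, 'm) module"
  where "ext_module \<equiv> rep_module ext ext_scal ext_act"

lemma ext_module_object: "mod_object R ext_module"
  by (rule mod_object_rep_module[OF ext_cl_rep])

lemma second_morphism: "second \<in> mod_morphisms R ext_module P"
proof (rule mod_morphismI[OF ext_module_object P])
  show "second (scal ext_module c z) = scal P c (second z)" if "z \<in> carrier ext_module" for c z
    using that scal_rep_module[OF ext_cl_rep] by (auto elim!: ext_cases simp: ext_simps)
  show "second (gact ext_module \<gamma> z) = gact P \<gamma> (second z)"
    if "\<gamma> \<in> G" "z \<in> carrier ext_module" for \<gamma> z
    using that gact_rep_module[OF ext_cl_rep] by (auto elim!: ext_cases simp: ext_simps)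
qed (auto elim!: ext_cases simp: ext_simps)

lemma second_surjective: "second ` carrier ext_module = carrier P"
proof
  show "carrier P \<subseteq> second ` carrier ext_module"
  proof
    fix x assume x: "x \<in> carrier P"
    then have "g (\<pi> x) \<in> p ` carrier M"
      using g_pi_closed surj by simp
    then obtain m where "m \<in> carrier M" "p m = g (\<pi> x)" by auto
    with x show "x \<in> second ` carrier ext_module"
      by (intro image_eqI[of _ _ "pair m x"]) (auto simp: ext_simps)
  qed
qed (auto elim!: ext_cases)

text \<open>
  A section has the form \<open>x \<mapsto> (k x, x)\<close> with \<open>k (\<gamma> x) = \<gamma> (k x) + D\<^sub>\<gamma> x\<close>, and \<open>D\<close> vanishes on \<open>iQ\<close>.
\<close>

lemma lift_from_section:
  assumes h: "h \<in> mod_morphisms R P ext_module"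
    and sec: "\<And>x. x \<in> carrier P \<Longrightarrow> second (h x) = x"
  shows "(\<lambda>q. first (h (i q))) \<in> mod_morphisms R Q M"
    and "q \<in> carrier Q \<Longrightarrow> p (first (h (i q))) = g q"
proof -
  let ?k = "\<lambda>q. first (h (i q))"
  have hi: "h (i q) = pair (?k q) (i q) \<and> ?k q \<in> carrier M \<and> p (?k q) = g q"
    if q: "q \<in> carrier Q" for q
  proof -
    have "h (i q) \<in> carrier ext"
      using mod_morphismsD(1)[OF h, of "i q"] q by (simp add: i_simps)
    then obtain m x where "h (i q) = pair m x" "m \<in> carrier M" "x \<in> carrier P" "p m = g (\<pi> x)"
      by (rule ext_cases)
    moreover have "second (h (i q)) = i q"
      using q by (simp add: sec i_simps)
    ultimately show ?thesis
      using q by (simp add: pi_i)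
  qed
  then show "p (?k q) = g q" if "q \<in> carrier Q"
    using that by blast
  have hi_carrier: "pair (?k q) (i q) \<in> carrier ext" if "q \<in> carrier Q" for q
    using conjunct2[OF hi[OF that]] that by (simp add: ext_carrier i_simps pi_i)
  show "?k \<in> mod_morphisms R Q M"
  proof (rule mod_morphismI[OF Q M])
    fix q assume q: "q \<in> carrier Q"
    show "?k q \<in> carrier M"
      using hi[OF q] by blast
    show "?k (q \<oplus>\<^bsub>Q\<^esub> q') = ?k q \<oplus>\<^bsub>M\<^esub> ?k q'" if q': "q' \<in> carrier Q" for q'
    proof -
      have "h (i (q \<oplus>\<^bsub>Q\<^esub> q')) = h (i q) \<oplus>\<^bsub>ext\<^esub> h (i q')"
        using q q' mod_morphismsD(2)[OF h] by (simp add: i_simps)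
      also have "\<dots> = pair (?k q \<oplus>\<^bsub>M\<^esub> ?k q') (i q \<oplus>\<^bsub>P\<^esub> i q')"
        using hi[OF q] hi[OF q'] ext_add by metis
      finally show ?thesis by simp
    qed
    show "?k (scal Q c q) = scal M c (?k q)" for c
    proof -
      have "h (i (scal Q c q)) = scal ext_module c (h (i q))"
        using q morphism_scal[OF P ext_module_object h] by (simp add: i_simps)
      also have "\<dots> = ext_scal c (pair (?k q) (i q))"
        using hi[OF q] scal_rep_module[OF ext_cl_rep hi_carrier[OF q]] by metis
      finally show ?thesis by (simp add: ext_scal_pair)
    qed
    show "?k (gact Q \<gamma> q) = gact M \<gamma> (?k q)" if "\<gamma> \<in> G" for \<gamma>
    proof -
      have "h (i (gact Q \<gamma> q)) = gact ext_module \<gamma> (h (i q))"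
        using q morphism_gact[OF P ext_module_object h] by (simp add: i_simps)
      also have "\<dots> = ext_act \<gamma> (pair (?k q) (i q))"
        using hi[OF q] gact_rep_module[OF ext_cl_rep that hi_carrier[OF q]] by metis
      also have "\<dots> = pair (gact M \<gamma> (?k q)) (gact P \<gamma> (i q))"
        using conjunct2[OF hi[OF q]] q by (simp add: ext_act_pair deriv_i closed)
      finally show ?thesis by simp
    qed
  qed
qed

end

context lifting_problem
begin

theorem exists_lift:
  fixes pair :: "'m \<Rightarrow> 'm \<Rightarrow> 'm"
  assumes proj: "projective_object R P" and inj_pair: "inj (\<lambda>(m, x). pair m x)"
  shows "\<exists>h\<in>mod_morphisms R Q M. \<forall>q\<in>carrier Q. p (h q) = g q"
proof -
  obtain \<pi> where "lifting_with_retraction E C R S \<rho> P Q M N i p g \<pi>"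
  proof (rule exists_graded_retraction)
    fix \<pi>
    assume "\<And>x. x \<in> carrier P \<Longrightarrow> \<pi> x \<in> carrier Q"
      "\<And>x y. \<lbrakk>x \<in> carrier P; y \<in> carrier P\<rbrakk> \<Longrightarrow> \<pi> (x \<oplus>\<^bsub>P\<^esub> y) = \<pi> x \<oplus>\<^bsub>Q\<^esub> \<pi> y"
      "\<And>c x. x \<in> carrier P \<Longrightarrow> \<pi> (scal P c x) = scal Q c (\<pi> x)"
      "\<And>v x. \<lbrakk>v \<in> verts E; x \<in> carrier P\<rbrakk> \<Longrightarrow> \<pi> (gact P (Vertex v) x) = gact Q (Vertex v) (\<pi> x)"
      "\<And>q. q \<in> carrier Q \<Longrightarrow> \<pi> (i q) = q"
    then show thesis
      by (intro that[of \<pi>] lifting_with_retraction.intro lifting_problem_axioms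
          lifting_with_retraction_axioms.intro)
  qed
  then interpret lifting_with_retraction E C R S \<rho> P Q M N i p g \<pi> .
  obtain DE where DE: "\<And>e. e \<in> arcs E \<Longrightarrow> homogeneous_lift (Edge e) (DE e)"
    using exists_edge_lift by metis
  interpret lifting_with_edges E C R S \<rho> P Q M N i p g \<pi> DE
    by unfold_locales (rule DE)
  obtain DG where DG: "\<And>e. e \<in> arcs E \<Longrightarrow> homogeneous_lift (Ghost e) (DG e) \<and>
    (\<forall>X\<in>all_classes E C. e \<in> X \<longrightarrow> (\<forall>e'\<in>X. \<forall>x\<in>carrier P.
      DG e (gact P (Edge e') x) = \<ominus>\<^bsub>M\<^esub> gact M (Ghost e) (DE e' x)))"
    using exists_ghost_lift by metis
  interpret lifting_with_derivation E C R S \<rho> P Q M N i p g \<pi> DE DG pair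
    by unfold_locales (use DG class_arcs inj_pair in blast)+
  have id: "(\<lambda>x. x) \<in> mod_morphisms R P P"
    by (auto simp: mod_morphisms_def)
  have epi: "mod_epi R ext_module P second"
    using second_morphism second_surjective by (rule epi_if_surjective)
  obtain h where h: "h \<in> mod_morphisms R P ext_module" "\<And>x. x \<in> carrier P \<Longrightarrow> second (h x) = x"
    using projective_objectD[OF proj ext_module_object P epi id] by blast
  show ?thesis
    using lift_from_section[OF h] by (intro bexI[of _ "\<lambda>q. first (h (i q))"]) auto
qed

end

theorem (in cl_presentation) presentation_left_hereditary:
  assumes "infinite (UNIV :: 'm set)"
  shows "left_hereditary TYPE('m) R"
proof -
  have "\<exists>f. bij_betw f ((UNIV :: 'm set) \<times> (UNIV :: 'm set)) (UNIV :: 'm set)"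
    using card_of_Times_same_infinite[OF assms] by (simp only: card_of_ordIso)
  then obtain f :: "'m \<times> 'm \<Rightarrow> 'm" where "inj f"
    by (auto simp: bij_betw_def)
  then have pair: "inj (\<lambda>(m, x). curry f m x)"
    by simp
  show ?thesis
    unfolding left_hereditary_def
  proof (intro allI impI, elim conjE)
    fix P Q :: "('r, 'm) module" and i
    assume proj: "projective_object R P" and Q: "mod_object R Q" and mono: "mod_mono R Q P i"
    have P: "mod_object R P"
      using proj by (simp add: projective_object_def)
    have lift: "\<exists>h\<in>mod_morphisms R Q M. \<forall>q\<in>carrier Q. p (h q) = g q"
      if M: "mod_object R M" and N: "mod_object R N" and epi: "mod_epi R M N p"
        and g: "g \<in> mod_morphisms R Q N" for M N :: "('r, 'm) module" and p g
    proof -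
      interpret lifting_problem E C R S \<rho> P Q M N i p g
      proof unfold_locales
        show "inj_on i (carrier Q)" by (rule mono_injective[OF Q P mono])
        show "p ` carrier M = carrier N" by (rule epi_surjective[OF M N epi])
        show "i \<in> mod_morphisms R Q P" "p \<in> mod_morphisms R M N"
          using mono epi by (simp_all add: mod_mono_def mod_epi_def)
      qed (fact P Q M N g)+
      show ?thesis
        using proj pair by (rule exists_lift)
    qed
    then show "projective_object R Q"
      using Q by (auto simp: projective_object_def)
  qed
qed

section \<open>Presented algebras\<close>

locale presentation =
  fixes G :: "'g set" and Rels :: "('g free_word \<Rightarrow>\<^sub>0 'k::field) set"
  assumes Rels: "Rels \<subseteq> carrier (free_algebra TYPE('k) G)"
begin

abbreviation FA where "FA \<equiv> carrier (free_algebra TYPE('k) G)"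

definition rel_ideal :: "('g free_word \<Rightarrow>\<^sub>0 'k) set"
  where "rel_ideal = \<Inter>{I. algebra_ideal G I \<and> Rels \<subseteq> I}"

definition coset :: "('g free_word \<Rightarrow>\<^sub>0 'k) \<Rightarrow> ('g free_word \<Rightarrow>\<^sub>0 'k) set"
  where "coset f = (\<lambda>h. h + f) ` rel_ideal"

lemma free_algebra_ideal: "algebra_ideal G FA"
  by (intro algebra_idealI)
    (auto intro: free_algebra_zero free_algebra_add free_algebra_scalar free_algebra_mult)

lemma rel_ideal_least: "\<lbrakk>algebra_ideal G I; Rels \<subseteq> I\<rbrakk> \<Longrightarrow> rel_ideal \<subseteq> I"
  by (auto simp: rel_ideal_def)

lemma Rels_rel_ideal: "Rels \<subseteq> rel_ideal"
  by (auto simp: rel_ideal_def)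

text \<open>
  The intersection is not over the empty family, because the free algebra is itself an ideal
  that contains the relations.
\<close>

lemma rel_ideal_ideal: "algebra_ideal G rel_ideal"
proof (rule algebra_idealI)
  show "rel_ideal \<subseteq> FA"
    using free_algebra_ideal Rels by (rule rel_ideal_least)
qed (auto simp: rel_ideal_def algebra_idealD)

lemmas rel_ideal_simps = algebra_idealD[OF rel_ideal_ideal]

lemma coset_self: "f \<in> coset f"
  unfolding coset_def by (rule image_eqI[of _ _ 0]) (simp_all add: rel_ideal_simps(2))

lemma coset_eq_iff: "coset f = coset g \<longleftrightarrow> f - g \<in> rel_ideal"
proof
  assume "coset f = coset g"
  then have "f \<in> coset g"
    using coset_self[of f] by simp
  then show "f - g \<in> rel_ideal"
    by (auto simp: coset_def)
next
  have sub: "coset f \<subseteq> coset g" if "f - g \<in> rel_ideal" for f g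
  proof
    fix x assume "x \<in> coset f"
    then obtain h where h: "h \<in> rel_ideal" "x = h + f" by (auto simp: coset_def)
    then have "x = (h + (f - g)) + g" "h + (f - g) \<in> rel_ideal"
      using rel_ideal_simps(3) that by auto
    then show "x \<in> coset g" unfolding coset_def by blast
  qed
  assume fg: "f - g \<in> rel_ideal"
  then have "g - f \<in> rel_ideal"
    using rel_ideal_simps(7)[OF fg] by simp
  with fg show "coset f = coset g"
    using sub by blast
qed

lemma a_r_coset_eq: "rel_ideal +>\<^bsub>free_algebra TYPE('k) G\<^esub> f = coset f"
  by (auto simp: a_r_coset_def' coset_def free_algebra_simps)

abbreviation R where "R \<equiv> presented_algebra G Rels"

lemma carrier_R: "carrier R = coset ` FA"
  unfolding presented_algebra_def FactRing_def rel_ideal_def[symmetric]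
  by (auto simp: A_RCOSETS_def' a_r_coset_eq)

lemma zero_R: "\<zero>\<^bsub>R\<^esub> = coset 0"
  unfolding presented_algebra_def FactRing_def rel_ideal_def[symmetric]
  by (simp add: coset_def)

lemma add_R: "coset f \<oplus>\<^bsub>R\<^esub> coset g = coset (f + g)"
proof -
  have "coset f \<oplus>\<^bsub>R\<^esub> coset g = (\<Union>a\<in>coset f. \<Union>b\<in>coset g. {a + b})"
    unfolding presented_algebra_def FactRing_def rel_ideal_def[symmetric]
    by (simp add: set_add_def' free_algebra_simps)
  also have "\<dots> = coset (f + g)"
  proof (intro equalityI subsetI)
    fix x assume "x \<in> (\<Union>a\<in>coset f. \<Union>b\<in>coset g. {a + b})"
    then obtain h k where "h \<in> rel_ideal" "k \<in> rel_ideal" "x = (h + f) + (k + g)"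
      by (auto simp: coset_def)
    then have "h + k \<in> rel_ideal" "x = (h + k) + (f + g)"
      using rel_ideal_simps(3) by (auto simp: algebra_simps)
    then show "x \<in> coset (f + g)" unfolding coset_def by blast
  next
    fix x assume "x \<in> coset (f + g)"
    then obtain h where "h \<in> rel_ideal" "x = (h + f) + (0 + g)"
      by (auto simp: coset_def algebra_simps)
    then show "x \<in> (\<Union>a\<in>coset f. \<Union>b\<in>coset g. {a + b})"
      using rel_ideal_simps(2) unfolding coset_def by blast
  qed
  finally show ?thesis .
qed

lemma mult_R:
  assumes f: "f \<in> FA" and g: "g \<in> FA"
  shows "coset f \<otimes>\<^bsub>R\<^esub> coset g = coset (f * g)"
proof -
  have const: "coset (a * b) = coset (f * g)" if a: "a \<in> coset f" and b: "b \<in> coset g" for a b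
  proof -
    obtain h k where h: "h \<in> rel_ideal" "a = h + f" and k: "k \<in> rel_ideal" "b = k + g"
      using a b by (auto simp: coset_def)
    have "b \<in> FA"
      using k g rel_ideal_simps(1) by (auto intro: free_algebra_add)
    then have "h * b + f * k \<in> rel_ideal"
      using h k f rel_ideal_simps(3,5,6) by blast
    moreover have "a * b - f * g = h * b + f * k"
      using h k by (simp add: algebra_simps)
    ultimately show ?thesis by (simp add: coset_eq_iff)
  qed
  have "coset f \<otimes>\<^bsub>R\<^esub> coset g = (\<Union>a\<in>coset f. \<Union>b\<in>coset g. coset (a * b))"
    unfolding presented_algebra_def FactRing_def rel_ideal_def[symmetric]
    by (simp add: rcoset_mult_def a_r_coset_eq free_algebra_simps)
  also have "\<dots> = (\<Union>a\<in>coset f. \<Union>b\<in>coset g. coset (f * g))"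
    by (intro SUP_cong refl) (rule const)
  also have "\<dots> = coset (f * g)"
    using coset_self[of f] coset_self[of g] by blast
  finally show ?thesis .
qed

lemma nonunital_ring_R: "nonunital_ring R"
proof -
  note coset_simps = add_R mult_R zero_R free_algebra_add free_algebra_mult free_algebra_zero
  have "abelian_group R"
  proof (rule abelian_groupI)
    fix x assume "x \<in> carrier R"
    then obtain f where "f \<in> FA" "x = coset f" by (auto simp: carrier_R)
    then show "\<exists>y\<in>carrier R. y \<oplus>\<^bsub>R\<^esub> x = \<zero>\<^bsub>R\<^esub>"
      by (intro bexI[of _ "coset (- f)"]) (auto simp: carrier_R coset_simps free_algebra_uminus)
  qed (auto simp: carrier_R coset_simps ac_simps)
  then show ?thesis
    by (rule nonunital_ring.intro)
      (unfold_locales; auto simp: carrier_R coset_simps algebra_simps)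
qed

end

section \<open>The involution\<close>

text \<open>
  The relations are invariant under the anti-automorphism that exchanges \<open>e\<close> and \<open>e\<^sup>*\<close> and reverses
  words. Composing the quotient map with it presents the opposite ring by the same relations.
\<close>

fun star_gen :: "('v, 'e) gen \<Rightarrow> ('v, 'e) gen"
  where "star_gen (Vertex v) = Vertex v"
  | "star_gen (Edge e) = Ghost e"
  | "star_gen (Ghost e) = Edge e"

definition star_word :: "('v, 'e) gen free_word \<Rightarrow> ('v, 'e) gen free_word"
  where "star_word w = Free_Word (rev (map star_gen (letters w)))"

definition star :: "(('v, 'e) gen free_word \<Rightarrow>\<^sub>0 'k::field) \<Rightarrow> (('v, 'e) gen free_word \<Rightarrow>\<^sub>0 'k)"
  where "star = Poly_Mapping.map_key star_word"

lemma star_gen_star_gen [simp]: "star_gen (star_gen g) = g"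
  by (cases g) auto

lemma star_word_star_word [simp]: "star_word (star_word w) = w"
  by (simp add: star_word_def rev_map comp_def)

lemma inj_star_word: "inj star_word"
  by (metis injI star_word_star_word)

lemma star_word_plus: "star_word (v + w) = star_word w + star_word v"
  by (simp add: star_word_def plus_free_word_def)

lemma star_word_zero: "star_word 0 = 0"
  by (simp add: star_word_def zero_free_word_def)

lemma star_single: "star (Poly_Mapping.single w c) = Poly_Mapping.single (star_word w) c"
  using map_key_single[OF inj_star_word, of "star_word w" c] by (simp add: star_def)

lemma star_add: "star (f + g) = star f + star g"
  by (simp add: star_def map_key_plus[OF inj_star_word])

lemma star_zero: "star 0 = 0"
  by (simp add: star_def map_key_zero[OF inj_star_word])

lemma star_diff: "star (f - g) = star f - star g"
  using star_add[of "f - g" g] by (simp add: algebra_simps)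

lemma star_sum: "star (sum f A) = (\<Sum>i\<in>A. star (f i))"
  by (induction A rule: infinite_finite_induct) (auto simp: star_zero star_add)

lemma star_mult: "star (f * g) = star g * star f"
proof -
  have single: "star (Poly_Mapping.single w c * g) = star g * Poly_Mapping.single (star_word w) c" for w c
  proof -
    have "Poly_Mapping.keys g \<subseteq> UNIV" by simp
    then show ?thesis
      by (induction g rule: free_word_poly_induct)
        (auto simp: star_zero star_single star_add mult_single star_word_plus algebra_simps)
  qed
  have "Poly_Mapping.keys f \<subseteq> UNIV" by simp
  then show ?thesis
    by (induction f rule: free_word_poly_induct)
      (auto simp: star_zero star_single star_add single algebra_simps)
qed

lemma star_star [simp]: "star (star f) = f"
proof -
  have "Poly_Mapping.keys f \<subseteq> UNIV" by simp
  then show ?thesis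
    by (induction f rule: free_word_poly_induct) (auto simp: star_zero star_single star_add)
qed

lemma star_gen_elem: "star (gen_elem g) = gen_elem (star_gen g)"
  by (simp add: gen_elem_def star_single star_word_def)

lemma star_carrier:
  assumes "f \<in> carrier (free_algebra TYPE('k::field) (cl_generators E))"
  shows "star f \<in> carrier (free_algebra TYPE('k) (cl_generators E))"
  using assms
proof (induction f rule: free_algebra_induct)
  case (single w c)
  have "star_gen ` cl_generators E \<subseteq> cl_generators E"
    by (auto simp: cl_generators_def)
  with single have "set (letters (star_word w)) \<subseteq> cl_generators E" "letters (star_word w) \<noteq> []"
    by (auto simp: star_word_def)
  then show ?case
    unfolding star_single by (intro free_algebra_single)
qed (auto simp: star_zero star_add intro: free_algebra_zero free_algebra_add)

lemma star_relation:
  assumes "f \<in> cl_relations E C S"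
  shows "star f \<in> cl_relations E C S"
proof -
  note star_simps = star_diff star_mult star_gen_elem star_zero star_sum
  from assms consider
    (V) v w where "v \<in> verts E" "w \<in> verts E"
      "f = vertex_elem v * vertex_elem w - (if v = w then vertex_elem v else 0)"
  | (E1) e where "e \<in> arcs E" "f = vertex_elem (tail E e) * edge_elem e - edge_elem e"
  | (E1') e where "e \<in> arcs E" "f = edge_elem e * vertex_elem (head E e) - edge_elem e"
  | (E2) e where "e \<in> arcs E" "f = vertex_elem (head E e) * ghost_elem e - ghost_elem e"
  | (E2') e where "e \<in> arcs E" "f = ghost_elem e * vertex_elem (tail E e) - ghost_elem e"
  | (SCK1) e e' X where "X \<in> all_classes E C" "e \<in> X" "e' \<in> X"
      "f = ghost_elem e * edge_elem e' - (if e = e' then vertex_elem (head E e) else 0)"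
  | (SCK2) v X where "v \<in> verts E" "X \<in> S \<inter> C v"
      "f = vertex_elem v - (\<Sum>e\<in>X. edge_elem e * ghost_elem e)"
    unfolding cl_relations_def by blast
  then show ?thesis
  proof cases
    case V
    then have "star f = vertex_elem w * vertex_elem v - (if w = v then vertex_elem w else 0)"
      by (auto simp: star_simps)
    with V show ?thesis unfolding cl_relations_def by blast
  next
    case E1
    then have "star f = ghost_elem e * vertex_elem (tail E e) - ghost_elem e"
      by (simp add: star_simps)
    with E1 show ?thesis unfolding cl_relations_def by blast
  next
    case E1'
    then have "star f = vertex_elem (head E e) * ghost_elem e - ghost_elem e"
      by (simp add: star_simps)
    with E1' show ?thesis unfolding cl_relations_def by blast
  next
    case E2
    then have "star f = edge_elem e * vertex_elem (head E e) - edge_elem e"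
      by (simp add: star_simps)
    with E2 show ?thesis unfolding cl_relations_def by blast
  next
    case E2'
    then have "star f = vertex_elem (tail E e) * edge_elem e - edge_elem e"
      by (simp add: star_simps)
    with E2' show ?thesis unfolding cl_relations_def by blast
  next
    case SCK1
    then have "star f = ghost_elem e' * edge_elem e - (if e' = e then vertex_elem (head E e') else 0)"
      by (auto simp: star_simps)
    with SCK1 show ?thesis unfolding cl_relations_def by blast
  next
    case SCK2
    then have "star f = vertex_elem v - (\<Sum>e\<in>X. edge_elem e * ghost_elem e)"
      by (simp add: star_simps)
    with SCK2 show ?thesis unfolding cl_relations_def by blast
  qed
qed

section \<open>Cohn--Leavitt algebras are hereditary\<close>

lemma nonunital_ring_opposite:
  assumes "nonunital_ring R"
  shows "nonunital_ring (opposite_ring R)"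
proof -
  interpret nonunital_ring R by fact
  have simps: "carrier (opposite_ring R) = carrier R" "add (opposite_ring R) = add R"
    "zero (opposite_ring R) = zero R" "mult (opposite_ring R) = (\<lambda>a b. b \<otimes>\<^bsub>R\<^esub> a)"
    by (simp_all add: opposite_ring_def)
  have "abelian_group (opposite_ring R)"
    by (rule abelian_group_cong[OF abelian_group_axioms]) (simp_all add: simps)
  then show ?thesis
    by (rule nonunital_ring.intro)
      (unfold_locales; simp add: simps m_closed m_assoc l_distr r_distr)
qed

theorem theorem3p7:
  fixes E :: "('v, 'e) pre_digraph"
    and C :: "'v \<Rightarrow> 'e set set"
    and S :: "'e set set"
  assumes "separated_graph E C"
    and "S \<subseteq> fin_classes E C"
    and "infinite (UNIV :: 'm set)"
    and "carrier (cohn_leavitt_algebra TYPE('k::field) E C S) \<lesssim> (UNIV :: 'm set)"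
  shows "hereditary TYPE('m) (cohn_leavitt_algebra TYPE('k) E C S)"
proof -
  interpret separated_graph E C by fact
  let ?Rels = "cl_relations E C S :: (('v, 'e) gen free_word \<Rightarrow>\<^sub>0 'k) set"
  let ?R = "cohn_leavitt_algebra TYPE('k) E C S"
  interpret pres: presentation "cl_generators E" ?Rels
    by unfold_locales (rule cl_relations_carrier)
  have R: "?R = pres.R"
    by (simp add: cohn_leavitt_algebra_def)
  interpret left: cl_presentation E C pres.R S pres.coset
  proof (intro cl_presentation.intro cl_presentation_axioms.intro)
    show "pres.coset f = pres.coset g" if "f - g \<in> ?Rels" for f g
      using that pres.Rels_rel_ideal by (auto simp: pres.coset_eq_iff)
    show "f - g \<in> I" if "pres.coset f = pres.coset g" "algebra_ideal (cl_generators E) I" "?Rels \<subseteq> I"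
      for f g I
      using that pres.rel_ideal_least by (auto simp: pres.coset_eq_iff)
  qed (use assms pres.nonunital_ring_R in \<open>auto simp: pres.carrier_R pres.add_R pres.mult_R\<close>)
  have opposite_simps: "carrier (opposite_ring pres.R) = carrier pres.R"
    "add (opposite_ring pres.R) = add pres.R" "mult (opposite_ring pres.R) = (\<lambda>a b. b \<otimes>\<^bsub>pres.R\<^esub> a)"
    by (simp_all add: opposite_ring_def)
  interpret right: cl_presentation E C "opposite_ring pres.R" S "\<lambda>f. pres.coset (star f)"
  proof (intro cl_presentation.intro cl_presentation_axioms.intro)
    show "nonunital_ring (opposite_ring pres.R)"
      using pres.nonunital_ring_R by (rule nonunital_ring_opposite)
    show "\<exists>f\<in>pres.FA. a = pres.coset (star f)" if "a \<in> carrier (opposite_ring pres.R)" for a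
      using that star_carrier by (fastforce simp: opposite_simps pres.carrier_R intro: bexI[of _ "star _"])
    show "pres.coset (star f) = pres.coset (star g)" if "f - g \<in> ?Rels" for f g
      using star_relation[OF that] pres.Rels_rel_ideal by (auto simp: pres.coset_eq_iff star_diff)
    show "f - g \<in> I" if fg: "f \<in> pres.FA" "g \<in> pres.FA" and eq: "pres.coset (star f) = pres.coset (star g)"
      and I: "algebra_ideal (cl_generators E) I" "?Rels \<subseteq> I" for f g I
    proof -
      let ?J = "{h \<in> pres.FA. star h \<in> I}"
      have "algebra_ideal (cl_generators E) ?J"
      proof (rule algebra_idealI)
        show "Poly_Mapping.single 0 c * h \<in> ?J" if "h \<in> ?J" for c h
        proof -
          have "star (Poly_Mapping.single 0 c * h) = Poly_Mapping.single 0 c * star h"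
            by (simp add: star_mult star_single star_word_zero single_central)
          with that show ?thesis
            using algebra_idealD(4)[OF I(1)] by (auto intro: free_algebra_scalar)
        qed
        show "f * h \<in> ?J \<and> h * f \<in> ?J" if "f \<in> pres.FA" "h \<in> ?J" for f h
          using that algebra_idealD(5,6)[OF I(1) star_carrier[OF that(1)]]
          by (auto simp: star_mult intro: free_algebra_mult)
      qed (use algebra_idealD[OF I(1)] in \<open>auto simp: star_zero star_add
          intro: free_algebra_zero free_algebra_add\<close>)
      moreover have "?Rels \<subseteq> ?J"
        using star_relation I(2) pres.Rels by blast
      ultimately have "pres.rel_ideal \<subseteq> ?J"
        by (rule pres.rel_ideal_least)
      moreover have "star f - star g \<in> pres.rel_ideal"
        using eq by (simp add: pres.coset_eq_iff)
      ultimately show ?thesis by (auto simp: star_diff)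
    qed
    show "pres.coset (star (f * g)) = pres.coset (star f) \<otimes>\<^bsub>opposite_ring pres.R\<^esub> pres.coset (star g)"
      if "f \<in> pres.FA" "g \<in> pres.FA" for f g
      using star_carrier[OF that(1)] star_carrier[OF that(2)]
      by (simp add: opposite_simps star_mult pres.mult_R)
    show "pres.coset (star f) \<in> carrier (opposite_ring pres.R)" if "f \<in> pres.FA" for f
      using star_carrier[OF that] by (simp add: opposite_simps pres.carrier_R)
  qed (use assms in \<open>auto simp: opposite_simps pres.add_R star_add\<close>)
  show ?thesis
    unfolding hereditary_def right_hereditary_def R
    using pres.nonunital_ring_R left.presentation_left_hereditary[OF assms(3)]
      right.presentation_left_hereditary[OF assms(3)] by blast
qed

end
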